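(* Let $1\le\alpha\le2$. For any $\varepsilon\in(0,1)$ there exists a constant $C>0$ depending only on $\alpha$ and $\varepsilon$ such that the following holds for all integers $n\ge3$ and $p\ge1$. If $$\rho_{t_0}\ge C\Biggl\{\sqrt{\frac p{t_0\wedge(n-t_0)}}+\Bigl(\frac p{t_0\wedge(n-t_0)}\Bigr)^{\frac{\alpha-1}\alpha}+\Bigl(\frac{\log\log(n)}{t_0\wedge(n-t_0)}\Bigr)^{\frac{\alpha-1}\alpha}\Biggr\}\quad\text{for all }t_0\in[n-1],$$ then there exists a test $\phi^{\mathrm{RM}}_{\mathcal{W}_\alpha}$ such that $$\mathcal{R}_{\mathcal{W}_\alpha^{\otimes}}\bigl(\{\rho_{t_0}\}_{t_0\in[n-1]},\phi^{\mathrm{RM}}_{\mathcal{W}_\alpha}\bigr)\le\varepsilon.$$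
   Context: Notation: $[m]=\{1,\dots,m\}$; $x\wedge y=\min(x,y)$; $\log$ is the natural logarithm. Model: $X=\theta+E\in\mathbb{R}^{p\times n}$, with deterministic $\theta$ and random $E\sim P_e$; $\theta_t\in\mathbb{R}^p$ denotes the $t$-th column. $\mathbb{E}_{\theta,P_e}$ is expectation under the law of $X$. A test is a measurable map $\phi:\mathbb{R}^{p\times n}\to\{0,1\}$. Null space: $\Theta_0(p,n)=\{\theta:\exists\mu\in\mathbb{R}^p,\ \theta_t=\mu\ \forall t\in[n]\}$. For a sequence $\{\rho_{t_0}\}_{t_0\in[n-1]}$, $\Theta(p,n,\rho_{t_0})$ is the set of $\theta$ for which there are $\mu_1,\mu_2\in\mathbb{R}^p$ with $\theta_t=\mu_1$ for $t=1,\dots,t_0$, $\theta_t=\mu_2$ for $t=t_0+1,\dots,n$ and $\|\mu_1-\mu_2\|_2^2\ge\rho_{t_0}^2$. The alternative is $\theta\in\bigcup_{t_0=1}^{n-1}\Theta(p,n,\rho_{t_0})$. Noise class: $\mathcal{W}_\alpha$ is the class of distributions of random vectors $W\in\mathbb{R}^p$ with $\mathbb{E}W=0$ and $\mathbb{E}|\langle W,v\rangle|^\alpha\le1$ for all $v\in\mathbb{R}^p$ with $\|v\|_2=1$. $\mathcal{W}_\alpha^{\otimes}$ is the class of distributions of $E$ with independent columns, each column having a (possibly different) distribution in $\mathcal{W}_\alpha$. Worst-case testing error: $$\mathcal{R}_{\mathcal{W}_\alpha^{\otimes}}(\{\rho_{t_0}\},\phi)=\sup_{P_e\in\mathcal{W}_\alpha^{\otimes}}\sup_{\theta\in\Theta_0(p,n)}\mathbb{E}_{\theta,P_e}(\phi)+\sup_{P_e\in\mathcal{W}_\alpha^{\otimes}}\sup_{\theta\in\bigcup_{t_0=1}^{n-1}\Theta(p,n,\rho_{t_0})}\mathbb{E}_{\theta,P_e}(1-\phi).$$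 *)

theory Defs
  imports "HOL-Probability.Probability"
begin

text \<open>
  The dimensions \<open>p\<close> and \<open>n\<close> are quantified after the constant in the main statement, so they
  cannot be types. A vector in \<open>\<real>\<^sup>p\<close> is an extensional function on \<open>{1..p}\<close>, and a
  \<open>p \<times> n\<close> matrix is the extensional family of its columns: \<open>X t i\<close> is the entry in row \<open>i\<close> and
  column \<open>t\<close>. The finite product sigma-algebras below are the Borel sigma-algebras.
\<close>

definition vec_borel :: "nat \<Rightarrow> (nat \<Rightarrow> real) measure" where
  "vec_borel p = (\<Pi>\<^sub>M i\<in>{1..p}. borel)"

definition mat_borel :: "nat \<Rightarrow> nat \<Rightarrow> (nat \<Rightarrow> nat \<Rightarrow> real) measure" where
  "mat_borel p n = (\<Pi>\<^sub>M t\<in>{1..n}. vec_borel p)"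

definition null_space :: "nat \<Rightarrow> nat \<Rightarrow> (nat \<Rightarrow> nat \<Rightarrow> real) set" where
  "null_space p n =
     {\<theta> \<in> space (mat_borel p n). \<exists>\<mu> \<in> space (vec_borel p). \<forall>t\<in>{1..n}. \<theta> t = \<mu>}"

definition change_at :: "nat \<Rightarrow> nat \<Rightarrow> nat \<Rightarrow> real \<Rightarrow> (nat \<Rightarrow> nat \<Rightarrow> real) set" where
  "change_at p n t0 r =
     {\<theta> \<in> space (mat_borel p n). \<exists>\<mu>1 \<in> space (vec_borel p). \<exists>\<mu>2 \<in> space (vec_borel p).
        (\<forall>t\<in>{1..t0}. \<theta> t = \<mu>1) \<and> (\<forall>t\<in>{t0+1..n}. \<theta> t = \<mu>2) \<and>
        (L2_set (\<lambda>i. \<mu>1 i - \<mu>2 i) {1..p})\<^sup>2 \<ge> r\<^sup>2}"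

definition alternative :: "nat \<Rightarrow> nat \<Rightarrow> (nat \<Rightarrow> real) \<Rightarrow> (nat \<Rightarrow> nat \<Rightarrow> real) set" where
  "alternative p n \<rho> = (\<Union>t0\<in>{1..n-1}. change_at p n t0 (\<rho> t0))"

definition noise_class :: "real \<Rightarrow> nat \<Rightarrow> (nat \<Rightarrow> real) measure set" where
  "noise_class \<alpha> p =
     {Q. prob_space Q \<and> sets Q = sets (vec_borel p) \<and>
         (\<forall>i\<in>{1..p}. integrable Q (\<lambda>w. w i) \<and> (\<integral>w. w i \<partial>Q) = 0) \<and>
         (\<forall>v \<in> space (vec_borel p). L2_set v {1..p} = 1 \<longrightarrow>
            (\<integral>\<^sup>+w. ennreal (\<bar>\<Sum>i\<in>{1..p}. w i * v i\<bar> powr \<alpha>) \<partial>Q) \<le> 1)}"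

definition indep_noise_class :: "real \<Rightarrow> nat \<Rightarrow> nat \<Rightarrow> (nat \<Rightarrow> nat \<Rightarrow> real) measure set" where
  "indep_noise_class \<alpha> p n =
     {P. prob_space P \<and> sets P = sets (mat_borel p n) \<and>
         prob_space.indep_vars P (\<lambda>_. vec_borel p) (\<lambda>t E. E t) {1..n} \<and>
         (\<forall>t\<in>{1..n}. distr P (vec_borel p) (\<lambda>E. E t) \<in> noise_class \<alpha> p)}"

definition data_law ::
    "nat \<Rightarrow> nat \<Rightarrow> (nat \<Rightarrow> nat \<Rightarrow> real) \<Rightarrow> (nat \<Rightarrow> nat \<Rightarrow> real) measure \<Rightarrow>
     (nat \<Rightarrow> nat \<Rightarrow> real) measure" where
  "data_law p n \<theta> P =
     distr P (mat_borel p n) (\<lambda>E. \<lambda>t\<in>{1..n}. \<lambda>i\<in>{1..p}. \<theta> t i + E t i)"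

definition is_test :: "nat \<Rightarrow> nat \<Rightarrow> ((nat \<Rightarrow> nat \<Rightarrow> real) \<Rightarrow> real) \<Rightarrow> bool" where
  "is_test p n \<phi> \<longleftrightarrow> \<phi> \<in> mat_borel p n \<rightarrow>\<^sub>M count_space {0, 1}"

text \<open>
  For a test the integrands are \<open>{0, 1}\<close>-valued, so the Lebesgue integrals below are the usual
  expectations; the suprema are taken in the complete lattice of extended nonnegative reals.
\<close>

definition testing_error ::
    "real \<Rightarrow> nat \<Rightarrow> nat \<Rightarrow> (nat \<Rightarrow> real) \<Rightarrow> ((nat \<Rightarrow> nat \<Rightarrow> real) \<Rightarrow> real) \<Rightarrow> ennreal" where
  "testing_error \<alpha> p n \<rho> \<phi> =
     (SUP P\<in>indep_noise_class \<alpha> p n. SUP \<theta>\<in>null_space p n.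
        \<integral>\<^sup>+X. ennreal (\<phi> X) \<partial>data_law p n \<theta> P) +
     (SUP P\<in>indep_noise_class \<alpha> p n. SUP \<theta>\<in>alternative p n \<rho>.
        \<integral>\<^sup>+X. ennreal (1 - \<phi> X) \<partial>data_law p n \<theta> P)"

end

theory Submission
  imports Defs
begin

text \<open>
  The columns are compared in mirrored pairs: under a change at \<open>t0\<close> the differences
  \<open>X i - X (n + 1 - i)\<close> with \<open>i \<le> m \<le> min t0 (n - t0)\<close> are independent, have heavy-tailed noise and the
  common shift \<open>d = \<mu>1 - \<mu>2\<close>; under the null hypothesis they have mean zero. So it suffices to test
  \<open>d = 0\<close> at every dyadic scale \<open>m = 2 ^ j\<close>, with false alarm probabilities summable over the scales.
  Three tests are combined.

  Shifts of norm at least of order \<open>sqrt p\<close> are seen in the first difference alone, because the expected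
  noise norm is \<open>O(sqrt p)\<close> by averaging the directional moments over random signs.

  If \<open>m < K p\<close>, the norm of the sum of the differences, each discarded when its norm exceeds a multiple
  \<open>R\<close> of \<open>sqrt p\<close>, is used. Discarding costs a bias \<open>O(1)\<close>. The diagonal part of the squared norm is
  at most \<open>4 R\<^sup>2 m\<close>, while the off-diagonal part is a martingale with second moment \<open>O(R\<^sup>3 m\<^sup>2)\<close>.
  By Chebyshev's inequality it exceeds a multiple of \<open>p m\<close> with probability \<open>O(1 / sqrt p)\<close>, hence
  \<open>O(1 / sqrt m)\<close>, which is summable over dyadic \<open>m\<close>.

  If \<open>m \<ge> K p\<close>, the sums of \<open>clip (l * \<langle>D i, v\<rangle>)\<close> are maximised over \<open>exp (O(p))\<close> directions \<open>v\<close>. The inequality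
  \<open>exp (- clip y) \<le> 1 - y + O(\<bar>y\<bar> powr \<alpha>)\<close> turns the \<open>\<alpha>\<close>-th moment into an exponential tail bound. The
  confidence level is \<open>exp (- min (c m) (B ln ln n))\<close>: the first term is summable over all scales, and the
  second one survives a union bound over the \<open>O(ln n)\<close> scales.
\<close>

text \<open>Keeps the index sets \<open>{1..p}\<close> from being rewritten to \<open>{Suc 0..p}\<close>.\<close>
declare One_nat_def [simp del]

section \<open>An exponential inequality for clipped variables\<close>

definition clip :: "real \<Rightarrow> real" where
  "clip y = max (-1) (min 1 y)"

lemma clip_mono: "x \<le> y \<Longrightarrow> clip x \<le> clip y"
  by (auto simp: clip_def)

lemma borel_measurable_clip [measurable]: "clip \<in> borel_measurable borel"
  unfolding clip_def[abs_def] by measurable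

text \<open>For \<open>z \<ge> 0\<close> invert \<open>exp z \<ge> 1 + z\<close> and use (1 - z +
  z^2)(1 + z) = 1 + z^3; for negative \<open>z\<close> this is the library bound on [0, 1] applied
  to \<open>- z\<close>.\<close>

lemma exp_minus_le_quadratic:
  fixes z :: real
  assumes "\<bar>z\<bar> \<le> 1"
  shows "exp (- z) \<le> 1 - z + z\<^sup>2"
proof (cases "z \<ge> 0")
  case True
  have "exp (- z) \<le> 1 / (1 + z)"
    using exp_ge_add_one_self[of z] True by (simp add: exp_minus divide_simps)
  also have "\<dots> \<le> 1 - z + z\<^sup>2"
  proof -
    have "1 \<le> (1 - z + z\<^sup>2) * (1 + z)"
      using True by (simp add: algebra_simps power2_eq_square)
    then show ?thesis using True by (simp add: divide_simps)
  qed
  finally show ?thesis .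
next
  case False
  then show ?thesis using exp_bound[of "- z"] assms by simp
qed

text \<open>Powers of a number at most 1 decrease in the exponent. With \<open>abs_le_powr\<close>
  this covers both regimes of the \<alpha>-th power: it dominates the square near zero and the
  absolute value far away.\<close>

lemma square_le_powr:
  fixes x \<alpha> :: real
  assumes "\<bar>x\<bar> \<le> 1" "\<alpha> \<le> 2"
  shows "x\<^sup>2 \<le> \<bar>x\<bar> powr \<alpha>"
proof (cases "x = 0")
  case False
  have "x\<^sup>2 = \<bar>x\<bar> powr 2" using False by simp
  also have "\<dots> \<le> \<bar>x\<bar> powr \<alpha>" using assms False by (intro powr_mono') auto
  finally show ?thesis .
qed auto

lemma abs_le_powr:
  fixes x \<alpha> :: real
  assumes "1 \<le> \<bar>x\<bar>" "1 \<le> \<alpha>"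
  shows "\<bar>x\<bar> \<le> \<bar>x\<bar> powr \<alpha>"
  using powr_mono[of 1 \<alpha> "\<bar>x\<bar>"] assms by simp

text \<open>With \<open>a = 0\<close> this controls false alarms, with \<open>a > 0\<close> the power of the clipped test.\<close>

lemma exp_clip_le:
  fixes a x \<alpha> :: real
  assumes a: "\<bar>a\<bar> \<le> 1/4" and \<alpha>: "1 \<le> \<alpha>" "\<alpha> \<le> 2"
  shows "exp (- clip (a + x)) \<le> 1 - (a + x) + 2 * a\<^sup>2 + 4 * \<bar>x\<bar> powr \<alpha>"
proof -
  consider "\<bar>a + x\<bar> \<le> 1" | "a + x > 1" | "a + x < -1" by linarith
  then show ?thesis
  proof cases
    case 1
    have "exp (- clip (a + x)) \<le> 1 - (a + x) + (a + x)\<^sup>2"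
      using exp_minus_le_quadratic[OF 1] 1 by (simp add: clip_def abs_le_iff)
    moreover have "(a + x)\<^sup>2 \<le> 2 * a\<^sup>2 + 4 * \<bar>x\<bar> powr \<alpha>"
    proof (cases "\<bar>x\<bar> \<le> 1")
      case True
      have "(a + x)\<^sup>2 \<le> 2 * a\<^sup>2 + 2 * x\<^sup>2"
        using zero_le_power2[of "a - x"] by (simp add: power2_eq_square algebra_simps)
      then show ?thesis using square_le_powr[OF True \<alpha>(2)] by (smt (verit) powr_ge_zero)
    next
      case False
      have "(a + x)\<^sup>2 \<le> 1" using 1 by (simp add: abs_square_le_1)
      then show ?thesis using abs_le_powr[of x \<alpha>] False \<alpha> by (smt (verit) zero_le_power2)
    qed
    ultimately show ?thesis by linarith
  next
    case 2
    \<comment> \<open>The clipped value is 1 and exp (-1) is at most 1, so it remains to dominate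
      \<open>a + x\<close>. As |a| is at most 1/4, the excess comes mainly from \<open>x\<close>,
      and \<open>a + x \<le> 3 * x\<close>.\<close>
    have x: "x \<ge> 3/4" using 2 a by linarith
    have "3 * x \<le> 4 * \<bar>x\<bar> powr \<alpha>"
    proof (cases "x \<le> 1")
      case True
      have "(3/4) * x \<le> x\<^sup>2" using x by (simp add: power2_eq_square)
      then show ?thesis using square_le_powr[of x \<alpha>] True x \<alpha> by linarith
    next
      case False
      then show ?thesis using abs_le_powr[of x \<alpha>] \<alpha> by linarith
    qed
    moreover have "exp (- clip (a + x)) \<le> 1" using 2 by (simp add: clip_def)
    moreover have "0 \<le> a\<^sup>2" by simp
    ultimately show ?thesis using x a by linarith
  next
    case 3
    \<comment> \<open>The right-hand side exceeds 2 + 4 * 9/16, because - (a + x) > 1 and the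
      \<alpha>-th power is at least 9/16; the left-hand side is exp 1, at most 3.\<close>
    have x: "x \<le> -3/4" using 3 a by linarith
    have "9/16 \<le> \<bar>x\<bar> powr \<alpha>"
    proof (cases "\<bar>x\<bar> \<le> 1")
      case True
      have "(3/4)\<^sup>2 \<le> \<bar>x\<bar>\<^sup>2" using x by (intro power_mono) auto
      then show ?thesis using square_le_powr[OF True \<alpha>(2)] by (simp add: power2_eq_square)
    next
      case False
      then show ?thesis using abs_le_powr[of x \<alpha>] \<alpha> by linarith
    qed
    moreover have "exp (- clip (a + x)) \<le> 3" using 3 exp_le by (simp add: clip_def)
    moreover have "0 \<le> a\<^sup>2" by simp
    ultimately show ?thesis using 3 by linarith
  qed
qed

section \<open>Averaging over signs\<close>

text \<open>A vector of signs is encoded by the set \<open>A\<close> of indices carrying the sign \<open>+\<close>.\<close>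

definition sign_sum :: "('b \<Rightarrow> real) \<Rightarrow> 'b set \<Rightarrow> 'b set \<Rightarrow> real" where
  "sign_sum a I A = (\<Sum>i\<in>I. if i \<in> A then a i else - a i)"

text \<open>The recursion behind all sign averages: subsets of \<open>insert x I\<close> are split
  by membership of \<open>x\<close>, so the sign at \<open>x\<close> takes both values for each
  choice of the other signs.\<close>

lemma sum_Pow_sign_sum_insert:
  fixes a :: "'b \<Rightarrow> real" and f :: "real \<Rightarrow> real"
  assumes "finite I" "x \<notin> I"
  shows "(\<Sum>A\<in>Pow (insert x I). f (sign_sum a (insert x I) A)) =
    (\<Sum>A\<in>Pow I. f (sign_sum a I A + a x) + f (sign_sum a I A - a x))"
proof -
  have A: "sign_sum a (insert x I) A = sign_sum a I A - a x" if "A \<in> Pow I" for A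
    using that assms by (auto simp: sign_sum_def)
  have B: "sign_sum a (insert x I) (insert x A) = sign_sum a I A + a x" if "A \<in> Pow I" for A
  proof -
    have "(\<Sum>i\<in>I. if i \<in> insert x A then a i else - a i) = (\<Sum>i\<in>I. if i \<in> A then a i else - a i)"
      using assms by (intro sum.cong) auto
    then show ?thesis using assms by (simp add: sign_sum_def)
  qed
  have inj: "inj_on (insert x) (Pow I)"
    using assms by (auto simp: inj_on_def)
  have "(\<Sum>A\<in>Pow (insert x I). f (sign_sum a (insert x I) A)) =
     (\<Sum>A\<in>Pow I. f (sign_sum a (insert x I) A)) + (\<Sum>A\<in>insert x ` Pow I. f (sign_sum a (insert x I) A))"
    unfolding Pow_insert using assms by (intro sum.union_disjoint) auto
  also have "\<dots> = (\<Sum>A\<in>Pow I. f (sign_sum a I A - a x)) + (\<Sum>A\<in>Pow I. f (sign_sum a I A + a x))"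
    using A B by (simp add: sum.reindex[OF inj])
  finally show ?thesis by (simp add: sum.distrib add.commute)
qed

lemma sum_sign_sum_square:
  fixes a :: "'b \<Rightarrow> real"
  assumes "finite I"
  shows "(\<Sum>A\<in>Pow I. (sign_sum a I A)\<^sup>2) = 2 ^ card I * (\<Sum>i\<in>I. (a i)\<^sup>2)"
  using assms
proof (induction I)
  case empty
  then show ?case by (simp add: sign_sum_def)
next
  case (insert x I)
  have "(\<Sum>A\<in>Pow (insert x I). (sign_sum a (insert x I) A)\<^sup>2) =
     (\<Sum>A\<in>Pow I. 2 * (sign_sum a I A)\<^sup>2 + 2 * (a x)\<^sup>2)"
    unfolding sum_Pow_sign_sum_insert[OF insert(1,2), of "\<lambda>s. s\<^sup>2"]
    by (intro sum.cong) (auto simp: power2_eq_square algebra_simps)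
  also have "\<dots> = 2 * (2 ^ card I * (\<Sum>i\<in>I. (a i)\<^sup>2)) + 2 ^ card I * (2 * (a x)\<^sup>2)"
    using insert by (simp add: sum.distrib sum_distrib_left[symmetric] card_Pow)
  finally show ?case using insert by (simp add: algebra_simps)
qed

text \<open>Fourth moment of a sum with random signs, with the Gaussian constant 3.\<close>

lemma sum_sign_sum_fourth:
  fixes a :: "'b \<Rightarrow> real"
  assumes "finite I"
  shows "(\<Sum>A\<in>Pow I. (sign_sum a I A) ^ 4) \<le> 2 ^ card I * (3 * (\<Sum>i\<in>I. (a i)\<^sup>2)\<^sup>2)"
  using assms
proof (induction I)
  case empty
  then show ?case by (simp add: sign_sum_def)
next
  case (insert x I)
  define \<sigma> where "\<sigma> = (\<Sum>i\<in>I. (a i)\<^sup>2)"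
  have "(\<Sum>A\<in>Pow (insert x I). (sign_sum a (insert x I) A) ^ 4) =
     (\<Sum>A\<in>Pow I. 2 * (sign_sum a I A) ^ 4 + 12 * (a x)\<^sup>2 * (sign_sum a I A)\<^sup>2 + 2 * (a x) ^ 4)"
    unfolding sum_Pow_sign_sum_insert[OF insert(1,2), of "\<lambda>s. s ^ 4"]
    by (intro sum.cong) (auto simp: power4_eq_xxxx power2_eq_square algebra_simps)
  also have "\<dots> = 2 * (\<Sum>A\<in>Pow I. (sign_sum a I A) ^ 4) + 12 * (a x)\<^sup>2 * (2 ^ card I * \<sigma>) + 2 ^ card I * (2 * (a x) ^ 4)"
    using insert by (simp add: sum.distrib sum_distrib_left[symmetric] card_Pow sum_sign_sum_square \<sigma>_def)
  \<comment> \<open>Enlarging the factor 2 of \<open>(a x) ^ 4\<close> to 6 completes the square 6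
    ((a x)^2 + \<sigma>)^2.\<close>
  also have "\<dots> \<le> 2 * (2 ^ card I * (3 * \<sigma>\<^sup>2)) + 12 * (a x)\<^sup>2 * (2 ^ card I * \<sigma>) + 2 ^ card I * (6 * (a x) ^ 4)"
    using insert.IH unfolding \<sigma>_def by (intro add_mono mult_left_mono) auto
  also have "\<dots> = 2 ^ card (insert x I) * (3 * (\<Sum>i\<in>insert x I. (a i)\<^sup>2)\<^sup>2)"
  proof -
    have "(\<Sum>i\<in>insert x I. (a i)\<^sup>2) = (a x)\<^sup>2 + \<sigma>" using insert by (simp add: \<sigma>_def)
    then show ?thesis using insert.hyps by (simp add: power2_eq_square power4_eq_xxxx algebra_simps)
  qed
  finally show ?case .
qed

text \<open>Transfers first-moment bounds for one-dimensional projections to the Euclidean norm,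
  with sign vectors as directions.\<close>

lemma Khintchine_L1:
  fixes a :: "'b \<Rightarrow> real"
  assumes I: "finite I"
  shows "2 ^ card I * L2_set a I \<le> 9/2 * (\<Sum>A\<in>Pow I. \<bar>sign_sum a I A\<bar>)"
proof (cases "L2_set a I = 0")
  case True
  then show ?thesis by (simp add: sum_nonneg)
next
  case False
  define s where "s = L2_set a I"
  have s: "s > 0" using False by (simp add: s_def less_le)
  have s2: "(\<Sum>i\<in>I. (a i)\<^sup>2) = s\<^sup>2"
    by (simp add: s_def L2_set_def sum_nonneg)
  txt \<open>The first moment is bounded below by the second and the fourth one, after scaling by \<open>3 * s\<close>.\<close>
  have pt: "y\<^sup>2 \<le> \<bar>y\<bar> + y ^ 4" for y :: real
  proof (cases "\<bar>y\<bar> \<le> 1")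
    case True
    have "\<bar>y\<bar> * \<bar>y\<bar> \<le> \<bar>y\<bar> * 1" using True by (intro mult_left_mono) auto
    then show ?thesis by (simp add: power2_eq_square add_increasing2)
  next
    case False
    have "1 * y\<^sup>2 \<le> y\<^sup>2 * y\<^sup>2"
      using False by (intro mult_right_mono) (auto simp: abs_square_less_1 not_less[symmetric] intro!: power_increasing)
    then show ?thesis by (simp add: power2_eq_square power4_eq_xxxx)
  qed
  have "2 ^ card I * s\<^sup>2 / (3 * s)\<^sup>2 = (\<Sum>A\<in>Pow I. (sign_sum a I A / (3 * s))\<^sup>2)"
    by (simp add: power_divide sum_divide_distrib[symmetric] sum_sign_sum_square[OF I] s2)
  also have "\<dots> \<le> (\<Sum>A\<in>Pow I. \<bar>sign_sum a I A / (3 * s)\<bar> + (sign_sum a I A / (3 * s)) ^ 4)"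
    by (intro sum_mono pt)
  also have "\<dots> = (\<Sum>A\<in>Pow I. \<bar>sign_sum a I A\<bar>) / (3 * s) + (\<Sum>A\<in>Pow I. (sign_sum a I A) ^ 4) / (3 * s) ^ 4"
    using s by (simp add: sum.distrib power_divide sum_divide_distrib abs_mult)
  also have "\<dots> \<le> (\<Sum>A\<in>Pow I. \<bar>sign_sum a I A\<bar>) / (3 * s) + 2 ^ card I * (3 * (s\<^sup>2)\<^sup>2) / (3 * s) ^ 4"
    using sum_sign_sum_fourth[OF I, of a] s unfolding s2
    by (intro add_left_mono divide_right_mono) auto
  finally have "2 ^ card I * (s\<^sup>2 / (3 * s)\<^sup>2 - 3 * (s\<^sup>2)\<^sup>2 / (3 * s) ^ 4) \<le> (\<Sum>A\<in>Pow I. \<bar>sign_sum a I A\<bar>) / (3 * s)"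
    by (simp only: right_diff_distrib times_divide_eq_right diff_le_eq mult.assoc)
  \<comment> \<open>The scale \<open>3 * s\<close> leaves 1/9 - 3/81 = 2/27; multiplying by
    \<open>3 * s\<close> gives 2/9, the inverse of the constant 9/2.\<close>
  moreover have "s\<^sup>2 / (3 * s)\<^sup>2 - 3 * (s\<^sup>2)\<^sup>2 / (3 * s) ^ 4 = 2/27"
    using s by (simp add: power2_eq_square power4_eq_xxxx field_simps)
  ultimately have "2 ^ card I * (2/27) * (3 * s) \<le> (\<Sum>A\<in>Pow I. \<bar>sign_sum a I A\<bar>)"
    using s by (simp add: pos_le_divide_eq mult_ac)
  moreover have "2 ^ card I * (2/27) * (3 * s) = 2/9 * (2 ^ card I * s)" by simp
  ultimately show ?thesis unfolding s_def by linarith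
qed

section \<open>A finite norming set of directions\<close>

text \<open>
  Scaled lattice points replace a net of the sphere: rounding a unit vector towards zero stays in the
  unit ball, and the number of lattice points is bounded by weighting them with \<open>2 ^ (4 p - \<Sum>\<bar>k i\<bar>)\<close>.
\<close>

definition grid :: "nat \<Rightarrow> (nat \<Rightarrow> int) set" where
  "grid p = {k \<in> {1..p} \<rightarrow>\<^sub>E {- int (2 * p)..int (2 * p)}. (\<Sum>i\<in>{1..p}. (k i)\<^sup>2) \<le> int (4 * p)}"

definition directions :: "nat \<Rightarrow> (nat \<Rightarrow> real) set" where
  "directions p = (\<lambda>k i. real_of_int (k i) / (2 * sqrt (real p))) ` grid p"

lemma finite_grid: "finite (grid p)"
  unfolding grid_def by (intro finite_subset[OF _ finite_PiE[of "{1..p}" "\<lambda>_. {- int (2 * p)..int (2 * p)}"]]) auto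

lemma finite_directions: "finite (directions p)"
  unfolding directions_def by (intro finite_imageI finite_grid)

text \<open>The subtracted remainder lets the induction close; what is used later is the bound 3,
  uniform in \<open>M\<close>.\<close>

lemma sum_half_powers_le: "(\<Sum>k\<in>{- int M..int M}. (1/2::real) ^ nat \<bar>k\<bar>) \<le> 3 - 2 * (1/2) ^ M"
proof (induction M)
  case 0
  then show ?case by simp
next
  case (Suc M)
  have "{- int (Suc M)..int (Suc M)} = insert (- int (Suc M)) (insert (int (Suc M)) {- int M..int M})"
    by auto
  then have "(\<Sum>k\<in>{- int (Suc M)..int (Suc M)}. (1/2::real) ^ nat \<bar>k\<bar>) =
     2 * (1/2) ^ (Suc M) + (\<Sum>k\<in>{- int M..int M}. (1/2::real) ^ nat \<bar>k\<bar>)"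
    by (simp add: nat_add_distrib del: of_nat_Suc)
  then show ?case using Suc by simp
qed

lemma card_grid_le: "real (card (grid p)) \<le> 48 ^ p"
proof -
  let ?S = "{- int (2 * p)..int (2 * p)}"
  have w: "1 \<le> 2 ^ (4 * p) * (\<Prod>i\<in>{1..p}. (1/2::real) ^ nat \<bar>k i\<bar>)" if "k \<in> grid p" for k
  proof -
    \<comment> \<open>For integers the absolute value is at most the square, so the coordinates of a
      grid point have absolute sum at most \<open>4 * p\<close> and its weight is at least
      1.\<close>
    have "nat \<bar>z\<bar> \<le> z\<^sup>2" for z :: int
    proof (cases "z = 0")
      case False
      then have "\<bar>z\<bar> * 1 \<le> \<bar>z\<bar> * \<bar>z\<bar>" by (intro mult_left_mono) auto
      then show ?thesis by (simp add: power2_eq_square)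
    qed auto
    then have "int (\<Sum>i\<in>{1..p}. nat \<bar>k i\<bar>) \<le> (\<Sum>i\<in>{1..p}. (k i)\<^sup>2)"
      unfolding of_nat_sum by (intro sum_mono) auto
    also have "\<dots> \<le> int (4 * p)" using that by (simp add: grid_def)
    finally have le: "(\<Sum>i\<in>{1..p}. nat \<bar>k i\<bar>) \<le> 4 * p" by linarith
    have "(1::real) = 2 ^ (4 * p) * (1/2) ^ (4 * p)" by (simp add: power_divide)
    also have "\<dots> \<le> 2 ^ (4 * p) * (1/2) ^ (\<Sum>i\<in>{1..p}. nat \<bar>k i\<bar>)"
      using le by (intro mult_left_mono power_decreasing) auto
    finally show ?thesis by (simp add: power_sum)
  qed
  have "real (card (grid p)) \<le> (\<Sum>k\<in>grid p. 2 ^ (4 * p) * (\<Prod>i\<in>{1..p}. (1/2::real) ^ nat \<bar>k i\<bar>))"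
    using sum_mono[of "grid p" "\<lambda>_. 1::real", OF w] by simp
  also have "\<dots> \<le> (\<Sum>k\<in>{1..p} \<rightarrow>\<^sub>E ?S. 2 ^ (4 * p) * (\<Prod>i\<in>{1..p}. (1/2::real) ^ nat \<bar>k i\<bar>))"
    by (intro sum_mono2 finite_PiE) (auto simp: grid_def intro!: mult_nonneg_nonneg prod_nonneg)
  \<comment> \<open>Over the full box the total weight factorises over the coordinates, each of
    which contributes at most 3.\<close>
  also have "\<dots> = 2 ^ (4 * p) * (\<Prod>i\<in>{1..p}. \<Sum>k\<in>?S. (1/2::real) ^ nat \<bar>k\<bar>)"
    by (subst prod_sum_PiE) (auto simp: sum_distrib_left)
  also have "\<dots> \<le> 2 ^ (4 * p) * 3 ^ p"
  proof -
    have "(\<Sum>k\<in>?S. (1/2::real) ^ nat \<bar>k\<bar>) \<le> 3"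
      using sum_half_powers_le[of "2 * p"] by (smt (verit) zero_le_power half_gt_zero_iff)
    then show ?thesis by (simp add: power_mono sum_nonneg)
  qed
  also have "\<dots> = 48 ^ p" by (simp add: power_mult flip: power_mult_distrib)
  finally show ?thesis .
qed

lemma card_directions_le: "real (card (directions p)) \<le> exp (6 * real p)"
proof -
  have "real (card (directions p)) \<le> 48 ^ p"
    using card_image_le[OF finite_grid, of "\<lambda>k i. real_of_int (k i) / (2 * sqrt (real p))" p] card_grid_le[of p]
    unfolding directions_def by linarith
  also have "\<dots> \<le> (exp 6) ^ p"
  proof (rule power_mono)
    have "(2::real) ^ 6 \<le> (exp 1) ^ 6"
      using exp_ge_add_one_self[of "1::real"] by (intro power_mono) auto
    then show "48 \<le> exp (6::real)" by (simp flip: exp_of_nat_mult)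
  qed auto
  also have "\<dots> = exp (6 * real p)" by (simp add: mult.commute flip: exp_of_nat_mult)
  finally show ?thesis .
qed

section \<open>Inner products and norms on \<open>{1..p}\<close>, and the norming property of
  \<open>directions\<close>\<close>

abbreviation ip :: "nat \<Rightarrow> (nat \<Rightarrow> real) \<Rightarrow> (nat \<Rightarrow> real) \<Rightarrow> real" where
  "ip p u v \<equiv> (\<Sum>i\<in>{1..p}. u i * v i)"

abbreviation nrm :: "nat \<Rightarrow> (nat \<Rightarrow> real) \<Rightarrow> real" where
  "nrm p u \<equiv> L2_set u {1..p}"

lemma nrm_square: "(nrm p u)\<^sup>2 = ip p u u"
  by (simp add: L2_set_def sum_nonneg power2_eq_square)

lemma nrm_scale: "nrm p (\<lambda>i. c * u i) = \<bar>c\<bar> * nrm p u"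
  using L2_set_right_distrib[of "\<bar>c\<bar>" u "{1..p}"] by (simp add: L2_set_def power_mult_distrib)

lemma abs_ip_le: "\<bar>ip p u v\<bar> \<le> nrm p u * nrm p v"
proof -
  have "\<bar>ip p u v\<bar> \<le> (\<Sum>i\<in>{1..p}. \<bar>u i\<bar> * \<bar>v i\<bar>)"
    unfolding abs_mult[symmetric] by (rule sum_abs)
  also have "\<dots> \<le> nrm p u * nrm p v" by (rule L2_set_mult_ineq)
  finally show ?thesis .
qed

lemma nrm_directions_le:
  assumes "v \<in> directions p" "p \<ge> 1"
  shows "nrm p v \<le> 1"
proof -
  obtain k where k: "k \<in> grid p" and v: "v = (\<lambda>i. real_of_int (k i) / (2 * sqrt (real p)))"
    using assms by (auto simp: directions_def)
  have "real_of_int (\<Sum>i\<in>{1..p}. (k i)\<^sup>2) \<le> real_of_int (int (4 * p))"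
    using k unfolding of_int_le_iff by (simp add: grid_def)
  then have "(\<Sum>i\<in>{1..p}. (real_of_int (k i))\<^sup>2) \<le> 4 * real p" by simp
  then have "(\<Sum>i\<in>{1..p}. (v i)\<^sup>2) \<le> 1"
    using assms(2) by (simp add: v power_divide power_mult_distrib sum_divide_distrib[symmetric] divide_le_eq)
  then show ?thesis by (simp add: L2_set_def)
qed

text \<open>Rounding c u with c = 2 sqrt p costs at most 1 / c per coordinate, hence squared
  distance at most 1/4 from the unit vector u. Expanding |u - v|^2 = 1 + |v|^2 - 2 <u, v> then gives
  <u, v> \<ge> 3/8.\<close>

lemma directions_norming:
  assumes p: "p \<ge> 1"
  shows "\<exists>v\<in>directions p. 3/8 * nrm p d \<le> ip p d v"
proof (cases "nrm p d = 0")
  case True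
  have "(\<lambda>i\<in>{1..p}. 0) \<in> grid p" by (auto simp: grid_def)
  moreover from True have "d i = 0" if "i \<in> {1..p}" for i
    using L2_set_eq_0_iff[of "{1..p}" d] that by auto
  ultimately show ?thesis using True by (auto simp: directions_def)
next
  case False
  define h where "h = nrm p d"
  have h: "h > 0" using False by (simp add: h_def less_le)
  define c where "c = 2 * sqrt (real p)"
  have c: "c > 0" using p by (simp add: c_def)
  define u where "u i = d i / h" for i
  have u1: "ip p u u = 1"
  proof -
    have "ip p u u = ip p d d / h\<^sup>2"
      by (simp add: u_def power2_eq_square sum_divide_distrib)
    moreover have "ip p d d = h\<^sup>2" unfolding h_def by (rule nrm_square[symmetric])
    ultimately show ?thesis using h by simp
  qed
  \<comment> \<open>Rounding towards zero increases no coordinate in absolute value, so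
    \<open>k\<close> inherits the norm bound of \<open>c * u\<close>.\<close>
  define k where "k = (\<lambda>i\<in>{1..p}. if u i \<ge> 0 then \<lfloor>c * u i\<rfloor> else \<lceil>c * u i\<rceil>)"
  define v where "v i = real_of_int (k i) / c" for i
  have kb: "\<bar>real_of_int (k i)\<bar> \<le> \<bar>c * u i\<bar> \<and> \<bar>c * u i - real_of_int (k i)\<bar> \<le> 1" if "i \<in> {1..p}" for i
  proof (cases "u i \<ge> 0")
    case True
    then have "0 \<le> c * u i" using c by simp
    moreover from this have "0 \<le> \<lfloor>c * u i\<rfloor>" by simp
    ultimately show ?thesis using True that
      unfolding k_def by (simp add: abs_le_iff) linarith
  next
    case False
    then have "c * u i \<le> 0" using c by (simp add: mult_nonneg_nonpos)
    moreover from this have "\<lceil>c * u i\<rceil> \<le> 0" by simp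
    ultimately show ?thesis using False that
      unfolding k_def by (simp add: abs_le_iff) linarith
  qed
  have c2: "c\<^sup>2 = 4 * real p" by (simp add: c_def power_mult_distrib)
  have ksum: "(\<Sum>i\<in>{1..p}. (real_of_int (k i))\<^sup>2) \<le> 4 * real p"
  proof -
    have "(\<Sum>i\<in>{1..p}. (real_of_int (k i))\<^sup>2) \<le> (\<Sum>i\<in>{1..p}. (c * u i)\<^sup>2)"
      by (intro sum_mono) (simp add: abs_le_square_iff[symmetric] kb)
    also have "\<dots> = c\<^sup>2 * ip p u u" by (simp add: sum_distrib_left power2_eq_square algebra_simps)
    finally show ?thesis using u1 c2 by simp
  qed
  have "k \<in> grid p"
  proof -
    have "real_of_int (\<Sum>i\<in>{1..p}. (k i)\<^sup>2) \<le> real_of_int (int (4 * p))" using ksum by simp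
    then have 1: "(\<Sum>i\<in>{1..p}. (k i)\<^sup>2) \<le> int (4 * p)" by (simp only: of_int_le_iff)
    have "\<bar>k i\<bar> \<le> int (2 * p)" if i: "i \<in> {1..p}" for i
    proof -
      have "(k i)\<^sup>2 \<le> (\<Sum>i\<in>{1..p}. (k i)\<^sup>2)" using i by (intro member_le_sum) auto
      also have "\<dots> \<le> int (4 * p)" by (rule 1)
      \<comment> \<open>As \<open>p \<ge> 1\<close>, the norm bound alone puts every coordinate into
        the box of \<open>grid\<close>.\<close>
      also have "\<dots> \<le> (int (2 * p))\<^sup>2" using p by (simp add: power2_eq_square)
      finally have "\<bar>k i\<bar> \<le> \<bar>int (2 * p)\<bar>" unfolding abs_le_square_iff .
      then show ?thesis by simp
    qed
    then show ?thesis using 1 by (auto simp: grid_def k_def abs_le_iff PiE_iff) (fastforce simp: k_def)+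
  qed
  then have v_in: "v \<in> directions p"
    unfolding directions_def v_def[abs_def] c_def by (intro image_eqI[of _ _ k]) auto
  have "(\<Sum>i\<in>{1..p}. (u i - v i)\<^sup>2) \<le> (\<Sum>i\<in>{1..p}. 1 / c\<^sup>2)"
  proof (intro sum_mono)
    fix i assume i: "i \<in> {1..p}"
    have "u i - v i = (c * u i - real_of_int (k i)) / c" using c by (simp add: v_def field_simps)
    moreover have "(c * u i - real_of_int (k i))\<^sup>2 \<le> 1" using kb[OF i] by (simp add: abs_square_le_1)
    ultimately show "(u i - v i)\<^sup>2 \<le> 1 / c\<^sup>2" using c by (simp add: power_divide divide_right_mono)
  qed
  also have "\<dots> = 1/4" using p by (simp add: c2)
  finally have uv: "(\<Sum>i\<in>{1..p}. (u i - v i)\<^sup>2) \<le> 1/4" .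
  have "(\<Sum>i\<in>{1..p}. (u i - v i)\<^sup>2) = ip p u u + ip p v v - 2 * ip p u v"
    by (simp add: power2_eq_square algebra_simps sum.distrib sum_subtractf sum_distrib_left)
  moreover have "0 \<le> ip p v v" by (simp add: sum_nonneg)
  ultimately have "3/8 \<le> ip p u v" using uv u1 by linarith
  moreover have "ip p d v = h * ip p u v" using h by (simp add: u_def sum_distrib_left)
  ultimately have "3/8 * nrm p d \<le> ip p d v" using h unfolding h_def by simp
  then show ?thesis using v_in by blast
qed

section \<open>The squared norm of a sum of bounded independent vectors\<close>

lemma measurable_vec_borel_component [measurable (raw)]:
  "f \<in> M \<rightarrow>\<^sub>M vec_borel p \<Longrightarrow> i \<in> {1..p} \<Longrightarrow> (\<lambda>x. f x i) \<in> borel_measurable M"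
  unfolding vec_borel_def by (rule measurable_compose[OF _ measurable_component_singleton])

lemma measurable_PiM_vec_component:
  "i \<in> I \<Longrightarrow> a \<in> {1..p} \<Longrightarrow> (\<lambda>y. y i a) \<in> borel_measurable (PiM I (\<lambda>_. vec_borel p))"
  by (rule measurable_vec_borel_component[where f = "\<lambda>y. y i"]) (auto intro: measurable_component_singleton)

lemma measurable_nrm [measurable (raw)]:
  assumes "\<And>i. i \<in> {1..p} \<Longrightarrow> (\<lambda>x. f x i) \<in> borel_measurable M"
  shows "(\<lambda>x. nrm p (f x)) \<in> borel_measurable M"
  unfolding L2_set_def using assms by measurable

lemma abs_component_le_nrm: "i \<in> {1..p} \<Longrightarrow> \<bar>u i\<bar> \<le> nrm p u"
  using member_le_L2_set[of "{1..p}" i "\<lambda>i. \<bar>u i\<bar>"] by (simp add: L2_set_def)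

lemma nrm_uminus: "nrm p (\<lambda>i. - u i) = nrm p u"
  by (simp add: L2_set_def)

lemma nrm_triangle: "nrm p (\<lambda>i. u i + v i) \<le> nrm p u + nrm p v"
  by (rule L2_set_triangle_ineq)

lemma nrm_triangle_minus: "nrm p (\<lambda>i. u i - v i) \<le> nrm p u + nrm p v"
  using nrm_triangle[where u = u and v = "\<lambda>i. - v i" and p = p] nrm_uminus[where u = v and p = p] by simp

lemma nrm_add_square: "(nrm p (\<lambda>i. u i + v i))\<^sup>2 = (nrm p u)\<^sup>2 + 2 * ip p v u + (nrm p v)\<^sup>2"
  unfolding nrm_square by (simp add: algebra_simps sum.distrib sum_distrib_left)

text \<open>The bound is required at every point. Sums, products and powers then stay in the class,
  and integrability goals reduce to the closure rules \<open>bounded_rv_intros\<close>.\<close>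

definition bounded_rv :: "'a measure \<Rightarrow> ('a \<Rightarrow> real) \<Rightarrow> bool" where
  "bounded_rv M f \<longleftrightarrow> f \<in> borel_measurable M \<and> (\<exists>B. \<forall>x. \<bar>f x\<bar> \<le> B)"

lemma bounded_rv_const: "bounded_rv M (\<lambda>_. c)"
  by (auto simp: bounded_rv_def)

lemma bounded_rv_add:
  assumes "bounded_rv M f" "bounded_rv M g"
  shows "bounded_rv M (\<lambda>x. f x + g x)"
proof -
  obtain B C where "\<And>x. \<bar>f x\<bar> \<le> B" "\<And>x. \<bar>g x\<bar> \<le> C"
    using assms by (auto simp: bounded_rv_def)
  then have "\<bar>f x + g x\<bar> \<le> B + C" for x
    using abs_triangle_ineq[of "f x" "g x"] by (smt (verit))
  then show ?thesis using assms by (auto simp: bounded_rv_def)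
qed

lemma bounded_rv_mult:
  assumes "bounded_rv M f" "bounded_rv M g"
  shows "bounded_rv M (\<lambda>x. f x * g x)"
proof -
  obtain B C where B: "\<And>x. \<bar>f x\<bar> \<le> B" and C: "\<And>x. \<bar>g x\<bar> \<le> C"
    using assms by (auto simp: bounded_rv_def)
  have "\<bar>f x * g x\<bar> \<le> B * C" for x
    unfolding abs_mult using B C by (intro mult_mono order_trans[OF abs_ge_zero B]) auto
  then show ?thesis using assms by (auto simp: bounded_rv_def)
qed

lemma bounded_rv_sum:
  assumes "\<And>i. i \<in> I \<Longrightarrow> bounded_rv M (f i)"
  shows "bounded_rv M (\<lambda>x. \<Sum>i\<in>I. f i x)"
  using assms
  by (induction I rule: infinite_finite_induct) (auto intro!: bounded_rv_add bounded_rv_const)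

lemma bounded_rv_power:
  assumes "bounded_rv M f"
  shows "bounded_rv M (\<lambda>x. (f x) ^ k)"
  by (induction k) (auto intro!: bounded_rv_mult bounded_rv_const assms)

lemmas bounded_rv_intros =
  bounded_rv_const bounded_rv_add bounded_rv_mult bounded_rv_sum bounded_rv_power

lemma (in prob_space) bounded_rv_integrable: "bounded_rv M f \<Longrightarrow> integrable M f"
  unfolding bounded_rv_def by (auto intro!: integrable_const_bound[where B = "SOME B. \<forall>x. \<bar>f x\<bar> \<le> B"] AE_I2 intro: someI2)

text \<open>Disjoint blocks of an independent family are independent as vectors, and so are
  functions of them. Used to separate the past of a sum from its next summand.\<close>

lemma (in prob_space) indep_vars_expectation_mult:
  fixes f g :: "_ \<Rightarrow> real"
  assumes "indep_vars (\<lambda>_. S) X I" "A \<inter> B = {}" "A \<subseteq> I" "B \<subseteq> I"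
    and [measurable]: "f \<in> borel_measurable (PiM A (\<lambda>_. S))" "g \<in> borel_measurable (PiM B (\<lambda>_. S))"
    and "integrable M (\<lambda>\<omega>. f (restrict (\<lambda>i. X i \<omega>) A))"
    and "integrable M (\<lambda>\<omega>. g (restrict (\<lambda>i. X i \<omega>) B))"
  shows "expectation (\<lambda>\<omega>. f (restrict (\<lambda>i. X i \<omega>) A) * g (restrict (\<lambda>i. X i \<omega>) B)) =
    expectation (\<lambda>\<omega>. f (restrict (\<lambda>i. X i \<omega>) A)) * expectation (\<lambda>\<omega>. g (restrict (\<lambda>i. X i \<omega>) B))"
proof -
  have "indep_var borel (f \<circ> (\<lambda>\<omega>. restrict (\<lambda>i. X i \<omega>) A)) borel (g \<circ> (\<lambda>\<omega>. restrict (\<lambda>i. X i \<omega>) B))"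
    by (intro indep_var_compose[OF indep_var_restrict[OF assms(1-4)]] assms(5,6))
  then show ?thesis
    using indep_var_lebesgue_integral[of "f \<circ> (\<lambda>\<omega>. restrict (\<lambda>i. X i \<omega>) A)" "g \<circ> (\<lambda>\<omega>. restrict (\<lambda>i. X i \<omega>) B)"]
      assms(7,8) by (simp add: comp_def)
qed

lemma integral_double_sum:
  fixes f :: "_ \<Rightarrow> _ \<Rightarrow> _ \<Rightarrow> real"
  assumes "\<And>a c. a \<in> A \<Longrightarrow> c \<in> B \<Longrightarrow> integrable M (f a c)"
  shows "(\<integral>x. (\<Sum>a\<in>A. \<Sum>c\<in>B. f a c x) \<partial>M) = (\<Sum>a\<in>A. \<Sum>c\<in>B. \<integral>x. f a c x \<partial>M)"
  using assms by (subst Bochner_Integration.integral_sum) (auto intro!: sum.cong Bochner_Integration.integral_sum)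

text \<open>\<open>b\<close> bounds the full norm, \<open>V\<close> the variance in any single
  direction. Keeping them apart bounds the off-diagonal part by \<open>V * b^2\<close>, which beats
  b^4 when the noise is spread over many directions.\<close>

locale bounded_indep_vectors = prob_space M for M :: "'a measure" +
  fixes Y :: "nat \<Rightarrow> 'a \<Rightarrow> nat \<Rightarrow> real" and m p :: nat and b V :: real
  assumes indep: "indep_vars (\<lambda>_. vec_borel p) Y {1..m}"
    and bound: "\<And>i \<omega>. i \<in> {1..m} \<Longrightarrow> nrm p (Y i \<omega>) \<le> b"
    and centered: "\<And>i a. i \<in> {1..m} \<Longrightarrow> a \<in> {1..p} \<Longrightarrow> expectation (\<lambda>\<omega>. Y i \<omega> a) = 0"
    and weak_variance: "\<And>i u. i \<in> {1..m} \<Longrightarrow> expectation (\<lambda>\<omega>. (ip p (Y i \<omega>) u)\<^sup>2) \<le> V * (nrm p u)\<^sup>2"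
    and V_nonneg: "0 \<le> V"
begin

section \<open>Partial sums, the off-diagonal martingale and their second moments\<close>

definition S :: "nat \<Rightarrow> 'a \<Rightarrow> nat \<Rightarrow> real" where
  "S k \<omega> a = (\<Sum>i\<in>{1..k}. Y i \<omega> a)"

text \<open>Half of the off-diagonal part of \<open>(nrm p (S k))\<^sup>2\<close>, a martingale in \<open>k\<close>.\<close>

definition Q :: "nat \<Rightarrow> 'a \<Rightarrow> real" where
  "Q k \<omega> = (\<Sum>j\<in>{1..k}. ip p (Y j \<omega>) (S (j - 1) \<omega>))"

lemma S_Suc: "S (Suc k) \<omega> = (\<lambda>a. S k \<omega> a + Y (Suc k) \<omega> a)"
  by (simp add: S_def fun_eq_iff)

lemma Q_Suc: "Q (Suc k) \<omega> = Q k \<omega> + ip p (Y (Suc k) \<omega>) (S k \<omega>)"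
  by (simp add: Q_def)

lemma nrm_S_square: "(nrm p (S k \<omega>))\<^sup>2 = (\<Sum>j\<in>{1..k}. (nrm p (Y j \<omega>))\<^sup>2) + 2 * Q k \<omega>"
proof (induction k)
  case 0
  then show ?case by (simp add: S_def Q_def L2_set_def)
next
  case (Suc k)
  then show ?case unfolding S_Suc nrm_add_square Q_Suc by simp
qed

lemma measurable_Y [measurable]: "i \<in> {1..m} \<Longrightarrow> Y i \<in> M \<rightarrow>\<^sub>M vec_borel p"
  using indep by (auto simp: indep_vars_def)

lemma bounded_rv_Y: "i \<in> {1..m} \<Longrightarrow> a \<in> {1..p} \<Longrightarrow> bounded_rv M (\<lambda>\<omega>. Y i \<omega> a)"
  unfolding bounded_rv_def
  by (intro conjI exI[of _ b] allI order_trans[OF abs_component_le_nrm bound]) (auto intro: measurable_vec_borel_component measurable_Y)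

lemma bounded_rv_S: "k \<le> m \<Longrightarrow> a \<in> {1..p} \<Longrightarrow> bounded_rv M (\<lambda>\<omega>. S k \<omega> a)"
  unfolding S_def by (intro bounded_rv_intros bounded_rv_Y) auto

lemma bounded_rv_Q: "k \<le> m \<Longrightarrow> bounded_rv M (Q k)"
  unfolding Q_def[abs_def] by (intro bounded_rv_intros bounded_rv_Y bounded_rv_S) auto

definition history :: "nat \<Rightarrow> 'a \<Rightarrow> nat \<Rightarrow> nat \<Rightarrow> real" where
  "history k \<omega> = restrict (\<lambda>i. Y i \<omega>) {1..k}"

text \<open>Dependence on the first \<open>k\<close> vectors is expressed by factorisation through
  them, so that independence of disjoint blocks applies directly in place of conditioning.\<close>

definition adapted :: "nat \<Rightarrow> ('a \<Rightarrow> real) \<Rightarrow> bool" where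
  "adapted k f \<longleftrightarrow> (\<exists>g\<in>borel_measurable (PiM {1..k} (\<lambda>_. vec_borel p)). \<forall>\<omega>. f \<omega> = g (history k \<omega>))"

lemma adapted_mult:
  assumes "adapted k f" "adapted k g"
  shows "adapted k (\<lambda>\<omega>. f \<omega> * g \<omega>)"
proof -
  obtain f' g' where [measurable]: "f' \<in> borel_measurable (PiM {1..k} (\<lambda>_. vec_borel p))"
      "g' \<in> borel_measurable (PiM {1..k} (\<lambda>_. vec_borel p))"
    and eq: "\<And>\<omega>. f \<omega> = f' (history k \<omega>)" "\<And>\<omega>. g \<omega> = g' (history k \<omega>)"
    using assms by (auto simp: adapted_def)
  show ?thesis unfolding adapted_def
    by (intro bexI[of _ "\<lambda>x. f' x * g' x"] borel_measurable_times) (auto simp: eq)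
qed

lemma adapted_S: "a \<in> {1..p} \<Longrightarrow> adapted k (\<lambda>\<omega>. S k \<omega> a)"
  unfolding adapted_def S_def
  by (intro bexI[of _ "\<lambda>y. \<Sum>i\<in>{1..k}. y i a"])
     (auto simp: history_def intro!: borel_measurable_sum measurable_PiM_vec_component)

lemma adapted_Q: "adapted k (Q k)"
  unfolding adapted_def Q_def S_def
  by (intro bexI[of _ "\<lambda>y. \<Sum>j\<in>{1..k}. \<Sum>a\<in>{1..p}. y j a * (\<Sum>i\<in>{1..j - 1}. y i a)"])
     (auto simp: history_def intro!: borel_measurable_sum borel_measurable_times measurable_PiM_vec_component sum.cong
       arg_cong2[where f = "(*)"])

lemma expectation_adapted_mult:
  assumes k: "Suc k \<le> m" and f: "adapted k f" "bounded_rv M f"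
    and h: "h \<in> borel_measurable (vec_borel p)" "bounded_rv M (\<lambda>\<omega>. h (Y (Suc k) \<omega>))"
  shows "expectation (\<lambda>\<omega>. f \<omega> * h (Y (Suc k) \<omega>)) = expectation f * expectation (\<lambda>\<omega>. h (Y (Suc k) \<omega>))"
proof -
  obtain f' where f'[measurable]: "f' \<in> borel_measurable (PiM {1..k} (\<lambda>_. vec_borel p))"
    and eq: "\<And>\<omega>. f \<omega> = f' (history k \<omega>)"
    using f(1) by (auto simp: adapted_def)
  have h': "(\<lambda>y. h (y (Suc k))) \<in> borel_measurable (PiM {Suc k} (\<lambda>_. vec_borel p))"
    by (rule measurable_compose[where f = "\<lambda>y. y (Suc k)", OF _ h(1)]) (auto intro: measurable_component_singleton)
  have f_eq: "f = (\<lambda>\<omega>. f' (restrict (\<lambda>i. Y i \<omega>) {1..k}))"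
    by (simp add: fun_eq_iff eq history_def)
  show ?thesis
    using indep_vars_expectation_mult[OF indep, of "{1..k}" "{Suc k}" f' "\<lambda>y. h (y (Suc k))"]
      f' h' k bounded_rv_integrable[OF h(2)] bounded_rv_integrable[OF f(2)]
    unfolding f_eq by simp
qed

lemma expectation_adapted_Y:
  assumes k: "Suc k \<le> m" and f: "adapted k f" "bounded_rv M f" and a: "a \<in> {1..p}"
  shows "expectation (\<lambda>\<omega>. f \<omega> * Y (Suc k) \<omega> a) = 0"
  using expectation_adapted_mult[OF k f, of "\<lambda>y. y a"] centered[of "Suc k" a] k a bounded_rv_Y[of "Suc k" a]
  by (simp add: measurable_vec_borel_component[OF measurable_ident])

text \<open>The martingale difference property: each coordinate of \<open>S k\<close> is absorbed
  into the adapted factor, leaving the vanishing mean of \<open>Y (Suc k)\<close>. The choice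
  \<open>f = 1\<close> removes the cross term for \<open>S\<close>, the choice
  \<open>f = Q k\<close> the one for \<open>Q\<close>.\<close>

lemma expectation_adapted_ip:
  assumes k: "Suc k \<le> m" and f: "adapted k f" "bounded_rv M f"
  shows "expectation (\<lambda>\<omega>. f \<omega> * ip p (Y (Suc k) \<omega>) (S k \<omega>)) = 0"
proof -
  have "expectation (\<lambda>\<omega>. f \<omega> * ip p (Y (Suc k) \<omega>) (S k \<omega>)) =
      expectation (\<lambda>\<omega>. \<Sum>a\<in>{1..p}. (f \<omega> * S k \<omega> a) * Y (Suc k) \<omega> a)"
    by (simp add: sum_distrib_left mult_ac)
  also have "\<dots> = (\<Sum>a\<in>{1..p}. expectation (\<lambda>\<omega>. (f \<omega> * S k \<omega> a) * Y (Suc k) \<omega> a))"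
    using k f by (intro Bochner_Integration.integral_sum bounded_rv_integrable bounded_rv_intros bounded_rv_S bounded_rv_Y) auto
  also have "\<dots> = 0"
    using k f by (intro sum.neutral ballI expectation_adapted_Y adapted_mult adapted_S bounded_rv_intros bounded_rv_S) auto
  finally show ?thesis .
qed

lemma expectation_nrm_S_square_le: "k \<le> m \<Longrightarrow> expectation (\<lambda>\<omega>. (nrm p (S k \<omega>))\<^sup>2) \<le> real k * b\<^sup>2"
proof (induction k)
  case 0
  then show ?case by (simp add: S_def L2_set_def)
next
  case (Suc k)
  have i1: "integrable M (\<lambda>\<omega>. (nrm p (S k \<omega>))\<^sup>2)"
    using Suc.prems unfolding nrm_square by (intro bounded_rv_integrable bounded_rv_intros bounded_rv_S) auto
  have i2: "integrable M (\<lambda>\<omega>. ip p (Y (Suc k) \<omega>) (S k \<omega>))"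
    using Suc.prems by (intro bounded_rv_integrable bounded_rv_intros bounded_rv_S bounded_rv_Y) auto
  have i3: "integrable M (\<lambda>\<omega>. (nrm p (Y (Suc k) \<omega>))\<^sup>2)"
    using Suc.prems unfolding nrm_square by (intro bounded_rv_integrable bounded_rv_intros bounded_rv_Y) auto
  have ad: "adapted k (\<lambda>_. 1)" unfolding adapted_def by (intro bexI[of _ "\<lambda>_. 1"]) auto
  have "expectation (\<lambda>\<omega>. (nrm p (S (Suc k) \<omega>))\<^sup>2) =
      expectation (\<lambda>\<omega>. (nrm p (S k \<omega>))\<^sup>2) + 2 * expectation (\<lambda>\<omega>. ip p (Y (Suc k) \<omega>) (S k \<omega>)) +
      expectation (\<lambda>\<omega>. (nrm p (Y (Suc k) \<omega>))\<^sup>2)"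
    unfolding S_Suc nrm_add_square using i1 i2 i3 by simp
  also have "expectation (\<lambda>\<omega>. ip p (Y (Suc k) \<omega>) (S k \<omega>)) = 0"
    using expectation_adapted_ip[OF Suc.prems ad bounded_rv_const] by simp
  also have "expectation (\<lambda>\<omega>. (nrm p (Y (Suc k) \<omega>))\<^sup>2) \<le> b\<^sup>2"
    using Suc.prems bound[of "Suc k"] by (intro integral_le_const i3 AE_I2 power_mono) auto
  finally show ?case using Suc by (simp add: algebra_simps)
qed

text \<open>\<open>weak_variance\<close> speaks of fixed directions, whereas \<open>S k\<close> is
  random but independent of the next vector. The quadratic form is expanded so that the second
  moments of \<open>Y (Suc k)\<close> factor out and \<open>S k\<close> can be treated as
  fixed.\<close>

lemma expectation_ip_square_le:
  assumes k: "Suc k \<le> m"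
  shows "expectation (\<lambda>\<omega>. (ip p (Y (Suc k) \<omega>) (S k \<omega>))\<^sup>2) \<le> V * expectation (\<lambda>\<omega>. (nrm p (S k \<omega>))\<^sup>2)"
proof -
  define C where "C a c = expectation (\<lambda>\<omega>. Y (Suc k) \<omega> a * Y (Suc k) \<omega> c)" for a c
  have quad: "(ip p (Y (Suc k) \<omega>) u)\<^sup>2 =
      (\<Sum>a\<in>{1..p}. \<Sum>c\<in>{1..p}. (u a * u c) * (Y (Suc k) \<omega> a * Y (Suc k) \<omega> c))" for \<omega> u
    by (simp add: power2_eq_square sum_product mult_ac)
  have YY: "integrable M (\<lambda>\<omega>. (S k \<omega> a * S k \<omega> c) * (Y (Suc k) \<omega> a * Y (Suc k) \<omega> c))"
      "integrable M (\<lambda>\<omega>. Y (Suc k) \<omega> a * Y (Suc k) \<omega> c)"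
      "integrable M (\<lambda>\<omega>. S k \<omega> a * S k \<omega> c)"
    if "a \<in> {1..p}" "c \<in> {1..p}" for a c
    using k that by (intro bounded_rv_integrable bounded_rv_intros bounded_rv_S bounded_rv_Y; simp)+
  have "expectation (\<lambda>\<omega>. (ip p (Y (Suc k) \<omega>) (S k \<omega>))\<^sup>2) =
      (\<Sum>a\<in>{1..p}. \<Sum>c\<in>{1..p}. expectation (\<lambda>\<omega>. (S k \<omega> a * S k \<omega> c) * (Y (Suc k) \<omega> a * Y (Suc k) \<omega> c)))"
    unfolding quad by (rule integral_double_sum) (rule YY)
  also have "\<dots> = (\<Sum>a\<in>{1..p}. \<Sum>c\<in>{1..p}. expectation (\<lambda>\<omega>. (S k \<omega> a * S k \<omega> c) * C a c))"
    unfolding integral_mult_left_zero C_def using k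
    by (intro sum.cong refl expectation_adapted_mult[where h = "\<lambda>y. y _ * y _"] adapted_mult adapted_S
        bounded_rv_intros bounded_rv_S bounded_rv_Y borel_measurable_times
        measurable_vec_borel_component[OF measurable_ident]) auto
  also have "\<dots> = expectation (\<lambda>\<omega>. \<Sum>a\<in>{1..p}. \<Sum>c\<in>{1..p}. (S k \<omega> a * S k \<omega> c) * C a c)"
    by (rule integral_double_sum[symmetric]) (intro integrable_mult_left YY)
  also have "\<dots> \<le> expectation (\<lambda>\<omega>. V * (nrm p (S k \<omega>))\<^sup>2)"
  proof (rule integral_mono)
    show "integrable M (\<lambda>\<omega>. \<Sum>a\<in>{1..p}. \<Sum>c\<in>{1..p}. (S k \<omega> a * S k \<omega> c) * C a c)"
      "integrable M (\<lambda>\<omega>. V * (nrm p (S k \<omega>))\<^sup>2)"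
      unfolding nrm_square using k by (intro bounded_rv_integrable bounded_rv_intros bounded_rv_S; simp)+
    fix \<omega>
    \<comment> \<open>With \<omega> frozen, the double sum is the second moment of the next vector
      in the fixed direction \<open>S k \<omega>\<close>.\<close>
    have "(\<Sum>a\<in>{1..p}. \<Sum>c\<in>{1..p}. (S k \<omega> a * S k \<omega> c) * C a c) =
       expectation (\<lambda>\<omega>'. (ip p (Y (Suc k) \<omega>') (S k \<omega>))\<^sup>2)"
      unfolding quad C_def integral_mult_right_zero[symmetric]
      by (rule integral_double_sum[symmetric]) (intro integrable_mult_right YY)
    also have "\<dots> \<le> V * (nrm p (S k \<omega>))\<^sup>2" using k by (intro weak_variance) auto
    finally show "(\<Sum>a\<in>{1..p}. \<Sum>c\<in>{1..p}. (S k \<omega> a * S k \<omega> c) * C a c) \<le> V * (nrm p (S k \<omega>))\<^sup>2" .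
  qed
  finally show ?thesis by simp
qed

text \<open>Martingale increments are orthogonal; the one after step \<open>k\<close> adds at most
  \<open>V * k * b^2\<close>, and k^2 + k is at most (k + 1)^2.\<close>

lemma expectation_Q_square_le: "k \<le> m \<Longrightarrow> expectation (\<lambda>\<omega>. (Q k \<omega>)\<^sup>2) \<le> V * b\<^sup>2 * (real k)\<^sup>2"
proof (induction k)
  case 0
  then show ?case by (simp add: Q_def)
next
  case (Suc k)
  let ?Z = "\<lambda>\<omega>. ip p (Y (Suc k) \<omega>) (S k \<omega>)"
  have Z: "bounded_rv M ?Z"
    using Suc.prems by (intro bounded_rv_intros bounded_rv_S bounded_rv_Y) auto
  have Qk: "bounded_rv M (Q k)" using Suc.prems by (intro bounded_rv_Q) auto
  have "(Q (Suc k) \<omega>)\<^sup>2 = (Q k \<omega>)\<^sup>2 + 2 * (Q k \<omega> * ?Z \<omega>) + (?Z \<omega>)\<^sup>2" for \<omega>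
    unfolding Q_Suc by (simp add: power2_eq_square algebra_simps)
  then have "expectation (\<lambda>\<omega>. (Q (Suc k) \<omega>)\<^sup>2) =
      expectation (\<lambda>\<omega>. (Q k \<omega>)\<^sup>2) + 2 * expectation (\<lambda>\<omega>. Q k \<omega> * ?Z \<omega>) + expectation (\<lambda>\<omega>. (?Z \<omega>)\<^sup>2)"
    using bounded_rv_integrable[OF bounded_rv_power[OF Qk]] bounded_rv_integrable[OF bounded_rv_power[OF Z]]
      bounded_rv_integrable[OF bounded_rv_mult[OF Qk Z]] by simp
  also have "expectation (\<lambda>\<omega>. Q k \<omega> * ?Z \<omega>) = 0"
    by (rule expectation_adapted_ip[OF Suc.prems adapted_Q Qk])
  also have "expectation (\<lambda>\<omega>. (?Z \<omega>)\<^sup>2) \<le> V * (real k * b\<^sup>2)"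
    using expectation_ip_square_le[OF Suc.prems] expectation_nrm_S_square_le[of k] Suc.prems V_nonneg
    by (meson Suc_leD mult_left_mono order_trans)
  finally have "expectation (\<lambda>\<omega>. (Q (Suc k) \<omega>)\<^sup>2) \<le> V * b\<^sup>2 * (real k)\<^sup>2 + V * (real k * b\<^sup>2)"
    using Suc by simp
  also have "\<dots> = V * b\<^sup>2 * ((real k)\<^sup>2 + real k)" by (simp add: algebra_simps)
  also have "\<dots> \<le> V * b\<^sup>2 * (real (Suc k))\<^sup>2"
    using V_nonneg by (intro mult_left_mono) (auto simp: power2_eq_square algebra_simps)
  finally show ?case .
qed

text \<open>The diagonal part is at most \<open>m * b^2\<close> surely, so an excess
  \<open>s\<close> forces \<open>Q m \<ge> s / 2\<close>, to which Chebyshev's inequality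
  applies.\<close>

lemma prob_nrm_S_square_gt:
  assumes s: "s > 0"
  shows "prob {\<omega> \<in> space M. (nrm p (S m \<omega>))\<^sup>2 > real m * b\<^sup>2 + s} \<le> 4 * V * b\<^sup>2 * (real m)\<^sup>2 / s\<^sup>2"
proof -
  have Qm: "bounded_rv M (Q m)" by (intro bounded_rv_Q) auto
  then have [measurable]: "Q m \<in> borel_measurable M" by (simp add: bounded_rv_def)
  have "prob {\<omega> \<in> space M. (nrm p (S m \<omega>))\<^sup>2 > real m * b\<^sup>2 + s} \<le> prob {\<omega> \<in> space M. (Q m \<omega>)\<^sup>2 \<ge> (s/2)\<^sup>2}"
  proof (intro finite_measure_mono subsetI)
    fix \<omega> assume \<omega>: "\<omega> \<in> {\<omega> \<in> space M. (nrm p (S m \<omega>))\<^sup>2 > real m * b\<^sup>2 + s}"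
    have "(\<Sum>j\<in>{1..m}. (nrm p (Y j \<omega>))\<^sup>2) \<le> (\<Sum>j\<in>{1..m}. b\<^sup>2)"
      by (intro sum_mono power_mono bound) auto
    then have "Q m \<omega> \<ge> s/2" using \<omega> nrm_S_square[of m \<omega>] by simp
    then have "(Q m \<omega>)\<^sup>2 \<ge> (s/2)\<^sup>2" using s by (intro power_mono) auto
    then show "\<omega> \<in> {\<omega> \<in> space M. (Q m \<omega>)\<^sup>2 \<ge> (s/2)\<^sup>2}" using \<omega> by simp
  qed simp
  also have "\<dots> \<le> expectation (\<lambda>\<omega>. (Q m \<omega>)\<^sup>2) / (s/2)\<^sup>2"
    using s Qm by (intro integral_Markov_inequality_measure[where A = "{}"] bounded_rv_integrable bounded_rv_power) auto
  also have "\<dots> \<le> (V * b\<^sup>2 * (real m)\<^sup>2) / (s/2)\<^sup>2"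
    by (intro divide_right_mono expectation_Q_square_le) auto
  finally show ?thesis by (simp add: power_divide mult_ac)
qed

end

section \<open>Samples of heavy-tailed noise\<close>

text \<open>Duality: testing a mean vector against itself turns a bound on directional means into a
  bound on its norm.\<close>

lemma nrm_le_if_ip_le:
  assumes "ip p b b \<le> c * nrm p b" "0 \<le> c"
  shows "nrm p b \<le> c"
proof (cases "nrm p b = 0")
  case False
  then have "0 < nrm p b" using L2_set_nonneg[of b "{1..p}"] by linarith
  moreover have "nrm p b * nrm p b \<le> c * nrm p b"
    using assms(1) nrm_square[where u = b and p = p] by (simp add: power2_eq_square)
  ultimately show ?thesis by simp
qed (use assms in auto)

lemma nrm_restrict: "nrm p (restrict u {1..p}) = nrm p u"
  by (auto intro: L2_set_cong)

lemma ip_restrict: "ip p (restrict u {1..p}) v = ip p u v"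
  by (auto intro: sum.cong)

text \<open>Long vectors are discarded rather than rescaled, so an inner product is either kept
  exactly or replaced by 0.\<close>

definition clamp :: "nat \<Rightarrow> real \<Rightarrow> (nat \<Rightarrow> real) \<Rightarrow> nat \<Rightarrow> real" where
  "clamp p R x = (\<lambda>a\<in>{1..p}. if nrm p x \<le> R then x a else 0)"

lemma measurable_id_vec_component: "a \<in> {1..p} \<Longrightarrow> (\<lambda>x. x a) \<in> borel_measurable (vec_borel p)"
  unfolding vec_borel_def by (rule measurable_component_singleton)

lemma measurable_nrm_vec [measurable]: "nrm p \<in> borel_measurable (vec_borel p)"
  by (rule measurable_nrm[OF measurable_id_vec_component])

lemma measurable_clamp [measurable]: "clamp p R \<in> vec_borel p \<rightarrow>\<^sub>M vec_borel p"
proof -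
  have "(\<lambda>x. \<lambda>a\<in>{1..p}. if nrm p x \<le> R then x a else 0) \<in> vec_borel p \<rightarrow>\<^sub>M (\<Pi>\<^sub>M i\<in>{1..p}. borel)"
  proof (rule measurable_restrict)
    fix a assume "a \<in> {1..p}"
    note [measurable] = measurable_id_vec_component[OF this]
    show "(\<lambda>x. if nrm p x \<le> R then x a else 0) \<in> borel_measurable (vec_borel p)" by measurable
  qed
  then show ?thesis by (simp add: clamp_def[abs_def] vec_borel_def[symmetric])
qed

lemma ip_clamp: "ip p (clamp p R x) u = (if nrm p x \<le> R then ip p x u else 0)"
  by (auto simp: clamp_def intro: sum.cong)

lemma nrm_clamp: "nrm p (clamp p R x) = (if nrm p x \<le> R then nrm p x else 0)"
  unfolding clamp_def nrm_restrict by (simp add: L2_set_def)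

lemma nrm_clamp_le: "0 \<le> R \<Longrightarrow> nrm p (clamp p R x) \<le> R"
  by (simp add: nrm_clamp)

lemma measurable_vec_borelI:
  assumes "\<And>a. a \<in> {1..p} \<Longrightarrow> (\<lambda>x. f x a) \<in> borel_measurable M"
  shows "(\<lambda>x. \<lambda>a\<in>{1..p}. f x a) \<in> M \<rightarrow>\<^sub>M vec_borel p"
  unfolding vec_borel_def using assms by (rule measurable_restrict)

text \<open>Abstracts the mirrored differences of pure noise. The moment bound 8 is the price of
  subtracting two columns; it is stated on the unit ball because vectors in
  \<open>directions\<close> may be shorter than 1.\<close>

locale noise_sample = prob_space M for M :: "'a measure" +
  fixes N :: "nat \<Rightarrow> 'a \<Rightarrow> nat \<Rightarrow> real" and m p :: nat and \<alpha> :: real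
  assumes indep: "indep_vars (\<lambda>_. vec_borel p) N {1..m}"
    and \<alpha>: "1 \<le> \<alpha>" "\<alpha> \<le> 2" and p: "1 \<le> p"
    and integrable_component: "\<And>i a. i \<in> {1..m} \<Longrightarrow> a \<in> {1..p} \<Longrightarrow> integrable M (\<lambda>\<omega>. N i \<omega> a)"
    and centered: "\<And>i a. i \<in> {1..m} \<Longrightarrow> a \<in> {1..p} \<Longrightarrow> expectation (\<lambda>\<omega>. N i \<omega> a) = 0"
    and integrable_moment: "\<And>i v. i \<in> {1..m} \<Longrightarrow> nrm p v \<le> 1 \<Longrightarrow> integrable M (\<lambda>\<omega>. \<bar>ip p (N i \<omega>) v\<bar> powr \<alpha>)"
    and moment: "\<And>i v. i \<in> {1..m} \<Longrightarrow> nrm p v \<le> 1 \<Longrightarrow> expectation (\<lambda>\<omega>. \<bar>ip p (N i \<omega>) v\<bar> powr \<alpha>) \<le> 8"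
begin

lemma measurable_N [measurable]: "i \<in> {1..m} \<Longrightarrow> N i \<in> M \<rightarrow>\<^sub>M vec_borel p"
  using indep by (auto simp: indep_vars_def)

lemma integrable_ip: "i \<in> {1..m} \<Longrightarrow> integrable M (\<lambda>\<omega>. ip p (N i \<omega>) v)"
  by (intro Bochner_Integration.integrable_sum integrable_mult_left integrable_component)

lemma expectation_ip: "i \<in> {1..m} \<Longrightarrow> expectation (\<lambda>\<omega>. ip p (N i \<omega>) v) = 0"
  by (subst Bochner_Integration.integral_sum) (auto intro: integrable_mult_left integrable_component simp: centered)

text \<open>For a normalised direction
  \<open>\<bar>x\<bar> \<le> 1 + \<bar>x\<bar> powr \<alpha>\<close> gives 1 + 8 = 9; the general
  case follows by scaling.\<close>

lemma expectation_abs_ip_le: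
  assumes i: "i \<in> {1..m}"
  shows "expectation (\<lambda>\<omega>. \<bar>ip p (N i \<omega>) v\<bar>) \<le> 9 * nrm p v"
proof (cases "nrm p v = 0")
  case True
  then have "ip p (N i \<omega>) v = 0" for \<omega>
    using abs_ip_le[where u = "N i \<omega>" and v = v and p = p] by simp
  then show ?thesis using True by simp
next
  case False
  then have h: "0 < nrm p v" using L2_set_nonneg[of v "{1..p}"] by linarith
  define w where "w a = inverse (nrm p v) * v a" for a
  have w: "nrm p w \<le> 1"
    unfolding w_def using h by (subst nrm_scale) simp
  have eq: "ip p (N i \<omega>) v = nrm p v * ip p (N i \<omega>) w" for \<omega>
  proof -
    have "ip p (N i \<omega>) w = inverse (nrm p v) * ip p (N i \<omega>) v"
      by (simp add: w_def sum_distrib_left mult_ac)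
    then show ?thesis using h by simp
  qed
  have "expectation (\<lambda>\<omega>. \<bar>ip p (N i \<omega>) w\<bar>) \<le> expectation (\<lambda>\<omega>. 1 + \<bar>ip p (N i \<omega>) w\<bar> powr \<alpha>)"
  proof (intro integral_mono)
    show "\<bar>x\<bar> \<le> 1 + \<bar>x\<bar> powr \<alpha>" for x :: real
      using abs_le_powr[of x \<alpha>] \<alpha> by (cases "1 \<le> \<bar>x\<bar>") (auto simp: add_increasing2)
    show "integrable M (\<lambda>\<omega>. \<bar>ip p (N i \<omega>) w\<bar>)" by (intro integrable_abs integrable_ip i)
    show "integrable M (\<lambda>\<omega>. 1 + \<bar>ip p (N i \<omega>) w\<bar> powr \<alpha>)"
      by (intro Bochner_Integration.integrable_add integrable_moment i w) simp
  qed
  also have "\<dots> \<le> 9"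
    using moment[OF i w] integrable_moment[OF i w] by (simp add: prob_space)
  finally have "nrm p v * expectation (\<lambda>\<omega>. \<bar>ip p (N i \<omega>) w\<bar>) \<le> nrm p v * 9"
    using h by (intro mult_left_mono) auto
  then show ?thesis unfolding eq abs_mult using h by (simp add: mult.commute)
qed

lemma integrable_nrm: "i \<in> {1..m} \<Longrightarrow> integrable M (\<lambda>\<omega>. nrm p (N i \<omega>))"
proof (rule Bochner_Integration.integrable_bound)
  assume i: "i \<in> {1..m}"
  then show "integrable M (\<lambda>\<omega>. \<Sum>a\<in>{1..p}. \<bar>N i \<omega> a\<bar>)"
    by (intro Bochner_Integration.integrable_sum integrable_abs integrable_component)
  show "(\<lambda>\<omega>. nrm p (N i \<omega>)) \<in> borel_measurable M"
    using i by (rule measurable_compose[OF measurable_N measurable_nrm_vec])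
  show "AE \<omega> in M. norm (nrm p (N i \<omega>)) \<le> norm (\<Sum>a\<in>{1..p}. \<bar>N i \<omega> a\<bar>)"
    by (intro AE_I2) (simp add: L2_set_le_sum_abs sum_nonneg)
qed

text \<open>Khintchine's inequality reduces the norm to projections on sign vectors, which have norm
  sqrt p; the constant is 9/2 * 9, rounded up.\<close>

lemma expectation_nrm_le:
  assumes i: "i \<in> {1..m}"
  shows "expectation (\<lambda>\<omega>. nrm p (N i \<omega>)) \<le> 41 * sqrt (real p)"
proof -
  define s :: "nat set \<Rightarrow> nat \<Rightarrow> real" where "s A a = (if a \<in> A then 1 else -1)" for A a
  have s: "nrm p (s A) = sqrt (real p)" for A
    by (simp add: L2_set_def s_def if_distrib[of "\<lambda>x. x\<^sup>2"] cong: if_cong)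
  have sgn: "sign_sum x {1..p} A = ip p x (s A)" for x A
    by (auto simp: sign_sum_def s_def intro: sum.cong)
  have Khintchine: "2 ^ card {1..p} * nrm p x \<le> 9/2 * (\<Sum>A\<in>Pow {1..p}. \<bar>ip p x (s A)\<bar>)" for x
    using Khintchine_L1[of "{1..p}" x] unfolding sgn by simp
  have "2 ^ p * expectation (\<lambda>\<omega>. nrm p (N i \<omega>)) = expectation (\<lambda>\<omega>. 2 ^ card {1..p} * nrm p (N i \<omega>))" by simp
  also have "\<dots> \<le> expectation (\<lambda>\<omega>. 9/2 * (\<Sum>A\<in>Pow {1..p}. \<bar>ip p (N i \<omega>) (s A)\<bar>))"
    by (intro integral_mono Khintchine integrable_mult_right integrable_nrm
        Bochner_Integration.integrable_sum integrable_abs integrable_ip i)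
  also have "\<dots> = 9/2 * (\<Sum>A\<in>Pow {1..p}. expectation (\<lambda>\<omega>. \<bar>ip p (N i \<omega>) (s A)\<bar>))"
    by (subst integral_mult_right_zero, subst Bochner_Integration.integral_sum) (intro integrable_abs integrable_ip i refl)+
  also have "\<dots> \<le> 9/2 * (\<Sum>A\<in>Pow {1..p}. 9 * sqrt (real p))"
    using expectation_abs_ip_le[OF i, of "s _"] unfolding s by (intro mult_left_mono sum_mono) auto
  also have "\<dots> = 2 ^ p * (81/2 * sqrt (real p))" by (simp add: card_Pow)
  finally have "expectation (\<lambda>\<omega>. nrm p (N i \<omega>)) \<le> 81/2 * sqrt (real p)" by simp
  also have "\<dots> \<le> 41 * sqrt (real p)" by simp
  finally show ?thesis .
qed

lemma prob_nrm_ge: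
  assumes i: "i \<in> {1..m}" and t: "0 < t"
  shows "prob {\<omega> \<in> space M. t * sqrt (real p) \<le> nrm p (N i \<omega>)} \<le> 41 / t"
proof -
  have sp: "sqrt (real p) > 0" using p by simp
  have "prob {\<omega> \<in> space M. t * sqrt (real p) \<le> nrm p (N i \<omega>)} \<le>
      expectation (\<lambda>\<omega>. nrm p (N i \<omega>)) / (t * sqrt (real p))"
    using t sp by (intro integral_Markov_inequality_measure[where A = "{}"] integrable_nrm i) auto
  also have "\<dots> \<le> (41 * sqrt (real p)) / (t * sqrt (real p))"
    using t sp by (intro divide_right_mono expectation_nrm_le i) auto
  finally show ?thesis using sp by simp
qed

lemma measurable_shift:
  assumes "i \<in> {1..m}"
  shows "(\<lambda>\<omega>. \<lambda>a\<in>{1..p}. d a + N i \<omega> a) \<in> M \<rightarrow>\<^sub>M vec_borel p"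
  by (intro measurable_vec_borelI borel_measurable_add measurable_vec_borel_component[OF measurable_N] assms) auto

lemma prob_shifted_nrm_le:
  assumes i: "i \<in> {1..m}" and t: "0 < t" and d: "2 * t * sqrt (real p) \<le> nrm p d"
  shows "prob {\<omega> \<in> space M. nrm p (\<lambda>a. d a + N i \<omega> a) \<le> t * sqrt (real p)} \<le> 41 / t"
proof -
  have [measurable]: "(\<lambda>\<omega>. nrm p (N i \<omega>)) \<in> borel_measurable M"
    using i by (rule measurable_compose[OF measurable_N measurable_nrm_vec])
  have "prob {\<omega> \<in> space M. nrm p (\<lambda>a. d a + N i \<omega> a) \<le> t * sqrt (real p)} \<le>
      prob {\<omega> \<in> space M. t * sqrt (real p) \<le> nrm p (N i \<omega>)}"
  proof (intro finite_measure_mono subsetI CollectI conjI)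
    fix \<omega> assume \<omega>: "\<omega> \<in> {\<omega> \<in> space M. nrm p (\<lambda>a. d a + N i \<omega> a) \<le> t * sqrt (real p)}"
    have "nrm p (\<lambda>a. (d a + N i \<omega> a) - N i \<omega> a) \<le> nrm p (\<lambda>a. d a + N i \<omega> a) + nrm p (N i \<omega>)"
      by (rule nrm_triangle_minus)
    then show "t * sqrt (real p) \<le> nrm p (N i \<omega>)" using \<omega> d by simp
  qed auto
  also have "\<dots> \<le> 41 / t" by (rule prob_nrm_ge[OF i t])
  finally show ?thesis .
qed

section \<open>Clamped observations: bias, variance and deviation of their sums\<close>

definition clamped :: "real \<Rightarrow> (nat \<Rightarrow> real) \<Rightarrow> nat \<Rightarrow> 'a \<Rightarrow> nat \<Rightarrow> real" where
  "clamped R d i \<omega> = clamp p R (\<lambda>a\<in>{1..p}. d a + N i \<omega> a)"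

definition clamped_mean :: "real \<Rightarrow> (nat \<Rightarrow> real) \<Rightarrow> nat \<Rightarrow> nat \<Rightarrow> real" where
  "clamped_mean R d i a = expectation (\<lambda>\<omega>. clamped R d i \<omega> a)"

definition clamped_centered :: "real \<Rightarrow> (nat \<Rightarrow> real) \<Rightarrow> nat \<Rightarrow> 'a \<Rightarrow> nat \<Rightarrow> real" where
  "clamped_centered R d i \<omega> = (\<lambda>a\<in>{1..p}. clamped R d i \<omega> a - clamped_mean R d i a)"

lemma measurable_clamped: "i \<in> {1..m} \<Longrightarrow> clamped R d i \<in> M \<rightarrow>\<^sub>M vec_borel p"
  unfolding clamped_def[abs_def] by (rule measurable_compose[OF measurable_shift measurable_clamp])

lemma nrm_clamped_le: "0 \<le> R \<Longrightarrow> nrm p (clamped R d i \<omega>) \<le> R"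
  unfolding clamped_def by (rule nrm_clamp_le)

lemma ip_clamped:
  "ip p (clamped R d i \<omega>) u = (if nrm p (\<lambda>a. d a + N i \<omega> a) \<le> R then ip p d u + ip p (N i \<omega>) u else 0)"
  unfolding clamped_def ip_clamp nrm_restrict ip_restrict by (simp add: algebra_simps sum.distrib)

lemma abs_ip_clamped_le: "0 \<le> R \<Longrightarrow> \<bar>ip p (clamped R d i \<omega>) u\<bar> \<le> R * nrm p u"
  by (rule order_trans[OF abs_ip_le]) (intro mult_right_mono nrm_clamped_le L2_set_nonneg)

lemma bounded_rv_clamped:
  assumes "0 \<le> R" "i \<in> {1..m}" "a \<in> {1..p}"
  shows "bounded_rv M (\<lambda>\<omega>. clamped R d i \<omega> a)"
  unfolding bounded_rv_def
  by (intro conjI exI[of _ R] allI order_trans[OF abs_component_le_nrm nrm_clamped_le]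
      measurable_vec_borel_component[OF measurable_clamped] assms)

lemma bounded_rv_ip_clamped:
  assumes "0 \<le> R" "i \<in> {1..m}"
  shows "bounded_rv M (\<lambda>\<omega>. ip p (clamped R d i \<omega>) u)"
  by (intro bounded_rv_intros bounded_rv_clamped assms)

lemma ip_clamped_mean:
  assumes "0 \<le> R" "i \<in> {1..m}"
  shows "ip p (clamped_mean R d i) u = expectation (\<lambda>\<omega>. ip p (clamped R d i \<omega>) u)"
  unfolding clamped_mean_def
  by (subst Bochner_Integration.integral_sum)
     (auto intro!: bounded_rv_integrable bounded_rv_intros bounded_rv_clamped assms)

lemma ip_clamped_mean_le:
  assumes R: "0 \<le> R" and i: "i \<in> {1..m}"
  shows "ip p (clamped_mean R d i) u \<le> expectation (\<lambda>\<omega>. \<bar>ip p (clamped R d i \<omega>) u\<bar>)"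
  unfolding ip_clamped_mean[OF R i]
  by (intro integral_mono integrable_abs bounded_rv_integrable bounded_rv_ip_clamped R i) auto

lemma nrm_clamped_mean_le:
  assumes R: "0 \<le> R" and i: "i \<in> {1..m}"
  shows "nrm p (clamped_mean R d i) \<le> R"
proof (rule nrm_le_if_ip_le[OF _ R])
  have "ip p (clamped_mean R d i) (clamped_mean R d i) \<le>
      expectation (\<lambda>\<omega>. \<bar>ip p (clamped R d i \<omega>) (clamped_mean R d i)\<bar>)"
    by (rule ip_clamped_mean_le[OF R i])
  also have "\<dots> \<le> R * nrm p (clamped_mean R d i)"
    by (intro integral_le_const integrable_abs bounded_rv_integrable bounded_rv_ip_clamped R i AE_I2 abs_ip_clamped_le)
  finally show "ip p (clamped_mean R d i) (clamped_mean R d i) \<le> R * nrm p (clamped_mean R d i)" .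
qed

lemma expectation_abs_ip_clamped_null_le:
  assumes R: "0 \<le> R" and i: "i \<in> {1..m}"
  shows "expectation (\<lambda>\<omega>. \<bar>ip p (clamped R (\<lambda>_. 0) i \<omega>) u\<bar>) \<le> 9 * nrm p u"
proof -
  have "expectation (\<lambda>\<omega>. \<bar>ip p (clamped R (\<lambda>_. 0) i \<omega>) u\<bar>) \<le> expectation (\<lambda>\<omega>. \<bar>ip p (N i \<omega>) u\<bar>)"
    by (intro integral_mono integrable_abs bounded_rv_integrable bounded_rv_ip_clamped R i integrable_ip)
       (simp add: ip_clamped)
  also have "\<dots> \<le> 9 * nrm p u" by (rule expectation_abs_ip_le[OF i])
  finally show ?thesis .
qed

text \<open>Discarding only decreases absolute projections, so by duality the bias inherits the
  directional bound 9, free of \<open>p\<close> and \<open>R\<close>.\<close>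

lemma nrm_clamped_mean_null_le:
  assumes R: "0 \<le> R" and i: "i \<in> {1..m}"
  shows "nrm p (clamped_mean R (\<lambda>_. 0) i) \<le> 9"
  by (rule nrm_le_if_ip_le[OF order_trans[OF ip_clamped_mean_le[OF R i] expectation_abs_ip_clamped_null_le[OF R i]]]) simp

lemma ip_clamped_centered:
  "ip p (clamped_centered R d i \<omega>) u = ip p (clamped R d i \<omega>) u - ip p (clamped_mean R d i) u"
  unfolding clamped_centered_def ip_restrict by (simp add: algebra_simps sum_subtractf)

lemma expectation_ip_clamped_centered_square_le:
  assumes R: "0 \<le> R" and i: "i \<in> {1..m}"
  shows "expectation (\<lambda>\<omega>. (ip p (clamped_centered R d i \<omega>) u)\<^sup>2) \<le> expectation (\<lambda>\<omega>. (ip p (clamped R d i \<omega>) u)\<^sup>2)"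
proof -
  have "expectation (\<lambda>\<omega>. (ip p (clamped_centered R d i \<omega>) u)\<^sup>2) = variance (\<lambda>\<omega>. ip p (clamped R d i \<omega>) u)"
    unfolding ip_clamped_centered ip_clamped_mean[OF R i] ..
  also have "\<dots> \<le> expectation (\<lambda>\<omega>. (ip p (clamped R d i \<omega>) u)\<^sup>2)"
    by (subst variance_eq) (auto intro!: bounded_rv_integrable bounded_rv_power bounded_rv_ip_clamped R i)
  finally show ?thesis .
qed

lemma bounded_indep_vectors_clamped:
  assumes R: "0 \<le> R" and V: "0 \<le> V"
    and var: "\<And>i u. i \<in> {1..m} \<Longrightarrow> expectation (\<lambda>\<omega>. (ip p (clamped R d i \<omega>) u)\<^sup>2) \<le> V * (nrm p u)\<^sup>2"
  shows "bounded_indep_vectors M (clamped_centered R d) m p (2 * R) V"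
proof unfold_locales
  have "indep_vars (\<lambda>_. vec_borel p)
      (\<lambda>i \<omega>. \<lambda>a\<in>{1..p}. clamp p R (\<lambda>a\<in>{1..p}. d a + N i \<omega> a) a - clamped_mean R d i a) {1..m}"
    by (rule indep_vars_compose2[OF indep, where Y = "\<lambda>i x. \<lambda>a\<in>{1..p}. clamp p R (\<lambda>a\<in>{1..p}. d a + x a) a - clamped_mean R d i a"])
       (intro measurable_vec_borelI borel_measurable_diff borel_measurable_add
          measurable_vec_borel_component[OF measurable_compose[OF measurable_vec_borelI measurable_clamp]]
          measurable_id_vec_component borel_measurable_const; simp)
  then show "indep_vars (\<lambda>_. vec_borel p) (clamped_centered R d) {1..m}"
    by (simp add: clamped_centered_def[abs_def] clamped_def)
  show "nrm p (clamped_centered R d i \<omega>) \<le> 2 * R" if "i \<in> {1..m}" for i \<omega>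
    unfolding clamped_centered_def nrm_restrict
    using nrm_triangle_minus[where u = "clamped R d i \<omega>" and v = "clamped_mean R d i" and p = p]
      nrm_clamped_le[OF R, of d i \<omega>] nrm_clamped_mean_le[OF R that, of d] by linarith
  show "expectation (\<lambda>\<omega>. clamped_centered R d i \<omega> a) = 0" if "i \<in> {1..m}" "a \<in> {1..p}" for i a
    using that bounded_rv_integrable[OF bounded_rv_clamped[OF R that, of d]]
    by (simp add: clamped_centered_def clamped_mean_def prob_space)
  show "expectation (\<lambda>\<omega>. (ip p (clamped_centered R d i \<omega>) u)\<^sup>2) \<le> V * (nrm p u)\<^sup>2" if "i \<in> {1..m}" for i u
    by (rule order_trans[OF expectation_ip_clamped_centered_square_le[OF R that] var[OF that]])
  show "0 \<le> V" by (rule V)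
qed

lemma nrm_sum_le:
  assumes "\<And>i. i \<in> {1..k} \<Longrightarrow> nrm p (x i) \<le> c"
  shows "nrm p (\<lambda>a. \<Sum>i\<in>{1..k}. x i a) \<le> real k * c"
  using assms
proof (induction k)
  case 0
  then show ?case by (simp add: L2_set_def)
next
  case (Suc k)
  have "nrm p (\<lambda>a. (\<Sum>i\<in>{1..k}. x i a) + x (Suc k) a) \<le> nrm p (\<lambda>a. \<Sum>i\<in>{1..k}. x i a) + nrm p (x (Suc k))"
    by (rule nrm_triangle)
  also have "\<dots> \<le> real k * c + c" using Suc by (intro add_mono) auto
  finally show ?case by (simp add: algebra_simps)
qed

lemma nrm_sum_clamped_centered:
  "nrm p (\<lambda>a. \<Sum>i\<in>{1..m}. clamped_centered R d i \<omega> a) =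
   nrm p (\<lambda>a. (\<Sum>i\<in>{1..m}. clamped R d i \<omega> a) - (\<Sum>i\<in>{1..m}. clamped_mean R d i a))"
  by (intro L2_set_cong) (auto simp: clamped_centered_def sum_subtractf)

lemma measurable_nrm_sum_clamped [measurable]:
  "(\<lambda>\<omega>. nrm p (\<lambda>a. \<Sum>i\<in>{1..m}. clamped R d i \<omega> a)) \<in> borel_measurable M"
  by (intro measurable_nrm borel_measurable_sum measurable_vec_borel_component[OF measurable_clamped]) auto

text \<open>The term \<open>9 * m\<close> absorbs the bias. A directional second moment is at most
  the supremum times the first absolute moment, hence \<open>V = 9 * R\<close>; with
  \<open>b = 2 * R\<close> the constant is 4 * 9 * 4 = 144.\<close>

lemma prob_nrm_sum_clamped_null_gt:
  assumes R: "0 < R" and s: "0 < s"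
  shows "prob {\<omega> \<in> space M. nrm p (\<lambda>a. \<Sum>i\<in>{1..m}. clamped R (\<lambda>_. 0) i \<omega> a) > 9 * real m + sqrt (4 * R\<^sup>2 * real m + s)}
    \<le> 144 * R ^ 3 * (real m)\<^sup>2 / s\<^sup>2"
proof -
  interpret Y: bounded_indep_vectors M "clamped_centered R (\<lambda>_. 0)" m p "2 * R" "9 * R"
  proof (rule bounded_indep_vectors_clamped)
    fix i u assume i: "i \<in> {1..m}"
    have "expectation (\<lambda>\<omega>. (ip p (clamped R (\<lambda>_. 0) i \<omega>) u)\<^sup>2) \<le>
        expectation (\<lambda>\<omega>. (R * nrm p u) * \<bar>ip p (clamped R (\<lambda>_. 0) i \<omega>) u\<bar>)"
    proof (rule integral_mono)
      show "integrable M (\<lambda>\<omega>. (ip p (clamped R (\<lambda>_. 0) i \<omega>) u)\<^sup>2)"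
        "integrable M (\<lambda>\<omega>. (R * nrm p u) * \<bar>ip p (clamped R (\<lambda>_. 0) i \<omega>) u\<bar>)"
        using R by (intro integrable_mult_right integrable_abs bounded_rv_integrable bounded_rv_power bounded_rv_ip_clamped i; simp)+
      fix \<omega>
      have "\<bar>ip p (clamped R (\<lambda>_. 0) i \<omega>) u\<bar> * \<bar>ip p (clamped R (\<lambda>_. 0) i \<omega>) u\<bar> \<le>
          (R * nrm p u) * \<bar>ip p (clamped R (\<lambda>_. 0) i \<omega>) u\<bar>"
        using R by (intro mult_right_mono abs_ip_clamped_le) auto
      then show "(ip p (clamped R (\<lambda>_. 0) i \<omega>) u)\<^sup>2 \<le> (R * nrm p u) * \<bar>ip p (clamped R (\<lambda>_. 0) i \<omega>) u\<bar>"
        by (simp add: power2_eq_square)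
    qed
    also have "\<dots> = (R * nrm p u) * expectation (\<lambda>\<omega>. \<bar>ip p (clamped R (\<lambda>_. 0) i \<omega>) u\<bar>)" by simp
    also have "\<dots> \<le> (R * nrm p u) * (9 * nrm p u)"
      using R i by (intro mult_left_mono expectation_abs_ip_clamped_null_le) auto
    finally show "expectation (\<lambda>\<omega>. (ip p (clamped R (\<lambda>_. 0) i \<omega>) u)\<^sup>2) \<le> (9 * R) * (nrm p u)\<^sup>2"
      by (simp add: power2_eq_square mult_ac)
  qed (use R in auto)
  have [measurable]: "(\<lambda>\<omega>. nrm p (Y.S m \<omega>)) \<in> borel_measurable M"
    unfolding Y.S_def
    by (intro measurable_nrm borel_measurable_sum measurable_vec_borel_component[OF Y.measurable_Y]) auto
  have "prob {\<omega> \<in> space M. nrm p (\<lambda>a. \<Sum>i\<in>{1..m}. clamped R (\<lambda>_. 0) i \<omega> a) > 9 * real m + sqrt (4 * R\<^sup>2 * real m + s)}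
      \<le> prob {\<omega> \<in> space M. (nrm p (Y.S m \<omega>))\<^sup>2 > real m * (2 * R)\<^sup>2 + s}"
  proof (intro finite_measure_mono subsetI CollectI conjI)
    fix \<omega> assume \<omega>: "\<omega> \<in> {\<omega> \<in> space M. nrm p (\<lambda>a. \<Sum>i\<in>{1..m}. clamped R (\<lambda>_. 0) i \<omega> a) > 9 * real m + sqrt (4 * R\<^sup>2 * real m + s)}"
    let ?c = "\<lambda>a. \<Sum>i\<in>{1..m}. clamped R (\<lambda>_. 0) i \<omega> a" and ?b = "\<lambda>a. \<Sum>i\<in>{1..m}. clamped_mean R (\<lambda>_. 0) i a"
    have "nrm p (\<lambda>a. (?c a - ?b a) + ?b a) \<le> nrm p (\<lambda>a. ?c a - ?b a) + nrm p ?b" by (rule nrm_triangle)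
    moreover have "nrm p ?b \<le> real m * 9"
      using R by (intro nrm_sum_le nrm_clamped_mean_null_le) auto
    moreover have "nrm p (\<lambda>a. ?c a - ?b a) = nrm p (Y.S m \<omega>)"
      unfolding nrm_sum_clamped_centered[symmetric] by (intro arg_cong2[where f = L2_set]) (auto simp: Y.S_def)
    ultimately have "sqrt (4 * R\<^sup>2 * real m + s) < nrm p (Y.S m \<omega>)" using \<omega> by simp
    then have "4 * R\<^sup>2 * real m + s < (nrm p (Y.S m \<omega>))\<^sup>2"
      using s by (metis real_sqrt_less_iff real_sqrt_abs abs_of_nonneg L2_set_nonneg)
    then show "real m * (2 * R)\<^sup>2 + s < (nrm p (Y.S m \<omega>))\<^sup>2" by (simp add: mult_ac power_mult_distrib)
  qed auto
  also have "\<dots> \<le> 4 * (9 * R) * (2 * R)\<^sup>2 * (real m)\<^sup>2 / s\<^sup>2" by (rule Y.prob_nrm_S_square_gt[OF s])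
  also have "\<dots> = 144 * R ^ 3 * (real m)\<^sup>2 / s\<^sup>2" by (simp add: power2_eq_square power3_eq_cube)
  finally show ?thesis .
qed

text \<open>An observation survives clamping whenever its noise norm is below 82 sqrt p. The mean in
  the direction of \<open>d\<close> therefore keeps half of the shift up to the noise contribution
  9, and Chebyshev's inequality controls the rest.\<close>

lemma prob_nrm_sum_clamped_le:
  assumes R: "0 < R" and s: "0 < s" and m: "1 \<le> m"
    and d: "0 < nrm p d" "nrm p d + 82 * sqrt (real p) \<le> R"
  shows "prob {\<omega> \<in> space M. nrm p (\<lambda>a. \<Sum>i\<in>{1..m}. clamped R d i \<omega> a) \<le> real m * (nrm p d / 2 - 9) - s * R * sqrt (real m)}
    \<le> 4 / s\<^sup>2"
proof -
  interpret Y: bounded_indep_vectors M "clamped_centered R d" m p "2 * R" "R\<^sup>2"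
  proof (rule bounded_indep_vectors_clamped)
    fix i u assume i: "i \<in> {1..m}"
    show "expectation (\<lambda>\<omega>. (ip p (clamped R d i \<omega>) u)\<^sup>2) \<le> R\<^sup>2 * (nrm p u)\<^sup>2"
    proof (intro integral_le_const bounded_rv_integrable bounded_rv_power bounded_rv_ip_clamped i AE_I2)
      fix \<omega>
      have "\<bar>ip p (clamped R d i \<omega>) u\<bar> \<le> \<bar>R * nrm p u\<bar>"
        using abs_ip_clamped_le[of R d i \<omega> u] R by simp
      then show "(ip p (clamped R d i \<omega>) u)\<^sup>2 \<le> R\<^sup>2 * (nrm p u)\<^sup>2"
        unfolding abs_le_square_iff by (simp add: power_mult_distrib)
    qed (use R in auto)
  qed (use R in auto)
  define u where "u a = inverse (nrm p d) * d a" for a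
  have u: "nrm p u = 1" unfolding u_def using d by (subst nrm_scale) simp
  have du: "ip p d u = nrm p d"
  proof -
    have "ip p d u = inverse (nrm p d) * ip p d d" by (simp add: u_def sum_distrib_left mult_ac)
    also have "\<dots> = inverse (nrm p d) * (nrm p d)\<^sup>2" by (simp only: nrm_square)
    also have "\<dots> = nrm p d" using d by (simp add: power2_eq_square)
    finally show ?thesis .
  qed
  have mean: "nrm p d / 2 - 9 \<le> ip p (clamped_mean R d i) u" if i: "i \<in> {1..m}" for i
  proof -
    let ?A = "{\<omega> \<in> space M. 82 * sqrt (real p) \<le> nrm p (N i \<omega>)}"
    have [measurable]: "(\<lambda>\<omega>. nrm p (N i \<omega>)) \<in> borel_measurable M"
      using i by (rule measurable_compose[OF measurable_N measurable_nrm_vec])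
    have A: "?A \<in> events" by measurable
    have ind: "integrable M (indicator ?A :: 'a \<Rightarrow> real)" "expectation (indicator ?A) = prob ?A"
      using A by (auto intro!: integrable_real_indicator simp: emeasure_eq_measure)
    have int: "integrable M (\<lambda>\<omega>. nrm p d * (1 - indicator ?A \<omega>) - \<bar>ip p (N i \<omega>) u\<bar>)"
      using ind(1) by (intro Bochner_Integration.integrable_diff integrable_abs integrable_ip i integrable_mult_right) auto
    have "nrm p d / 2 - 9 \<le> nrm p d * (1 - prob ?A) - expectation (\<lambda>\<omega>. \<bar>ip p (N i \<omega>) u\<bar>)"
    proof -
      \<comment> \<open>82 is twice the constant of \<open>prob_nrm_ge\<close>, so the noise is that
        large with probability at most 1/2.\<close>
      have "nrm p d * prob ?A \<le> nrm p d * (41 / 82)"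
        using d by (intro mult_left_mono prob_nrm_ge i) auto
      then show ?thesis using expectation_abs_ip_le[OF i, of u] u by (simp add: algebra_simps)
    qed
    also have "\<dots> = expectation (\<lambda>\<omega>. nrm p d * (1 - indicator ?A \<omega>) - \<bar>ip p (N i \<omega>) u\<bar>)"
    proof -
      have "expectation (\<lambda>\<omega>. nrm p d * (1 - indicator ?A \<omega>) - \<bar>ip p (N i \<omega>) u\<bar>) =
          expectation (\<lambda>\<omega>. nrm p d * (1 - indicator ?A \<omega>)) - expectation (\<lambda>\<omega>. \<bar>ip p (N i \<omega>) u\<bar>)"
        using ind(1) by (intro Bochner_Integration.integral_diff integrable_abs integrable_ip i integrable_mult_right Bochner_Integration.integrable_diff) auto
      also have "expectation (\<lambda>\<omega>. nrm p d * (1 - indicator ?A \<omega>)) = nrm p d * (1 - prob ?A)"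
        by (subst integral_mult_right_zero, subst Bochner_Integration.integral_diff) (use ind in \<open>auto simp: prob_space\<close>)
      finally show ?thesis by simp
    qed
    also have "\<dots> \<le> expectation (\<lambda>\<omega>. ip p (clamped R d i \<omega>) u)"
    proof (intro integral_mono bounded_rv_integrable[OF bounded_rv_ip_clamped[OF _ i]])
      show "integrable M (\<lambda>\<omega>. nrm p d * (1 - indicator ?A \<omega>) - \<bar>ip p (N i \<omega>) u\<bar>)"
        by (rule int)
      fix \<omega> assume \<omega>: "\<omega> \<in> space M"
      have "nrm p (\<lambda>a. d a + N i \<omega> a) \<le> nrm p d + nrm p (N i \<omega>)" by (rule nrm_triangle)
      \<comment> \<open>Outside \<open>?A\<close> the observation is kept and its projection is
        \<open>nrm p d\<close> plus noise; on \<open>?A\<close> the left side is nonpositive and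
        lies below both possible values.\<close>
      then show "nrm p d * (1 - indicator ?A \<omega>) - \<bar>ip p (N i \<omega>) u\<bar> \<le> ip p (clamped R d i \<omega>) u"
        unfolding ip_clamped du using \<omega> d by (auto simp: indicator_def)
    qed (use R in auto)
    finally show ?thesis using ip_clamped_mean[OF _ i, of R d u] R by simp
  qed
  let ?b = "\<lambda>a. \<Sum>i\<in>{1..m}. clamped_mean R d i a"
  have b: "real m * (nrm p d / 2 - 9) \<le> nrm p ?b"
  proof -
    have "real m * (nrm p d / 2 - 9) = (\<Sum>i\<in>{1..m}. nrm p d / 2 - 9)" by simp
    also have "\<dots> \<le> (\<Sum>i\<in>{1..m}. ip p (clamped_mean R d i) u)" by (intro sum_mono mean)
    also have "\<dots> = ip p ?b u" by (subst sum.swap) (simp add: sum_distrib_right)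
    also have "\<dots> \<le> nrm p ?b * nrm p u" using abs_ip_le[where u = ?b and v = u and p = p] by linarith
    finally show ?thesis using u by simp
  qed
  have int: "integrable M (\<lambda>\<omega>. (nrm p (Y.S m \<omega>))\<^sup>2)"
    unfolding nrm_square by (intro bounded_rv_integrable bounded_rv_intros Y.bounded_rv_S) auto
  have "prob {\<omega> \<in> space M. nrm p (\<lambda>a. \<Sum>i\<in>{1..m}. clamped R d i \<omega> a) \<le> real m * (nrm p d / 2 - 9) - s * R * sqrt (real m)}
     \<le> prob {\<omega> \<in> space M. (s * R * sqrt (real m))\<^sup>2 \<le> (nrm p (Y.S m \<omega>))\<^sup>2}"
  proof (intro finite_measure_mono subsetI CollectI conjI)
    fix \<omega> assume \<omega>: "\<omega> \<in> {\<omega> \<in> space M. nrm p (\<lambda>a. \<Sum>i\<in>{1..m}. clamped R d i \<omega> a) \<le> real m * (nrm p d / 2 - 9) - s * R * sqrt (real m)}"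
    let ?c = "\<lambda>a. \<Sum>i\<in>{1..m}. clamped R d i \<omega> a"
    have "nrm p (\<lambda>a. ?c a - (?c a - ?b a)) \<le> nrm p ?c + nrm p (\<lambda>a. ?c a - ?b a)" by (rule nrm_triangle_minus)
    moreover have "nrm p (\<lambda>a. ?c a - ?b a) = nrm p (Y.S m \<omega>)"
      unfolding nrm_sum_clamped_centered[symmetric] by (intro arg_cong2[where f = L2_set]) (auto simp: Y.S_def)
    ultimately have "s * R * sqrt (real m) \<le> nrm p (Y.S m \<omega>)" using \<omega> b by simp
    then show "(s * R * sqrt (real m))\<^sup>2 \<le> (nrm p (Y.S m \<omega>))\<^sup>2" using s R by (intro power_mono) auto
  qed (use borel_measurable_integrable[OF int] in \<open>auto\<close>)
  also have "\<dots> \<le> expectation (\<lambda>\<omega>. (nrm p (Y.S m \<omega>))\<^sup>2) / (s * R * sqrt (real m))\<^sup>2"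
    using s R m by (intro integral_Markov_inequality_measure[where A = "{}"] int) auto
  also have "\<dots> \<le> (real m * (2 * R)\<^sup>2) / (s * R * sqrt (real m))\<^sup>2"
    by (intro divide_right_mono Y.expectation_nrm_S_square_le) auto
  also have "\<dots> = 4 / s\<^sup>2" using s R m by (simp add: power_mult_distrib)
  finally show ?thesis .
qed

text \<open>Exponential Markov inequality at parameter 1. In \<open>exp_clip_le\<close> the linear
  noise term has mean zero and the moment term contributes 4 * 8 = 32.\<close>

lemma prob_sum_clip_le:
  assumes v: "nrm p v \<le> 1" and a: "\<bar>a\<bar> \<le> 1/4"
  shows "prob {\<omega> \<in> space M. (\<Sum>i\<in>{1..m}. clip (a + c * ip p (N i \<omega>) v)) \<le> T}
    \<le> exp (T + real m * (- a + 2 * a\<^sup>2 + 32 * \<bar>c\<bar> powr \<alpha>))"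
proof -
  let ?e = "\<lambda>i \<omega>. exp (- clip (a + c * ip p (N i \<omega>) v))"
  have ip_meas: "(\<lambda>x. ip p x v) \<in> borel_measurable (vec_borel p)"
    by (intro borel_measurable_sum borel_measurable_times measurable_id_vec_component borel_measurable_const)
  have e_meas: "(\<lambda>x. exp (- clip (a + c * ip p x v))) \<in> borel_measurable (vec_borel p)"
    using ip_meas by measurable
  have ind: "indep_vars (\<lambda>_. borel) ?e {1..m}"
    by (rule indep_vars_compose2[OF indep, where Y = "\<lambda>_ x. exp (- clip (a + c * ip p x v))"]) (rule e_meas)
  have bdd: "bounded_rv M (?e i)" if "i \<in> {1..m}" for i
    unfolding bounded_rv_def
    by (intro conjI exI[of _ "exp 1"] measurable_compose[OF measurable_N e_meas] that) (auto simp: clip_def)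
  have prod_bdd: "bounded_rv M (\<lambda>\<omega>. \<Prod>i\<in>{1..k}. ?e i \<omega>)" if "k \<le> m" for k
    using that
  proof (induction k)
    case 0
    then show ?case by (simp add: bounded_rv_const)
  next
    case (Suc k)
    then have "bounded_rv M (\<lambda>\<omega>. (\<Prod>i\<in>{1..k}. ?e i \<omega>) * ?e (Suc k) \<omega>)"
      by (intro bounded_rv_mult bdd) auto
    then show ?case by simp
  qed
  have step: "expectation (?e i) \<le> exp (- a + 2 * a\<^sup>2 + 32 * \<bar>c\<bar> powr \<alpha>)" if i: "i \<in> {1..m}" for i
  proof -
    have int: "integrable M (\<lambda>\<omega>. 1 - (a + c * ip p (N i \<omega>) v) + 2 * a\<^sup>2 + 4 * (\<bar>c\<bar> powr \<alpha> * \<bar>ip p (N i \<omega>) v\<bar> powr \<alpha>))"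
      using integrable_ip[OF i, of v] integrable_moment[OF i v] by simp
    have "expectation (?e i) \<le> expectation (\<lambda>\<omega>. 1 - (a + c * ip p (N i \<omega>) v) + 2 * a\<^sup>2 + 4 * (\<bar>c\<bar> powr \<alpha> * \<bar>ip p (N i \<omega>) v\<bar> powr \<alpha>))"
    proof (intro integral_mono int bounded_rv_integrable bdd i)
      fix \<omega>
      show "?e i \<omega> \<le> 1 - (a + c * ip p (N i \<omega>) v) + 2 * a\<^sup>2 + 4 * (\<bar>c\<bar> powr \<alpha> * \<bar>ip p (N i \<omega>) v\<bar> powr \<alpha>)"
        using exp_clip_le[OF a \<alpha>, of "c * ip p (N i \<omega>) v"] by (simp add: abs_mult powr_mult)
    qed
    also have "\<dots> = 1 - a + 2 * a\<^sup>2 + 4 * (\<bar>c\<bar> powr \<alpha> * expectation (\<lambda>\<omega>. \<bar>ip p (N i \<omega>) v\<bar> powr \<alpha>))"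
      using integrable_ip[OF i, of v] integrable_moment[OF i v] expectation_ip[OF i, of v] by (simp add: prob_space)
    also have "\<dots> \<le> 1 - a + 2 * a\<^sup>2 + 4 * (\<bar>c\<bar> powr \<alpha> * 8)"
      by (intro add_left_mono mult_left_mono moment i v) auto
    also have "\<dots> \<le> exp (- a + 2 * a\<^sup>2 + 32 * \<bar>c\<bar> powr \<alpha>)"
      using exp_ge_add_one_self[of "- a + 2 * a\<^sup>2 + 32 * \<bar>c\<bar> powr \<alpha>"] by linarith
    finally show ?thesis .
  qed
  have "prob {\<omega> \<in> space M. (\<Sum>i\<in>{1..m}. clip (a + c * ip p (N i \<omega>) v)) \<le> T} =
      prob {\<omega> \<in> space M. exp (- T) \<le> (\<Prod>i\<in>{1..m}. ?e i \<omega>)}"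
    by (simp add: exp_sum[symmetric] sum_negf)
  also have "\<dots> \<le> expectation (\<lambda>\<omega>. \<Prod>i\<in>{1..m}. ?e i \<omega>) / exp (- T)"
    by (intro integral_Markov_inequality_measure[where A = "{}"] bounded_rv_integrable prod_bdd) (auto simp: prod_nonneg)
  also have "expectation (\<lambda>\<omega>. \<Prod>i\<in>{1..m}. ?e i \<omega>) = (\<Prod>i\<in>{1..m}. expectation (?e i))"
    by (intro indep_vars_lebesgue_integral ind bounded_rv_integrable bdd) auto
  also have "(\<Prod>i\<in>{1..m}. expectation (?e i)) \<le> (\<Prod>i\<in>{1..m}. exp (- a + 2 * a\<^sup>2 + 32 * \<bar>c\<bar> powr \<alpha>))"
    by (intro prod_mono conjI step) auto
  also have "(\<Prod>i\<in>{1..m}. exp (- a + 2 * a\<^sup>2 + 32 * \<bar>c\<bar> powr \<alpha>)) / exp (- T) =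
      exp (T + real m * (- a + 2 * a\<^sup>2 + 32 * \<bar>c\<bar> powr \<alpha>))"
    by (simp only: prod_constant exp_add exp_of_nat_mult exp_minus[of T] card_atLeastAtMost) (simp add: divide_inverse)
  finally show ?thesis by (simp add: divide_right_mono)
qed

end

section \<open>The three tests\<close>

text \<open>All three tests act on a sequence \<open>x\<close> of mirrored differences. Index 1
  pairs the outermost columns and hence straddles every change point.\<close>

definition norm_reject :: "nat \<Rightarrow> real \<Rightarrow> (nat \<Rightarrow> nat \<Rightarrow> real) \<Rightarrow> bool" where
  "norm_reject p t x \<longleftrightarrow> t * sqrt (real p) < nrm p (x 1)"

definition clamped_reject :: "nat \<Rightarrow> real \<Rightarrow> real \<Rightarrow> nat \<Rightarrow> (nat \<Rightarrow> nat \<Rightarrow> real) \<Rightarrow> bool" where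
  "clamped_reject p R \<tau> m x \<longleftrightarrow> \<tau> < nrm p (\<lambda>a. \<Sum>i\<in>{1..m}. clamp p R (x i) a)"

definition clipped_reject :: "nat \<Rightarrow> real \<Rightarrow> real \<Rightarrow> nat \<Rightarrow> (nat \<Rightarrow> nat \<Rightarrow> real) \<Rightarrow> bool" where
  "clipped_reject p l T m x \<longleftrightarrow> (\<exists>v\<in>directions p. T < (\<Sum>i\<in>{1..m}. clip (l * ip p (x i) v)))"

lemma measurable_ip_vec: "(\<lambda>x. ip p x v) \<in> borel_measurable (vec_borel p)"
  by (intro borel_measurable_sum borel_measurable_times measurable_id_vec_component borel_measurable_const)

lemma pred_norm_reject:
  assumes "(\<lambda>\<omega>. x \<omega> 1) \<in> M \<rightarrow>\<^sub>M vec_borel p"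
  shows "Measurable.pred M (\<lambda>\<omega>. norm_reject p t (x \<omega>))"
proof -
  note [measurable] = measurable_compose[OF assms measurable_nrm_vec]
  show ?thesis unfolding norm_reject_def by measurable
qed

lemma pred_clamped_reject:
  assumes "\<And>i. i \<in> {1..m} \<Longrightarrow> (\<lambda>\<omega>. x \<omega> i) \<in> M \<rightarrow>\<^sub>M vec_borel p"
  shows "Measurable.pred M (\<lambda>\<omega>. clamped_reject p R \<tau> m (x \<omega>))"
proof -
  have [measurable]: "(\<lambda>\<omega>. nrm p (\<lambda>a. \<Sum>i\<in>{1..m}. clamp p R (x \<omega> i) a)) \<in> borel_measurable M"
    by (intro measurable_nrm borel_measurable_sum measurable_vec_borel_component[OF measurable_compose[OF assms measurable_clamp]])
  show ?thesis unfolding clamped_reject_def by measurable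
qed

lemma pred_clipped_sum:
  assumes "\<And>i. i \<in> {1..m} \<Longrightarrow> (\<lambda>\<omega>. x \<omega> i) \<in> M \<rightarrow>\<^sub>M vec_borel p"
  shows "Measurable.pred M (\<lambda>\<omega>. T < (\<Sum>i\<in>{1..m}. clip (l * ip p (x \<omega> i) v)))"
proof -
  have [measurable]: "(\<lambda>\<omega>. \<Sum>i\<in>{1..m}. clip (l * ip p (x \<omega> i) v)) \<in> borel_measurable M"
    by (intro borel_measurable_sum measurable_compose[OF _ borel_measurable_clip] borel_measurable_times
        borel_measurable_const measurable_compose[OF assms measurable_ip_vec])
  show ?thesis by measurable
qed

lemma pred_clipped_reject:
  assumes "\<And>i. i \<in> {1..m} \<Longrightarrow> (\<lambda>\<omega>. x \<omega> i) \<in> M \<rightarrow>\<^sub>M vec_borel p"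
  shows "Measurable.pred M (\<lambda>\<omega>. clipped_reject p l T m (x \<omega>))"
  unfolding clipped_reject_def
  by (intro pred_intros_finite finite_directions pred_clipped_sum assms)

section \<open>Error probabilities of the three tests on shifted noise\<close>

context noise_sample
begin

definition shifted :: "(nat \<Rightarrow> real) \<Rightarrow> 'a \<Rightarrow> nat \<Rightarrow> nat \<Rightarrow> real" where
  "shifted d \<omega> i = (\<lambda>a\<in>{1..p}. d a + N i \<omega> a)"

lemma prob_norm_reject_null:
  assumes m: "1 \<le> m" and t: "0 < t"
  shows "prob {\<omega> \<in> space M. norm_reject p t (shifted (\<lambda>_. 0) \<omega>)} \<le> 41 / t"
proof -
  have [measurable]: "(\<lambda>\<omega>. nrm p (N 1 \<omega>)) \<in> borel_measurable M"
    using m by (intro measurable_compose[OF measurable_N measurable_nrm_vec]) auto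
  have "prob {\<omega> \<in> space M. norm_reject p t (shifted (\<lambda>_. 0) \<omega>)} \<le> prob {\<omega> \<in> space M. t * sqrt (real p) \<le> nrm p (N 1 \<omega>)}"
    unfolding norm_reject_def shifted_def nrm_restrict by (intro finite_measure_mono) auto
  also have "\<dots> \<le> 41 / t" using m by (intro prob_nrm_ge t) auto
  finally show ?thesis .
qed

lemma prob_norm_accept:
  assumes m: "1 \<le> m" and t: "0 < t" and d: "2 * t * sqrt (real p) \<le> nrm p d"
  shows "prob {\<omega> \<in> space M. \<not> norm_reject p t (shifted d \<omega>)} \<le> 41 / t"
  using prob_shifted_nrm_le[of 1 t d] m t d unfolding norm_reject_def shifted_def nrm_restrict not_less by simp

lemma prob_clamped_reject_null:
  assumes "0 < R" "0 < s"
  shows "prob {\<omega> \<in> space M. clamped_reject p R (9 * real m + sqrt (4 * R\<^sup>2 * real m + s)) m (shifted (\<lambda>_. 0) \<omega>)}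
    \<le> 144 * R ^ 3 * (real m)\<^sup>2 / s\<^sup>2"
  using prob_nrm_sum_clamped_null_gt[OF assms] unfolding clamped_reject_def clamped_def shifted_def .

lemma prob_clamped_accept:
  assumes "0 < R" "0 < s" "1 \<le> m" "0 < nrm p d" "nrm p d + 82 * sqrt (real p) \<le> R"
    and \<tau>: "\<tau> \<le> real m * (nrm p d / 2 - 9) - s * R * sqrt (real m)"
  shows "prob {\<omega> \<in> space M. \<not> clamped_reject p R \<tau> m (shifted d \<omega>)} \<le> 4 / s\<^sup>2"
proof -
  have "prob {\<omega> \<in> space M. \<not> clamped_reject p R \<tau> m (shifted d \<omega>)} \<le>
    prob {\<omega> \<in> space M. nrm p (\<lambda>a. \<Sum>i\<in>{1..m}. clamped R d i \<omega> a) \<le> real m * (nrm p d / 2 - 9) - s * R * sqrt (real m)}"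
    using \<tau> unfolding clamped_reject_def shifted_def clamped_def[symmetric] by (intro finite_measure_mono) auto
  also have "\<dots> \<le> 4 / s\<^sup>2" by (rule prob_nrm_sum_clamped_le[OF assms(1-5)])
  finally show ?thesis .
qed

lemma ip_shifted: "ip p (shifted d \<omega> i) v = ip p d v + ip p (N i \<omega>) v"
  unfolding shifted_def ip_restrict by (simp add: algebra_simps sum.distrib)

lemma pred_sum_clip: "Measurable.pred M (\<lambda>\<omega>. (\<Sum>i\<in>{1..m}. clip (a + c * ip p (N i \<omega>) v)) \<le> T)"
proof -
  have [measurable]: "(\<lambda>\<omega>. \<Sum>i\<in>{1..m}. clip (a + c * ip p (N i \<omega>) v)) \<in> borel_measurable M"
    by (intro borel_measurable_sum measurable_compose[OF _ borel_measurable_clip] borel_measurable_times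
        borel_measurable_add borel_measurable_const measurable_compose[OF measurable_N measurable_ip_vec])
  show ?thesis by measurable
qed

text \<open>Union bound over \<open>directions\<close>, which costs exp (6 p). Since
  \<open>clip\<close> is odd, replacing \<open>l\<close> by \<open>- l\<close> turns the upper tail
  into the lower tail of \<open>prob_sum_clip_le\<close>.\<close>

lemma prob_clipped_reject_null:
  assumes l: "0 < l"
  shows "prob {\<omega> \<in> space M. clipped_reject p l T m (shifted (\<lambda>_. 0) \<omega>)} \<le> exp (6 * real p + 32 * real m * l powr \<alpha> - T)"
proof -
  let ?E = "\<lambda>v. {\<omega> \<in> space M. (\<Sum>i\<in>{1..m}. clip (0 + (- l) * ip p (N i \<omega>) v)) \<le> - T}"
  have clip_minus: "clip (- y) = - clip y" for y by (auto simp: clip_def)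
  have E: "?E v \<in> events" for v by (rule predE[OF pred_sum_clip])
  have "{\<omega> \<in> space M. clipped_reject p l T m (shifted (\<lambda>_. 0) \<omega>)} \<subseteq> (\<Union>v\<in>directions p. ?E v)"
    by (auto simp: clipped_reject_def ip_shifted clip_minus sum_negf intro: less_imp_le)
  then have "prob {\<omega> \<in> space M. clipped_reject p l T m (shifted (\<lambda>_. 0) \<omega>)} \<le> prob (\<Union>v\<in>directions p. ?E v)"
    using E finite_directions by (intro finite_measure_mono) auto
  also have "\<dots> \<le> (\<Sum>v\<in>directions p. prob (?E v))"
    using E by (intro finite_measure_subadditive_finite finite_directions) auto
  also have "\<dots> \<le> (\<Sum>v\<in>directions p. exp (32 * real m * l powr \<alpha> - T))"
  proof (rule sum_mono)
    fix v assume "v \<in> directions p"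
    then have "nrm p v \<le> 1" using p by (rule nrm_directions_le)
    from prob_sum_clip_le[OF this, of 0 "- l" "- T"] l
    show "prob (?E v) \<le> exp (32 * real m * l powr \<alpha> - T)" by (simp add: mult_ac)
  qed
  also have "\<dots> \<le> exp (6 * real p) * exp (32 * real m * l powr \<alpha> - T)"
    using card_directions_le[of p] by (simp add: mult_right_mono)
  finally show ?thesis by (simp add: exp_add[symmetric] add_diff_eq)
qed

text \<open>One norming direction of \<open>d\<close> suffices. Monotonicity of \<open>clip\<close>
  lowers its shift to \<open>a\<close>, which is small enough for
  \<open>exp_clip_le\<close>.\<close>

lemma prob_clipped_accept:
  assumes l: "0 < l" and a: "0 \<le> a" "a \<le> 1/4" "a \<le> l * (3/8 * nrm p d)"
  shows "prob {\<omega> \<in> space M. \<not> clipped_reject p l T m (shifted d \<omega>)} \<le> exp (T + real m * (- a + 2 * a\<^sup>2 + 32 * l powr \<alpha>))"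
proof -
  obtain v where v: "v \<in> directions p" and dv: "3/8 * nrm p d \<le> ip p d v"
    using directions_norming[OF p] by blast
  have v1: "nrm p v \<le> 1" using v p by (rule nrm_directions_le)
  let ?E = "{\<omega> \<in> space M. (\<Sum>i\<in>{1..m}. clip (a + l * ip p (N i \<omega>) v)) \<le> T}"
  have "prob {\<omega> \<in> space M. \<not> clipped_reject p l T m (shifted d \<omega>)} \<le> prob ?E"
  proof (intro finite_measure_mono subsetI CollectI conjI)
    fix \<omega> assume \<omega>: "\<omega> \<in> {\<omega> \<in> space M. \<not> clipped_reject p l T m (shifted d \<omega>)}"
    have "a \<le> l * ip p d v" using a dv l by (meson mult_left_mono order_trans less_imp_le)
    then have "(\<Sum>i\<in>{1..m}. clip (a + l * ip p (N i \<omega>) v)) \<le> (\<Sum>i\<in>{1..m}. clip (l * ip p (shifted d \<omega> i) v))"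
      unfolding ip_shifted by (intro sum_mono clip_mono) (simp add: distrib_left)
    also have "\<dots> \<le> T" using \<omega> v by (auto simp: clipped_reject_def not_less)
    finally show "(\<Sum>i\<in>{1..m}. clip (a + l * ip p (N i \<omega>) v)) \<le> T" .
  qed (use predE[OF pred_sum_clip] in auto)
  also have "\<dots> \<le> exp (T + real m * (- a + 2 * a\<^sup>2 + 32 * l powr \<alpha>))"
    using prob_sum_clip_le[OF v1, of a l T] a l by simp
  finally show ?thesis .
qed

end

section \<open>Differences of mirrored columns\<close>

definition column_diff :: "nat \<Rightarrow> nat \<Rightarrow> (nat \<Rightarrow> nat \<Rightarrow> real) \<Rightarrow> nat \<Rightarrow> nat \<Rightarrow> real" where
  "column_diff p n X i = (\<lambda>a\<in>{1..p}. X i a - X (n + 1 - i) a)"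

lemma measurable_column: "t \<in> {1..n} \<Longrightarrow> (\<lambda>X. X t) \<in> mat_borel p n \<rightarrow>\<^sub>M vec_borel p"
  unfolding mat_borel_def by (rule measurable_component_singleton)

lemma measurable_column_diff:
  assumes "i \<in> {1..n}"
  shows "(\<lambda>X. column_diff p n X i) \<in> mat_borel p n \<rightarrow>\<^sub>M vec_borel p"
  unfolding column_diff_def using assms
  by (intro measurable_vec_borelI borel_measurable_diff measurable_vec_borel_component[OF measurable_column]) auto

lemma powr_diff_le:
  fixes x y \<alpha> :: real
  assumes "0 \<le> \<alpha>" "\<alpha> \<le> 2"
  shows "\<bar>x - y\<bar> powr \<alpha> \<le> 4 * (\<bar>x\<bar> powr \<alpha> + \<bar>y\<bar> powr \<alpha>)"
proof -
  define z where "z = max \<bar>x\<bar> \<bar>y\<bar>"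
  have "\<bar>x - y\<bar> powr \<alpha> \<le> (2 * z) powr \<alpha>"
    using assms by (intro powr_mono2) (auto simp: z_def)
  also have "\<dots> = 2 powr \<alpha> * z powr \<alpha>" by (simp add: z_def powr_mult)
  also have "\<dots> \<le> 4 * z powr \<alpha>"
    using powr_mono[of \<alpha> 2 "2::real"] assms by (intro mult_right_mono) auto
  also have "\<dots> \<le> 4 * (\<bar>x\<bar> powr \<alpha> + \<bar>y\<bar> powr \<alpha>)"
    by (auto simp: z_def max_def)
  finally show ?thesis .
qed

text \<open>Extends the moment condition from unit vectors to the unit ball by normalising; the zero
  vector is treated apart.\<close>

lemma noise_class_moment:
  assumes Q: "Q \<in> noise_class \<alpha> p" and \<alpha>: "0 < \<alpha>" and v: "nrm p v \<le> 1"
  shows "(\<integral>\<^sup>+w. ennreal (\<bar>ip p w v\<bar> powr \<alpha>) \<partial>Q) \<le> 1"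
proof (cases "nrm p v = 0")
  case True
  then have "ip p w v = 0" for w
    using abs_ip_le[where u = w and v = v and p = p] by simp
  then show ?thesis using \<alpha> by simp
next
  case False
  then have h: "0 < nrm p v" using L2_set_nonneg[of v "{1..p}"] by linarith
  define u where "u = (\<lambda>a\<in>{1..p}. inverse (nrm p v) * v a)"
  have u1: "nrm p u = 1" unfolding u_def nrm_restrict using h by (subst nrm_scale) simp
  have "u \<in> space (vec_borel p)" by (auto simp: vec_borel_def space_PiM u_def)
  then have mom: "(\<integral>\<^sup>+w. ennreal (\<bar>ip p w u\<bar> powr \<alpha>) \<partial>Q) \<le> 1"
    using Q u1 by (auto simp: noise_class_def)
  have eq: "ip p w u = inverse (nrm p v) * ip p w v" for w
  proof -
    have "ip p w u = (\<Sum>a\<in>{1..p}. w a * (inverse (nrm p v) * v a))" unfolding u_def by (intro sum.cong) auto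
    then show ?thesis by (simp add: sum_distrib_left mult_ac)
  qed
  have "(\<integral>\<^sup>+w. ennreal (\<bar>ip p w v\<bar> powr \<alpha>) \<partial>Q) \<le> (\<integral>\<^sup>+w. ennreal (\<bar>ip p w u\<bar> powr \<alpha>) \<partial>Q)"
  proof (intro nn_integral_mono ennreal_leI powr_mono2)
    fix w
    have "ip p w v = nrm p v * ip p w u" using h by (simp add: eq)
    then show "\<bar>ip p w v\<bar> \<le> \<bar>ip p w u\<bar>"
      using mult_right_mono[OF v, of "\<bar>ip p w u\<bar>"] h by (simp add: abs_mult)
  qed (use \<alpha> in auto)
  also note mom
  finally show ?thesis .
qed

text \<open>Since \<open>2 * m \<le> n\<close>, the pairs {i, n + 1 - i} with i \<le> m are
  disjoint, which gives independence of the differences. The moment bound is 4 * (1 + 1) by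
  \<open>powr_diff_le\<close>.\<close>

lemma noise_sample_column_diff:
  assumes P: "P \<in> indep_noise_class \<alpha> p n" and \<alpha>: "1 \<le> \<alpha>" "\<alpha> \<le> 2" and p: "1 \<le> p" and m: "2 * m \<le> n"
  shows "noise_sample P (\<lambda>i E. column_diff p n E i) m p \<alpha>"
proof -
  from P have ps: "prob_space P" and sets_P: "sets P = sets (mat_borel p n)"
    and ind: "prob_space.indep_vars P (\<lambda>_. vec_borel p) (\<lambda>t E. E t) {1..n}"
    and noise: "\<And>t. t \<in> {1..n} \<Longrightarrow> distr P (vec_borel p) (\<lambda>E. E t) \<in> noise_class \<alpha> p"
    by (auto simp: indep_noise_class_def)
  interpret prob_space P by (rule ps)
  have col [measurable]: "(\<lambda>E. E t) \<in> P \<rightarrow>\<^sub>M vec_borel p" if "t \<in> {1..n}" for t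
    using measurable_column[OF that, of p] by (simp add: measurable_cong_sets[OF sets_P refl])
  have comp_int: "integrable P (\<lambda>E. E t a)" and comp_zero: "expectation (\<lambda>E. E t a) = 0"
    if t: "t \<in> {1..n}" and a: "a \<in> {1..p}" for t a
    using noise[OF t] a integrable_distr_eq[OF col[OF t] measurable_id_vec_component[OF a]]
      integral_distr[OF col[OF t] measurable_id_vec_component[OF a]]
    by (auto simp: noise_class_def)
  have powr_meas: "(\<lambda>w. \<bar>ip p w v\<bar> powr \<alpha>) \<in> borel_measurable (vec_borel p)" for v
    using measurable_ip_vec[where p = p and v = v] by measurable
  have mom_int: "integrable P (\<lambda>E. \<bar>ip p (E t) v\<bar> powr \<alpha>)" and mom_le: "expectation (\<lambda>E. \<bar>ip p (E t) v\<bar> powr \<alpha>) \<le> 1"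
    if t: "t \<in> {1..n}" and v: "nrm p v \<le> 1" for t v
  proof -
    have nn: "(\<integral>\<^sup>+E. ennreal (\<bar>ip p (E t) v\<bar> powr \<alpha>) \<partial>P) \<le> 1"
    proof -
      have [measurable]: "(\<lambda>w. ennreal (\<bar>ip p w v\<bar> powr \<alpha>)) \<in> borel_measurable (vec_borel p)"
        using powr_meas[of v] by measurable
      have "(\<integral>\<^sup>+w. ennreal (\<bar>ip p w v\<bar> powr \<alpha>) \<partial>distr P (vec_borel p) (\<lambda>E. E t)) \<le> 1"
        using \<alpha> by (intro noise_class_moment[OF noise[OF t] _ v]) auto
      then show ?thesis using nn_integral_distr[OF col[OF t], of "\<lambda>w. ennreal (\<bar>ip p w v\<bar> powr \<alpha>)"] by simp
    qed
    have meas: "(\<lambda>E. \<bar>ip p (E t) v\<bar> powr \<alpha>) \<in> borel_measurable P"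
      by (rule measurable_compose[OF col[OF t] powr_meas])
    show int: "integrable P (\<lambda>E. \<bar>ip p (E t) v\<bar> powr \<alpha>)"
      using nn by (intro integrableI_nonneg meas) (auto intro: le_less_trans)
    have "ennreal (expectation (\<lambda>E. \<bar>ip p (E t) v\<bar> powr \<alpha>)) \<le> 1"
      using nn nn_integral_eq_integral[OF int] by simp
    then show "expectation (\<lambda>E. \<bar>ip p (E t) v\<bar> powr \<alpha>) \<le> 1" by simp
  qed
  have mirror: "n + 1 - i \<in> {1..n}" "i \<in> {1..n}" if "i \<in> {1..m}" for i
    using that m by auto
  have ip_diff: "ip p (column_diff p n E i) v = ip p (E i) v - ip p (E (n + 1 - i)) v" for E i v
    unfolding column_diff_def ip_restrict by (simp add: algebra_simps sum_subtractf)
  have diff_int: "integrable P (\<lambda>E. 4 * (\<bar>ip p (E i) v\<bar> powr \<alpha> + \<bar>ip p (E (n + 1 - i)) v\<bar> powr \<alpha>))"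
    if "i \<in> {1..m}" "nrm p v \<le> 1" for i v
    using mom_int[OF mirror(1)[OF that(1)] that(2)] mom_int[OF mirror(2)[OF that(1)] that(2)]
    by (intro integrable_mult_right Bochner_Integration.integrable_add)
  have diff_mom_int: "integrable P (\<lambda>E. \<bar>ip p (column_diff p n E i) v\<bar> powr \<alpha>)"
    if i: "i \<in> {1..m}" and v: "nrm p v \<le> 1" for i v
  proof (rule Bochner_Integration.integrable_bound[OF diff_int[OF i v]])
    show "(\<lambda>E. \<bar>ip p (column_diff p n E i) v\<bar> powr \<alpha>) \<in> borel_measurable P"
      using measurable_compose[OF measurable_column_diff[OF mirror(2)[OF i], of p] powr_meas[of v]]
      by (simp add: measurable_cong_sets[OF sets_P refl])
    show "AE E in P. norm (\<bar>ip p (column_diff p n E i) v\<bar> powr \<alpha>) \<le>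
       norm (4 * (\<bar>ip p (E i) v\<bar> powr \<alpha> + \<bar>ip p (E (n + 1 - i)) v\<bar> powr \<alpha>))"
      unfolding ip_diff using powr_diff_le[of \<alpha>] \<alpha> by (intro AE_I2) simp
  qed
  show ?thesis
  proof unfold_locales
    show "1 \<le> \<alpha>" "\<alpha> \<le> 2" "1 \<le> p" by (fact \<alpha> p)+
    let ?K = "\<lambda>i. {i, n + 1 - i}"
    have "indep_vars (\<lambda>i. PiM (?K i) (\<lambda>_. vec_borel p)) (\<lambda>i E. restrict (\<lambda>t. E t) (?K i)) {1..m}"
      using m by (intro indep_vars_restrict[OF ind]) (auto simp: disjoint_family_on_def)
    then have "indep_vars (\<lambda>_. vec_borel p)
        (\<lambda>i E. (\<lambda>y. \<lambda>a\<in>{1..p}. y i a - y (n + 1 - i) a) (restrict (\<lambda>t. E t) (?K i))) {1..m}"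
      by (rule indep_vars_compose2[where Y = "\<lambda>i y. \<lambda>a\<in>{1..p}. y i a - y (n + 1 - i) a"])
         (intro measurable_vec_borelI borel_measurable_diff measurable_PiM_vec_component; simp)
    then show "indep_vars (\<lambda>_. vec_borel p) (\<lambda>i E. column_diff p n E i) {1..m}"
      by (simp add: column_diff_def)
    fix i assume i: "i \<in> {1..m}"
    show "integrable P (\<lambda>E. column_diff p n E i a)" "expectation (\<lambda>E. column_diff p n E i a) = 0"
      if "a \<in> {1..p}" for a
      using comp_int[OF mirror(1)[OF i] that] comp_int[OF mirror(2)[OF i] that]
        comp_zero[OF mirror(1)[OF i] that] comp_zero[OF mirror(2)[OF i] that] that
      by (simp_all add: column_diff_def)
    fix v assume v: "nrm p v \<le> 1"
    show "integrable P (\<lambda>E. \<bar>ip p (column_diff p n E i) v\<bar> powr \<alpha>)" by (rule diff_mom_int[OF i v])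
    have "expectation (\<lambda>E. \<bar>ip p (column_diff p n E i) v\<bar> powr \<alpha>) \<le>
        expectation (\<lambda>E. 4 * (\<bar>ip p (E i) v\<bar> powr \<alpha> + \<bar>ip p (E (n + 1 - i)) v\<bar> powr \<alpha>))"
      using powr_diff_le[of \<alpha>] \<alpha> by (intro integral_mono diff_mom_int diff_int i v) (simp add: ip_diff)
    also have "\<dots> \<le> 4 * (1 + 1)"
      using mom_le[OF mirror(1)[OF i] v] mom_le[OF mirror(2)[OF i] v]
        mom_int[OF mirror(1)[OF i] v] mom_int[OF mirror(2)[OF i] v] by simp
    finally show "expectation (\<lambda>E. \<bar>ip p (column_diff p n E i) v\<bar> powr \<alpha>) \<le> 8" by simp
  qed
qed

section \<open>Calibration of the constants\<close>

lemma exp_minus_le_inverse_square: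
  fixes y :: real
  assumes "0 < y"
  shows "exp (- y) \<le> 4 / y\<^sup>2"
proof -
  have "y / 2 \<le> exp (y / 2)" using exp_ge_add_one_self[of "y / 2"] by linarith
  then have "(y / 2)\<^sup>2 \<le> (exp (y / 2))\<^sup>2" using assms by (intro power_mono) auto
  also have "(exp (y / 2))\<^sup>2 = exp y" by (simp add: power2_eq_square exp_add[symmetric])
  finally show ?thesis using assms by (simp add: exp_minus power_divide field_simps)
qed

lemma sum_geometric_le:
  fixes r :: real
  assumes "finite J" "0 \<le> r" "r < 1"
  shows "(\<Sum>j\<in>J. r ^ j) \<le> 1 / (1 - r)"
  using sum_le_suminf[of "\<lambda>j. r ^ j" J] suminf_geometric[of r] summable_geometric[of r] assms by simp

lemma ln_ln_pos: "3 \<le> n \<Longrightarrow> 0 < ln (ln (real n))"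
proof -
  assume "3 \<le> n"
  moreover have "exp 1 < (3::real)" using e_less_272 by simp
  ultimately have "exp 1 < real n" by linarith
  then have "ln (exp 1) < ln (real n)" using \<open>3 \<le> n\<close> by (subst ln_less_cancel_iff) auto
  then have "1 < ln (real n)" by simp
  then show ?thesis by simp
qed

text \<open>The factor 2 ensures that 2^j disjoint mirrored pairs of columns exist.\<close>

definition scales :: "nat \<Rightarrow> nat set" where
  "scales n = {j. 2 * 2 ^ j \<le> n}"

text \<open>From 2^(j + 1) \<le> n and ln 2 \<ge> 1/2. The left side counts the scales 0..j, so the
  union bound runs over at most 2 ln n of them.\<close>

lemma scales_bound:
  assumes "j \<in> scales n"
  shows "real (j + 1) \<le> 2 * ln (real n)"
proof -
  have le: "2 ^ (j + 1) \<le> n" using assms by (simp add: scales_def power_add mult.commute)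
  have "real (j + 1) * ln 2 = ln (2 ^ (j + 1))" by (simp only: ln_realpow)
  also have "\<dots> \<le> ln (real n)"
  proof (subst ln_le_cancel_iff)
    have "real (2 ^ (j + 1)) \<le> real n" using le by (simp only: of_nat_le_iff)
    then show "(2::real) ^ (j + 1) \<le> real n" by simp
    then show "0 < real n" by (rule less_le_trans[rotated]) simp
  qed simp
  finally have "real (j + 1) * ln 2 \<le> ln (real n)" .
  moreover have "real (j + 1) * (1/2) \<le> real (j + 1) * ln 2"
    using ln2_ge_two_thirds by (intro mult_left_mono) auto
  ultimately have "real (j + 1) * (1/2) \<le> ln (real n)" by (rule order_trans[rotated])
  then show ?thesis by simp
qed

lemma scales_subset: "scales n \<subseteq> {..<nat \<lfloor>2 * ln (real n)\<rfloor>}"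
proof
  fix j assume "j \<in> scales n"
  from scales_bound[OF this] show "j \<in> {..<nat \<lfloor>2 * ln (real n)\<rfloor>}"
    by (simp add: less_eq_Suc_le le_nat_floor)
qed

lemma finite_scales: "finite (scales n)"
  by (rule finite_subset[OF scales_subset]) simp

lemma card_scales_le:
  assumes "1 \<le> n"
  shows "real (card (scales n)) \<le> 2 * ln (real n)"
proof -
  have "card (scales n) \<le> nat \<lfloor>2 * ln (real n)\<rfloor>"
    using card_mono[OF _ scales_subset[of n]] by simp
  moreover have "0 \<le> 2 * ln (real n)" using assms by simp
  ultimately show ?thesis by linarith
qed

section \<open>Constants for a prescribed error level\<close>

locale error_level =
  fixes \<epsilon> :: real
  assumes \<epsilon>_pos: "0 < \<epsilon>" and \<epsilon>_less: "\<epsilon> < 1"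
begin

text \<open>Each of these constants makes one error contribution at most \<epsilon> / 8: 41 / t for
  the first test, exp (- \<open>l\<epsilon>\<close>) and 4 / s^2 for the power of the other two, and
  \<open>K\<close>, \<open>q\<close>, \<open>B\<close> for the three sums over scales in
  \<open>sum_scale_bounds\<close>.\<close>

definition t :: real where "t = 328 / \<epsilon>"
definition l\<epsilon> :: real where "l\<epsilon> = ln (8 / \<epsilon>)"
text \<open>The first summand keeps the shift of the clipped test below 1/4, the second makes its
  false alarms summable over scales.\<close>

definition K :: real where "K = 16 * (390 + l\<epsilon>) + 64 * 1040\<^sup>2 / \<epsilon>"
definition B :: real where "B = 1 + ln (16 / \<epsilon>) / ln (ln 3)"
definition q :: real where "q = sqrt (8 * 36864 * t ^ 3 * sqrt K / \<epsilon>)"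
definition s :: real where "s = sqrt (32 / \<epsilon>)"

lemma t_ge: "328 \<le> t" using \<epsilon>_pos \<epsilon>_less by (simp add: t_def field_simps)
lemma l\<epsilon>_pos: "0 < l\<epsilon>" using \<epsilon>_pos \<epsilon>_less by (simp add: l\<epsilon>_def field_simps)
lemma K_ge: "16 * (390 + l\<epsilon>) \<le> K" "64 * 1040\<^sup>2 / \<epsilon> \<le> K" using \<epsilon>_pos l\<epsilon>_pos by (simp_all add: K_def)
lemma K_ge_1: "1 \<le> K" using K_ge(1) l\<epsilon>_pos by (simp add: algebra_simps)
lemma ln_ln_3_pos: "0 < ln (ln (3::real))" using ln_ln_pos[of 3] by simp
lemma B_ge: "1 \<le> B" using \<epsilon>_pos \<epsilon>_less ln_ln_3_pos by (simp add: B_def field_simps)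
lemma q_pos: "0 < q" using \<epsilon>_pos t_ge K_ge_1 by (simp add: q_def)
lemma s_pos: "0 < s" using \<epsilon>_pos by (simp add: s_def)

text \<open>Twice the largest shift that the first test may miss, leaving room for noise of norm 82
  sqrt p.\<close>

definition radius :: "nat \<Rightarrow> real" where
  "radius p = 4 * t * sqrt (real p)"

text \<open>The terms are the bias, the diagonal part of the squared norm, and an allowance for its
  off-diagonal part.\<close>

definition clamped_threshold :: "nat \<Rightarrow> nat \<Rightarrow> real" where
  "clamped_threshold p m = 9 * real m + sqrt (4 * (radius p)\<^sup>2 * real m + q * real p * real m)"

text \<open>
  The summand \<open>6 p\<close> pays for the union bound over \<open>directions p\<close>; the minimum is the remaining exponent
  of the false alarm probability at scale \<open>m\<close>.
\<close>

definition weight :: "nat \<Rightarrow> nat \<Rightarrow> nat \<Rightarrow> real" where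
  "weight p n m = 6 * real p + min (real m / 1040) (B * ln (ln (real n)))"

text \<open>Chosen so that \<open>m * temper \<alpha> p n m powr \<alpha> = weight p n m\<close>, which balances moment and deviation.\<close>

definition temper :: "real \<Rightarrow> nat \<Rightarrow> nat \<Rightarrow> nat \<Rightarrow> real" where
  "temper \<alpha> p n m = (weight p n m / real m) powr (1 / \<alpha>)"

text \<open>The threshold factor 33 exceeds the 32 of the moment bound by one, which leaves
  \<open>6 * p - weight p n m\<close> as exponent of the false alarm probability.\<close>

definition scale_reject :: "real \<Rightarrow> nat \<Rightarrow> nat \<Rightarrow> nat \<Rightarrow> (nat \<Rightarrow> nat \<Rightarrow> real) \<Rightarrow> bool" where
  "scale_reject \<alpha> p n m x \<longleftrightarrow>
     (if real m < K * real p then clamped_reject p (radius p) (clamped_threshold p m) m x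
      else clipped_reject p (temper \<alpha> p n m) (33 * weight p n m) m x)"

section \<open>False alarms at each scale and their sum\<close>

lemma radius_pos: "1 \<le> p \<Longrightarrow> 0 < radius p"
  using t_ge by (simp add: radius_def)

lemma weight_ge: "3 \<le> n \<Longrightarrow> 6 * real p \<le> weight p n m"
  using B_ge ln_ln_pos[of n] by (simp add: weight_def)

lemma weight_pos: "3 \<le> n \<Longrightarrow> 1 \<le> p \<Longrightarrow> 0 < weight p n m"
  using weight_ge[of n p m] by simp

lemma temper_pos: "3 \<le> n \<Longrightarrow> 1 \<le> p \<Longrightarrow> 1 \<le> m \<Longrightarrow> 0 < temper \<alpha> p n m"
  using weight_pos[of n p m] by (simp add: temper_def)

lemma temper_powr:
  "3 \<le> n \<Longrightarrow> 1 \<le> p \<Longrightarrow> 1 \<le> m \<Longrightarrow> 1 \<le> \<alpha> \<Longrightarrow> real m * temper \<alpha> p n m powr \<alpha> = weight p n m"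
  using weight_pos[of n p m] by (simp add: temper_def powr_powr)

text \<open>A rational rate above 1 / sqrt 2, whose geometric series sums to 4.\<close>

lemma inverse_sqrt_le:
  assumes "m = 2 ^ j"
  shows "1 / sqrt (real m) \<le> (3/4) ^ j"
proof -
  have "4/3 \<le> sqrt 2" by (rule real_le_rsqrt) (simp add: power2_eq_square)
  then have "1 / sqrt 2 \<le> 3/4" by (simp add: field_simps)
  then have "(1 / sqrt 2) ^ j \<le> (3/4) ^ j" by (intro power_mono) auto
  then show ?thesis by (simp add: assms real_sqrt_power power_divide)
qed

text \<open>The cube of the radius is of order p^(3/2), against p^2 in the denominator;
  \<open>m < K * p\<close> converts the remaining 1 / sqrt p into decay in \<open>m\<close>. The
  constant is 144 * 4^3.\<close>

lemma clamped_null_bound: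
  assumes p: "1 \<le> p" and m: "1 \<le> m" and mK: "real m < K * real p"
  shows "144 * radius p ^ 3 * (real m)\<^sup>2 / (q * real p * real m)\<^sup>2 \<le> 9216 * t ^ 3 * sqrt K / q\<^sup>2 * (1 / sqrt (real m))"
proof -
  define y where "y = sqrt (real p)"
  have y: "0 < y" "real p = y\<^sup>2" using p by (auto simp: y_def)
  have "144 * radius p ^ 3 * (real m)\<^sup>2 / (q * real p * real m)\<^sup>2 = 9216 * t ^ 3 / q\<^sup>2 * (1 / y)"
    using y m q_pos unfolding radius_def y_def[symmetric] y(2)
    by (simp add: power_mult_distrib field_simps power2_eq_square power3_eq_cube)
  also have "\<dots> \<le> 9216 * t ^ 3 / q\<^sup>2 * (sqrt K * (1 / sqrt (real m)))"
  proof (intro mult_left_mono)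
    have "sqrt (real m) \<le> sqrt (K * real p)" using mK by simp
    also have "\<dots> = sqrt K * y" by (simp add: real_sqrt_mult y_def)
    finally show "1 / y \<le> sqrt K * (1 / sqrt (real m))" using y m by (simp add: field_simps)
  qed (use t_ge in auto)
  finally show ?thesis by simp
qed

text \<open>The exponential of a minimum splits into two terms. In the first, 1 / m^2 is used once
  as 1 / K, which makes it small, and once as 1 / m, which makes it summable.\<close>

lemma clipped_null_bound:
  assumes m: "1 \<le> m" "real m \<ge> K * real p" "1 \<le> p"
  shows "exp (6 * real p - weight p n m) \<le> 4 * 1040\<^sup>2 / K * (1 / real m) + exp (- (B * ln (ln (real n))))"
proof -
  have "exp (6 * real p - weight p n m) = exp (- min (real m / 1040) (B * ln (ln (real n))))"
    by (simp add: weight_def)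
  also have "\<dots> \<le> exp (- (real m / 1040)) + exp (- (B * ln (ln (real n))))"
    by (auto simp: min_def add_increasing add_increasing2)
  also have "exp (- (real m / 1040)) \<le> 4 / (real m / 1040)\<^sup>2"
    using m by (intro exp_minus_le_inverse_square) auto
  also have "\<dots> = 4 * 1040\<^sup>2 * (1 / real m) * (1 / real m)"
    using m by (simp add: power2_eq_square)
  also have "\<dots> \<le> 4 * 1040\<^sup>2 * (1 / K) * (1 / real m)"
  proof (intro mult_right_mono mult_left_mono)
    have "K * 1 \<le> K * real p" using K_ge_1 m by (intro mult_left_mono) auto
    then have "K \<le> real m" using m by linarith
    then show "1 / real m \<le> 1 / K" using K_ge_1 m by (intro divide_left_mono) auto
  qed auto
  finally show ?thesis by simp
qed

text \<open>Both branches get the same bound, so it can be summed over all scales without sorting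
  them by branch.\<close>

lemma prob_scale_reject_null:
  assumes N: "noise_sample M N m p \<alpha>" and m: "m = 2 ^ j" and n: "3 \<le> n"
  shows "measure M {\<omega> \<in> space M. scale_reject \<alpha> p n m (noise_sample.shifted N p (\<lambda>_. 0) \<omega>)} \<le>
    9216 * t ^ 3 * sqrt K / q\<^sup>2 * (3/4) ^ j + 4 * 1040\<^sup>2 / K * (1/2) ^ j + exp (- (B * ln (ln (real n))))"
    (is "?P \<le> ?a + ?b + ?c")
proof -
  interpret noise_sample M N m p \<alpha> by (rule N)
  have m1: "1 \<le> m" by (simp add: m)
  have b: "4 * 1040\<^sup>2 / K * (1/2) ^ j = 4 * 1040\<^sup>2 / K * (1 / real m)"
    by (simp add: m power_one_over)
  have nonneg: "0 \<le> ?a" "0 \<le> ?b" "0 \<le> ?c"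
    using t_ge K_ge_1 by (auto intro!: mult_nonneg_nonneg divide_nonneg_nonneg)
  show ?thesis
  proof (cases "real m < K * real p")
    case True
    have "?P \<le> 144 * radius p ^ 3 * (real m)\<^sup>2 / (q * real p * real m)\<^sup>2"
      unfolding scale_reject_def clamped_threshold_def if_P[OF True]
      using p m1 q_pos by (intro prob_clamped_reject_null radius_pos) auto
    also have "\<dots> \<le> 9216 * t ^ 3 * sqrt K / q\<^sup>2 * (1 / sqrt (real m))"
      by (rule clamped_null_bound[OF p m1 True])
    also have "\<dots> \<le> ?a" using t_ge K_ge_1 by (intro mult_left_mono inverse_sqrt_le m) auto
    finally show ?thesis using nonneg by linarith
  next
    case False
    have "?P \<le> exp (6 * real p + 32 * real m * temper \<alpha> p n m powr \<alpha> - 33 * weight p n m)"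
      unfolding scale_reject_def if_not_P[OF False] by (intro prob_clipped_reject_null temper_pos n p m1)
    also have "\<dots> = exp (6 * real p - weight p n m)"
      using temper_powr[OF n p m1 \<alpha>(1)] by (simp add: mult.assoc)
    also have "\<dots> \<le> ?b + ?c" unfolding b using False by (intro clipped_null_bound m1 p) auto
    finally show ?thesis using nonneg by linarith
  qed
qed

lemma sum_scale_bounds:
  assumes n: "3 \<le> n"
  shows "(\<Sum>j\<in>scales n. 9216 * t ^ 3 * sqrt K / q\<^sup>2 * (3/4) ^ j + 4 * 1040\<^sup>2 / K * (1/2) ^ j + exp (- (B * ln (ln (real n)))))
    \<le> 3 * \<epsilon> / 8"
proof -
  have "(\<Sum>j\<in>scales n. 9216 * t ^ 3 * sqrt K / q\<^sup>2 * (3/4) ^ j) = 9216 * t ^ 3 * sqrt K / q\<^sup>2 * (\<Sum>j\<in>scales n. (3/4) ^ j)"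
    by (simp add: sum_distrib_left)
  also have "\<dots> \<le> 9216 * t ^ 3 * sqrt K / q\<^sup>2 * 4"
    using sum_geometric_le[OF finite_scales, of "3/4" n] t_ge K_ge_1 by (intro mult_left_mono) auto
  also have "\<dots> = \<epsilon> / 8"
  proof -
    have "q\<^sup>2 = 8 * 36864 * t ^ 3 * sqrt K / \<epsilon>" using t_ge K_ge_1 \<epsilon>_pos by (simp add: q_def)
    then show ?thesis using t_ge K_ge_1 \<epsilon>_pos by simp
  qed
  finally have 1: "(\<Sum>j\<in>scales n. 9216 * t ^ 3 * sqrt K / q\<^sup>2 * (3/4) ^ j) \<le> \<epsilon> / 8" .
  have "(\<Sum>j\<in>scales n. 4 * 1040\<^sup>2 / K * (1/2) ^ j) = 4 * 1040\<^sup>2 / K * (\<Sum>j\<in>scales n. (1/2) ^ j)"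
    by (simp add: sum_distrib_left)
  also have "\<dots> \<le> 4 * 1040\<^sup>2 / K * 2"
    using sum_geometric_le[OF finite_scales, of "1/2" n] K_ge_1 by (intro mult_left_mono) auto
  also have "\<dots> \<le> \<epsilon> / 8"
    using K_ge(2) K_ge_1 \<epsilon>_pos by (simp add: field_simps)
  finally have 2: "(\<Sum>j\<in>scales n. 4 * 1040\<^sup>2 / K * (1/2) ^ j) \<le> \<epsilon> / 8" .
  have lnpos: "0 < ln (real n)" using n by simp
  have "(\<Sum>j\<in>scales n. exp (- (B * ln (ln (real n))))) \<le> 2 * ln (real n) * exp (- (B * ln (ln (real n))))"
    using card_scales_le[of n] n by (simp add: mult_right_mono)
  also have "\<dots> = 2 * exp (- ((B - 1) * ln (ln (real n))))"
  proof -
    \<comment> \<open>The number of scales is of order exp (ln ln n) and so uses up one unit of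
      \<open>B\<close>; the rest of \<open>B\<close> is calibrated at n = 3.\<close>
    have "ln (real n) * exp (- (B * ln (ln (real n)))) = exp (ln (ln (real n))) * exp (- (B * ln (ln (real n))))"
      using lnpos by simp
    also have "\<dots> = exp (- ((B - 1) * ln (ln (real n))))" by (simp add: exp_add[symmetric] algebra_simps)
    finally show ?thesis by simp
  qed
  also have "\<dots> \<le> 2 * exp (- ln (16 / \<epsilon>))"
  proof -
    have "ln (ln 3) \<le> ln (ln (real n))" using n by simp
    then have "(B - 1) * ln (ln 3) \<le> (B - 1) * ln (ln (real n))" using B_ge by (intro mult_left_mono) auto
    then show ?thesis using ln_ln_3_pos by (simp add: B_def)
  qed
  also have "\<dots> = \<epsilon> / 8" using \<epsilon>_pos by (simp add: exp_minus)
  finally have 3: "(\<Sum>j\<in>scales n. exp (- (B * ln (ln (real n))))) \<le> \<epsilon> / 8" .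
  show ?thesis using 1 2 3 by (simp only: sum.distrib)
qed

section \<open>Power at a single scale\<close>

definition C_clamped :: real where
  "C_clamped = 2 * (36 * sqrt K + 8 * s * t + 2 * sqrt (64 * t\<^sup>2 + q))"

text \<open>16/3 = 2 * 8/3 undoes the norming constant 3/8 and the factor 2 of the required shift;
  \<open>24 * B\<close> comes from \<open>weight_powr_le\<close>.\<close>

definition C_clipped :: real where
  "C_clipped = 16/3 * (65 + l\<epsilon>) * (24 * B)"

lemma C_nonneg: "0 < C_clamped" "0 < C_clipped"
  using s_pos t_ge q_pos K_ge_1 l\<epsilon>_pos B_ge
  by (auto simp: C_clamped_def C_clipped_def intro!: add_pos_nonneg add_pos_pos mult_pos_pos)

text \<open>After division by \<open>m\<close> all deviations are multiples of w = sqrt (p / m). The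
  constant bias terms fit in as well, because \<open>m < K * p\<close> gives
  \<open>1 \<le> sqrt K * w\<close>.\<close>

lemma clamped_threshold_le:
  assumes p: "1 \<le> p" and m: "1 \<le> m" "real m < K * real p" "real m0 < 2 * real m" "1 \<le> m0"
    and h: "C_clamped * sqrt (real p / real m0) \<le> h"
  shows "clamped_threshold p m \<le> real m * (h / 2 - 9) - s * radius p * sqrt (real m)"
proof -
  define w where "w = sqrt (real p / real m)"
  have w: "0 < w" using p m by (simp add: w_def)
  have mw: "sqrt (real p) * sqrt (real m) = real m * w"
    using m by (simp add: w_def real_sqrt_divide field_simps)
  have w1: "1 \<le> sqrt K * w"
  proof -
    have "1 \<le> K * (real p / real m)" using m by (simp add: field_simps)
    then have "sqrt 1 \<le> sqrt (K * (real p / real m))" by (rule real_sqrt_le_mono)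
    then show ?thesis by (simp add: w_def real_sqrt_mult real_sqrt_divide)
  qed
  \<comment> \<open>The dyadic scale \<open>m\<close> lies within a factor 2 of \<open>m0\<close>;
    the generous 4 has a rational root.\<close>
  have "w \<le> sqrt (4 * (real p / real m0))"
    unfolding w_def using m p by (intro real_sqrt_le_mono) (simp add: field_simps)
  then have w2: "w \<le> 2 * sqrt (real p / real m0)" by (simp only: real_sqrt_mult real_sqrt_four)
  have "(36 * sqrt K + 8 * s * t + 2 * sqrt (64 * t\<^sup>2 + q)) * w \<le>
      (36 * sqrt K + 8 * s * t + 2 * sqrt (64 * t\<^sup>2 + q)) * (2 * sqrt (real p / real m0))"
    using w2 s_pos t_ge q_pos K_ge_1 by (intro mult_left_mono) auto
  also have "\<dots> = C_clamped * sqrt (real p / real m0)" by (simp add: C_clamped_def)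
  also note h
  finally have "36 * (sqrt K * w) + 8 * s * t * w + 2 * sqrt (64 * t\<^sup>2 + q) * w \<le> h"
    by (simp add: algebra_simps)
  then have "9 + sqrt (64 * t\<^sup>2 + q) * w \<le> h / 2 - 9 - 4 * s * t * w" using w1 by linarith
  then have key: "real m * (9 + sqrt (64 * t\<^sup>2 + q) * w) \<le> real m * (h / 2 - 9 - 4 * s * t * w)"
    by (intro mult_left_mono) auto
  have "4 * (radius p)\<^sup>2 * real m + q * real p * real m = (real p * real m) * (64 * t\<^sup>2 + q)"
    by (simp add: radius_def power_mult_distrib algebra_simps)
  then have "sqrt (4 * (radius p)\<^sup>2 * real m + q * real p * real m) = sqrt (real p) * sqrt (real m) * sqrt (64 * t\<^sup>2 + q)"
    by (simp only: real_sqrt_mult)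
  then have "clamped_threshold p m = real m * (9 + sqrt (64 * t\<^sup>2 + q) * w)"
    by (simp only: clamped_threshold_def mw) (simp add: algebra_simps)
  moreover have "s * radius p * sqrt (real m) = 4 * s * t * (sqrt (real p) * sqrt (real m))"
    by (simp add: radius_def)
  then have "real m * (h / 2 - 9) - s * radius p * sqrt (real m) = real m * (h / 2 - 9 - 4 * s * t * w)"
    by (simp only: mw) (simp add: algebra_simps)
  ultimately show ?thesis using key by simp
qed

lemma powr_mult_le:
  fixes c x e :: real
  assumes "1 \<le> c" "0 \<le> x" "0 \<le> e" "e \<le> 1"
  shows "(c * x) powr e \<le> c * x powr e"
  using powr_mono[of e 1 c] assms by (simp add: powr_mult mult_right_mono)

text \<open>A sum is at most twice the maximum, and the power of a maximum is at most the sum of the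
  powers; this separates the dimension from the iterated logarithm.\<close>

lemma weight_powr_le:
  assumes n: "3 \<le> n" and p: "1 \<le> p" and m: "1 \<le> m" "real m0 < 2 * real m" "1 \<le> m0" and e: "0 \<le> e" "e \<le> 1"
  shows "(weight p n m / real m) powr e \<le>
    24 * B * ((real p / real m0) powr e + (ln (ln (real n)) / real m0) powr e)"
proof -
  let ?x = "real p / real m0" and ?y = "ln (ln (real n)) / real m0"
  have xy: "0 \<le> ?x" "0 \<le> ?y" using ln_ln_pos[OF n] m by auto
  have "weight p n m / real m \<le> (6 * real p + B * ln (ln (real n))) / real m"
    using m by (intro divide_right_mono) (auto simp: weight_def)
  also have "\<dots> \<le> (6 * real p + B * ln (ln (real n))) / (real m0 / 2)"
    using m B_ge ln_ln_pos[OF n] by (intro divide_left_mono) auto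
  also have "\<dots> = 12 * ?x + 2 * B * ?y" by (simp add: add_divide_distrib algebra_simps)
  also have "\<dots> \<le> 12 * B * ?x + 12 * B * ?y"
    using xy B_ge by (intro add_mono mult_right_mono) auto
  also have "\<dots> \<le> max (24 * B * ?x) (24 * B * ?y)" by linarith
  finally have "(weight p n m / real m) powr e \<le> (max (24 * B * ?x) (24 * B * ?y)) powr e"
    using e weight_pos[OF n p, of m] by (intro powr_mono2) auto
  also have "\<dots> \<le> (24 * B * ?x) powr e + (24 * B * ?y) powr e"
    by (auto simp: max_def)
  also have "\<dots> \<le> 24 * B * ?x powr e + 24 * B * ?y powr e"
    using xy e B_ge by (intro add_mono powr_mult_le) auto
  finally show ?thesis by (simp add: algebra_simps)
qed

text \<open>The origin of the rate: with x = weight / m the required shift is of order x =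
  x^(1/\<alpha>) * x^((\<alpha> - 1)/\<alpha>), where the first factor is \<open>temper\<close> and
  the second is matched by \<open>h\<close>.\<close>

lemma clipped_shift_le:
  assumes n: "3 \<le> n" and p: "1 \<le> p" and m: "1 \<le> m" "real m0 < 2 * real m" "1 \<le> m0" and \<alpha>: "1 \<le> \<alpha>"
    and h: "C_clipped * ((real p / real m0) powr ((\<alpha> - 1) / \<alpha>) + (ln (ln (real n)) / real m0) powr ((\<alpha> - 1) / \<alpha>)) \<le> h"
  shows "2 * (65 * weight p n m + l\<epsilon>) / real m \<le> temper \<alpha> p n m * (3/8 * h)"
proof -
  define x where "x = weight p n m / real m"
  have w: "6 \<le> weight p n m" using weight_ge[OF n, of p m] p by linarith
  have x: "0 < x" using w m by (simp add: x_def)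
  have e: "0 \<le> (\<alpha> - 1) / \<alpha>" "(\<alpha> - 1) / \<alpha> \<le> 1" using \<alpha> by (auto simp: field_simps)
  have "16/3 * (65 + l\<epsilon>) * x powr ((\<alpha> - 1) / \<alpha>) \<le>
      16/3 * (65 + l\<epsilon>) * (24 * B * ((real p / real m0) powr ((\<alpha> - 1) / \<alpha>) + (ln (ln (real n)) / real m0) powr ((\<alpha> - 1) / \<alpha>)))"
    unfolding x_def using l\<epsilon>_pos by (intro mult_left_mono weight_powr_le n p m e) auto
  also have "\<dots> \<le> h" using h by (simp only: C_clipped_def mult.assoc)
  finally have hx: "16/3 * (65 + l\<epsilon>) * x powr ((\<alpha> - 1) / \<alpha>) \<le> h" .
  have "l\<epsilon> * 1 \<le> l\<epsilon> * weight p n m" using w l\<epsilon>_pos by (intro mult_left_mono) auto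
  then have "2 * (65 * weight p n m + l\<epsilon>) / real m \<le> 2 * ((65 + l\<epsilon>) * weight p n m) / real m"
    by (intro divide_right_mono) (auto simp: algebra_simps)
  also have "\<dots> = 2 * (65 + l\<epsilon>) * x" by (simp add: x_def)
  also have "x = x powr (1 / \<alpha>) * x powr ((\<alpha> - 1) / \<alpha>)"
    using x \<alpha> by (simp add: powr_add[symmetric] add_divide_distrib[symmetric])
  also have "2 * (65 + l\<epsilon>) * (x powr (1 / \<alpha>) * x powr ((\<alpha> - 1) / \<alpha>)) =
      temper \<alpha> p n m * (3/8 * (16/3 * (65 + l\<epsilon>) * x powr ((\<alpha> - 1) / \<alpha>)))"
    by (simp add: temper_def x_def)
  also have "\<dots> \<le> temper \<alpha> p n m * (3/8 * h)"
    using hx temper_pos[OF n p m(1), of \<alpha>] by (intro mult_left_mono) auto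
  finally show ?thesis .
qed

text \<open>1040 = 16 * 65 in \<open>weight\<close> limits its minimum term to m / 16 after
  multiplication by 65; \<open>K\<close> limits 390 p + \<open>l\<epsilon>\<close> to m / 16 as
  well.\<close>

lemma clipped_shift_small:
  assumes n: "3 \<le> n" and p: "1 \<le> p" and m: "K * real p \<le> real m"
  shows "2 * (65 * weight p n m + l\<epsilon>) / real m \<le> 1/4"
proof -
  have "16 * (390 + l\<epsilon>) * real p \<le> K * real p" using K_ge(1) by (intro mult_right_mono) auto
  then have "16 * (390 + l\<epsilon>) * real p \<le> real m" using m by linarith
  moreover have "l\<epsilon> * 1 \<le> l\<epsilon> * real p" using p l\<epsilon>_pos by (intro mult_left_mono) auto
  ultimately have "390 * real p + l\<epsilon> \<le> real m / 16" by (simp add: algebra_simps)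
  moreover have "weight p n m \<le> 6 * real p + real m / 1040" by (simp add: weight_def)
  ultimately have "65 * weight p n m + l\<epsilon> \<le> real m / 8" by simp
  moreover have "0 < real m"
    using m K_ge_1 p by (intro less_le_trans[OF _ m]) auto
  ultimately show ?thesis by (simp add: field_simps)
qed

text \<open>\<open>h1\<close> serves the clamped branch and \<open>h2\<close> the clipped one.
  \<open>small\<close> is the range that the first test may miss; it keeps the shift well inside
  \<open>radius\<close>.\<close>

lemma prob_scale_accept:
  assumes N: "noise_sample M N m p \<alpha>" and n: "3 \<le> n" and m: "1 \<le> m" "real m0 < 2 * real m" "1 \<le> m0"
    and h1: "C_clamped * sqrt (real p / real m0) \<le> nrm p d"
    and h2: "C_clipped * ((real p / real m0) powr ((\<alpha> - 1) / \<alpha>) + (ln (ln (real n)) / real m0) powr ((\<alpha> - 1) / \<alpha>)) \<le> nrm p d"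
    and small: "nrm p d < 2 * t * sqrt (real p)"
  shows "measure M {\<omega> \<in> space M. \<not> scale_reject \<alpha> p n m (noise_sample.shifted N p d \<omega>)} \<le> \<epsilon> / 8"
    (is "?P \<le> _")
proof -
  interpret noise_sample M N m p \<alpha> by (rule N)
  show ?thesis
  proof (cases "real m < K * real p")
    case True
    have "0 < C_clamped * sqrt (real p / real m0)" using C_nonneg(1) p m by simp
    then have d: "0 < nrm p d" using h1 by linarith
    have "82 * sqrt (real p) \<le> 2 * t * sqrt (real p)" using t_ge by (intro mult_right_mono) auto
    then have R: "nrm p d + 82 * sqrt (real p) \<le> radius p" using small by (simp add: radius_def)
    have "?P \<le> 4 / s\<^sup>2"
      unfolding scale_reject_def if_P[OF True]
      by (intro prob_clamped_accept radius_pos p s_pos m(1) d R clamped_threshold_le[OF p m(1) True m(2,3) h1])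
    also have "\<dots> = \<epsilon> / 8" using \<epsilon>_pos by (simp add: s_def)
    finally show ?thesis .
  next
    case False
    \<comment> \<open>Chosen so that m a / 2 = 65 weight + \<open>l\<epsilon>\<close>: it pays for
      the threshold 33 and the moment term 32 and leaves - \<open>l\<epsilon>\<close>.\<close>
    define a where "a = 2 * (65 * weight p n m + l\<epsilon>) / real m"
    have a0: "0 \<le> a" using weight_pos[OF n p, of m] l\<epsilon>_pos by (simp add: a_def)
    have a1: "a \<le> 1/4" unfolding a_def using False by (intro clipped_shift_small n p) auto
    have a2: "a \<le> temper \<alpha> p n m * (3/8 * nrm p d)"
      unfolding a_def by (rule clipped_shift_le[OF n p m \<alpha>(1) h2])
    have "?P \<le> exp (33 * weight p n m + real m * (- a + 2 * a\<^sup>2 + 32 * temper \<alpha> p n m powr \<alpha>))"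
      unfolding scale_reject_def if_not_P[OF False] by (intro prob_clipped_accept temper_pos n p m(1) a0 a1 a2)
    also have "\<dots> \<le> exp (- l\<epsilon>)"
    proof (subst exp_le_cancel_iff)
      have "a\<^sup>2 \<le> 1/4 * a" unfolding power2_eq_square using a0 a1 by (intro mult_right_mono) auto
      then have "real m * (- a + 2 * a\<^sup>2) \<le> real m * (- a / 2)" by (intro mult_left_mono) auto
      moreover have "real m * a = 2 * (65 * weight p n m + l\<epsilon>)" using m by (simp add: a_def)
      moreover have "real m * (32 * temper \<alpha> p n m powr \<alpha>) = 32 * weight p n m"
        using temper_powr[OF n p m(1) \<alpha>(1)] by simp
      ultimately show "33 * weight p n m + real m * (- a + 2 * a\<^sup>2 + 32 * temper \<alpha> p n m powr \<alpha>) \<le> - l\<epsilon>"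
        by (simp add: algebra_simps)
    qed
    also have "\<dots> = \<epsilon> / 8" using \<epsilon>_pos by (simp add: l\<epsilon>_def exp_minus)
    finally show ?thesis .
  qed
qed

end

section \<open>The combined test\<close>

definition signal_plus_noise ::
    "nat \<Rightarrow> nat \<Rightarrow> (nat \<Rightarrow> nat \<Rightarrow> real) \<Rightarrow> (nat \<Rightarrow> nat \<Rightarrow> real) \<Rightarrow> nat \<Rightarrow> nat \<Rightarrow> real" where
  "signal_plus_noise p n \<theta> E = (\<lambda>t\<in>{1..n}. \<lambda>i\<in>{1..p}. \<theta> t i + E t i)"

lemma measurable_signal_plus_noise: "signal_plus_noise p n \<theta> \<in> mat_borel p n \<rightarrow>\<^sub>M mat_borel p n"
proof -
  have "(\<lambda>E. \<lambda>t\<in>{1..n}. \<lambda>i\<in>{1..p}. \<theta> t i + E t i) \<in> mat_borel p n \<rightarrow>\<^sub>M (\<Pi>\<^sub>M t\<in>{1..n}. vec_borel p)"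
    by (intro measurable_restrict measurable_vec_borelI borel_measurable_add borel_measurable_const
        measurable_vec_borel_component[OF measurable_column])
  then show ?thesis by (simp add: signal_plus_noise_def[abs_def] mat_borel_def[symmetric])
qed

lemma nn_integral_data_law:
  assumes P: "sets P = sets (mat_borel p n)" and A: "Measurable.pred (mat_borel p n) A"
  shows "(\<integral>\<^sup>+X. ennreal (if A X then 1 else 0) \<partial>data_law p n \<theta> P) =
    emeasure P {E \<in> space P. A (signal_plus_noise p n \<theta> E)}"
proof -
  have meas: "signal_plus_noise p n \<theta> \<in> P \<rightarrow>\<^sub>M mat_borel p n"
    using measurable_signal_plus_noise by (simp add: measurable_cong_sets[OF P refl])
  have [measurable]: "Measurable.pred P (\<lambda>E. A (signal_plus_noise p n \<theta> E))"
    by (rule measurable_compose[OF meas A])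
  have "(\<integral>\<^sup>+X. ennreal (if A X then 1 else 0) \<partial>data_law p n \<theta> P) =
      (\<integral>\<^sup>+E. ennreal (if A (signal_plus_noise p n \<theta> E) then 1 else 0) \<partial>P)"
    unfolding data_law_def signal_plus_noise_def[symmetric] using A by (intro nn_integral_distr meas) measurable
  also have "\<dots> = (\<integral>\<^sup>+E. indicator {E \<in> space P. A (signal_plus_noise p n \<theta> E)} E \<partial>P)"
    by (intro nn_integral_cong) (auto simp: indicator_def)
  also have "\<dots> = emeasure P {E \<in> space P. A (signal_plus_noise p n \<theta> E)}"
    by (intro nn_integral_indicator) measurable
  finally show ?thesis .
qed

lemma column_diff_signal_plus_noise:
  assumes "i \<in> {1..n}" and "\<And>a. a \<in> {1..p} \<Longrightarrow> \<theta> i a - \<theta> (n + 1 - i) a = d a"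
  shows "column_diff p n (signal_plus_noise p n \<theta> E) i = (\<lambda>a\<in>{1..p}. d a + column_diff p n E i a)"
proof -
  have "n + 1 - i \<in> {1..n}" using assms(1) by auto
  then show ?thesis using assms by (auto simp: column_diff_def signal_plus_noise_def fun_eq_iff)
qed

lemma norm_reject_cong: "x 1 = y 1 \<Longrightarrow> norm_reject p t x \<longleftrightarrow> norm_reject p t y"
  by (simp add: norm_reject_def)

context error_level
begin

text \<open>Data differences agree with uniformly shifted noise only up to a limited index; the test
  at scale \<open>m\<close> looks no further.\<close>

lemma scale_reject_cong:
  assumes "\<And>i. i \<in> {1..m} \<Longrightarrow> x i = y i"
  shows "scale_reject \<alpha> p n m x \<longleftrightarrow> scale_reject \<alpha> p n m y"
proof -
  have "(\<Sum>i\<in>{1..m}. clamp p (radius p) (x i) a) = (\<Sum>i\<in>{1..m}. clamp p (radius p) (y i) a)" for a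
    using assms by (intro sum.cong) auto
  moreover have "(\<Sum>i\<in>{1..m}. clip (l * ip p (x i) v)) = (\<Sum>i\<in>{1..m}. clip (l * ip p (y i) v))" for l v
    using assms by (intro sum.cong) auto
  ultimately show ?thesis by (simp only: scale_reject_def clamped_reject_def clipped_reject_def)
qed

lemma pred_scale_reject:
  assumes "\<And>i. i \<in> {1..m} \<Longrightarrow> (\<lambda>\<omega>. x \<omega> i) \<in> M \<rightarrow>\<^sub>M vec_borel p"
  shows "Measurable.pred M (\<lambda>\<omega>. scale_reject \<alpha> p n m (x \<omega>))"
  unfolding scale_reject_def
  using pred_clamped_reject[where x = x, OF assms] pred_clipped_reject[where x = x, OF assms]
  by (cases "real m < K * real p") simp_all

section \<open>The combined test and its two error probabilities\<close>

definition reject :: "real \<Rightarrow> nat \<Rightarrow> nat \<Rightarrow> (nat \<Rightarrow> nat \<Rightarrow> real) \<Rightarrow> bool" where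
  "reject \<alpha> p n x \<longleftrightarrow> norm_reject p t x \<or> (\<exists>j\<in>scales n. scale_reject \<alpha> p n (2 ^ j) x)"

definition change_test :: "real \<Rightarrow> nat \<Rightarrow> nat \<Rightarrow> (nat \<Rightarrow> nat \<Rightarrow> real) \<Rightarrow> real" where
  "change_test \<alpha> p n X = (if reject \<alpha> p n (column_diff p n X) then 1 else 0)"

lemma pred_norm_reject_column_diff:
  "1 \<le> n \<Longrightarrow> Measurable.pred (mat_borel p n) (\<lambda>X. norm_reject p t (column_diff p n X))"
  by (intro pred_norm_reject measurable_column_diff) auto

lemma pred_scale_reject_column_diff:
  "j \<in> scales n \<Longrightarrow> Measurable.pred (mat_borel p n) (\<lambda>X. scale_reject \<alpha> p n (2 ^ j) (column_diff p n X))"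
  by (intro pred_scale_reject measurable_column_diff) (auto simp: scales_def)

lemma pred_reject:
  assumes "1 \<le> n"
  shows "Measurable.pred (mat_borel p n) (\<lambda>X. reject \<alpha> p n (column_diff p n X))"
  unfolding reject_def using assms
  by (intro pred_intros_logic pred_intros_finite finite_scales pred_norm_reject_column_diff pred_scale_reject_column_diff)

lemma is_test_change_test:
  assumes "1 \<le> n"
  shows "is_test p n (change_test \<alpha> p n)"
proof -
  note [measurable] = pred_reject[OF assms]
  show ?thesis unfolding is_test_def change_test_def[abs_def]
    by (rule measurable_If) auto
qed

text \<open>Equal columns cancel in every mirrored difference. The union bound gives \<epsilon> / 8
  for the first test and 3 \<epsilon> / 8 for all scales together.\<close>

lemma prob_reject_null_le:
  assumes P: "P \<in> indep_noise_class \<alpha> p n" and \<alpha>: "1 \<le> \<alpha>" "\<alpha> \<le> 2" and p: "1 \<le> p" and n: "3 \<le> n"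
    and \<theta>: "\<theta> \<in> null_space p n"
  shows "measure P {E \<in> space P. reject \<alpha> p n (column_diff p n (signal_plus_noise p n \<theta> E))} \<le> \<epsilon> / 2"
proof -
  interpret prob_space P using P by (simp add: indep_noise_class_def)
  have sets_P: "sets P = sets (mat_borel p n)" using P by (simp add: indep_noise_class_def)
  have meas: "signal_plus_noise p n \<theta> \<in> P \<rightarrow>\<^sub>M mat_borel p n"
    using measurable_signal_plus_noise by (simp add: measurable_cong_sets[OF sets_P refl])
  have zero: "column_diff p n (signal_plus_noise p n \<theta> E) i = (\<lambda>a\<in>{1..p}. 0 + column_diff p n E i a)"
    if "i \<in> {1..n}" for E i
  proof (rule column_diff_signal_plus_noise[OF that])
    have "n + 1 - i \<in> {1..n}" using that by auto
    then show "\<theta> i a - \<theta> (n + 1 - i) a = 0" for a using \<theta> that by (auto simp: null_space_def)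
  qed
  let ?x = "\<lambda>E. column_diff p n (signal_plus_noise p n \<theta> E)"
  let ?A = "{E \<in> space P. norm_reject p t (?x E)}"
  let ?S = "\<lambda>j. {E \<in> space P. scale_reject \<alpha> p n (2 ^ j) (?x E)}"
  have A: "?A \<in> events"
    using n by (intro predE measurable_compose[OF meas pred_norm_reject_column_diff]) auto
  have S: "?S j \<in> events" if "j \<in> scales n" for j
    using that by (intro predE measurable_compose[OF meas pred_scale_reject_column_diff])
  interpret N1: noise_sample P "\<lambda>i E. column_diff p n E i" 1 p \<alpha>
    using n by (intro noise_sample_column_diff P \<alpha> p) simp
  have shift: "?x E i = noise_sample.shifted (\<lambda>i E. column_diff p n E i) p (\<lambda>_. 0) E i" if "i \<in> {1..n}" for E i
    using zero[OF that] by (simp only: N1.shifted_def)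
  have "norm_reject p t (?x E) \<longleftrightarrow> norm_reject p t (noise_sample.shifted (\<lambda>i E. column_diff p n E i) p (\<lambda>_. 0) E)" for E
    using n by (intro norm_reject_cong shift) auto
  then have prob_A: "prob ?A \<le> \<epsilon> / 8"
    using N1.prob_norm_reject_null[of t] t_ge \<epsilon>_pos by (simp add: t_def)
  have prob_S: "prob (?S j) \<le> 9216 * t ^ 3 * sqrt K / q\<^sup>2 * (3/4) ^ j + 4 * 1040\<^sup>2 / K * (1/2) ^ j + exp (- (B * ln (ln (real n))))"
    if j: "j \<in> scales n" for j
  proof -
    have le: "2 * 2 ^ j \<le> n" using j by (simp add: scales_def)
    have "scale_reject \<alpha> p n (2 ^ j) (?x E) \<longleftrightarrow>
        scale_reject \<alpha> p n (2 ^ j) (noise_sample.shifted (\<lambda>i E. column_diff p n E i) p (\<lambda>_. 0) E)" for E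
      using le by (intro scale_reject_cong shift) auto
    then show ?thesis
      using prob_scale_reject_null[OF noise_sample_column_diff[OF P \<alpha> p le] refl n] by simp
  qed
  have "{E \<in> space P. reject \<alpha> p n (?x E)} \<subseteq> ?A \<union> (\<Union>j\<in>scales n. ?S j)"
    by (auto simp: reject_def)
  then have "prob {E \<in> space P. reject \<alpha> p n (?x E)} \<le> prob (?A \<union> (\<Union>j\<in>scales n. ?S j))"
    using A S finite_scales[of n] by (intro finite_measure_mono) auto
  also have "\<dots> \<le> prob ?A + prob (\<Union>j\<in>scales n. ?S j)"
    using A S finite_scales[of n] by (intro measure_Un_le) auto
  also have "\<dots> \<le> prob ?A + (\<Sum>j\<in>scales n. prob (?S j))"
    using S finite_scales[of n] by (intro add_left_mono finite_measure_subadditive_finite) auto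
  also have "\<dots> \<le> \<epsilon> / 8 + 3 * \<epsilon> / 8"
    using prob_A order_trans[OF sum_mono[OF prob_S] sum_scale_bounds[OF n]] by (intro add_mono)
  finally show ?thesis by simp
qed

text \<open>A single powerful component suffices: the first test if the shift is large, otherwise
  the dyadic scale just below the number of pairs known to straddle the change.\<close>

lemma prob_accept_alternative_le:
  assumes P: "P \<in> indep_noise_class \<alpha> p n" and \<alpha>: "1 \<le> \<alpha>" "\<alpha> \<le> 2" and p: "1 \<le> p" and n: "3 \<le> n"
    and t0: "t0 \<in> {1..n - 1}"
    and \<theta>: "\<theta> \<in> change_at p n t0 r"
    and r: "r \<ge> (C_clamped + C_clipped) *
         (sqrt (real p / real (min t0 (n - t0))) +
          (real p / real (min t0 (n - t0))) powr ((\<alpha> - 1) / \<alpha>) +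
          (ln (ln (real n)) / real (min t0 (n - t0))) powr ((\<alpha> - 1) / \<alpha>))"
  shows "measure P {E \<in> space P. \<not> reject \<alpha> p n (column_diff p n (signal_plus_noise p n \<theta> E))} \<le> \<epsilon> / 8"
proof -
  interpret prob_space P using P by (simp add: indep_noise_class_def)
  have sets_P: "sets P = sets (mat_borel p n)" using P by (simp add: indep_noise_class_def)
  have meas: "signal_plus_noise p n \<theta> \<in> P \<rightarrow>\<^sub>M mat_borel p n"
    using measurable_signal_plus_noise by (simp add: measurable_cong_sets[OF sets_P refl])
  \<comment> \<open>For i \<le> m0 column i lies before the change and column n + 1 - i after
    it.\<close>
  define m0 where "m0 = min t0 (n - t0)"
  have m0: "1 \<le> m0" "m0 \<le> t0" "m0 \<le> n - t0" "t0 \<le> n" using t0 by (auto simp: m0_def)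
  obtain \<mu>1 \<mu>2 where \<mu>: "\<And>i. i \<in> {1..t0} \<Longrightarrow> \<theta> i = \<mu>1" "\<And>i. i \<in> {t0 + 1..n} \<Longrightarrow> \<theta> i = \<mu>2"
    and gap: "r\<^sup>2 \<le> (nrm p (\<lambda>a. \<mu>1 a - \<mu>2 a))\<^sup>2"
    using \<theta> by (auto simp: change_at_def)
  define d where "d a = \<mu>1 a - \<mu>2 a" for a
  let ?u = "sqrt (real p / real m0)"
  let ?v = "(real p / real m0) powr ((\<alpha> - 1) / \<alpha>) + (ln (ln (real n)) / real m0) powr ((\<alpha> - 1) / \<alpha>)"
  have uv: "0 \<le> ?u" "0 \<le> ?v" by (auto intro: add_nonneg_nonneg)
  have r': "(C_clamped + C_clipped) * (?u + ?v) \<le> r" using r by (simp add: m0_def add.assoc)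
  have "0 \<le> (C_clamped + C_clipped) * (?u + ?v)"
    using C_nonneg uv by (intro mult_nonneg_nonneg) auto
  then have "0 \<le> r" using r' by linarith
  then have rd: "r \<le> nrm p d"
    using gap by (auto simp: d_def[abs_def] intro: power2_le_imp_le)
  have h1: "C_clamped * ?u \<le> nrm p d" and h2: "C_clipped * ?v \<le> nrm p d"
  proof -
    have "(C_clamped + C_clipped) * (?u + ?v) = C_clamped * ?u + C_clamped * ?v + C_clipped * ?u + C_clipped * ?v"
      by (simp only: algebra_simps)
    moreover have "0 \<le> C_clamped * ?u" "0 \<le> C_clamped * ?v" "0 \<le> C_clipped * ?u" "0 \<le> C_clipped * ?v"
      using C_nonneg uv by (intro mult_nonneg_nonneg; simp)+
    ultimately show "C_clamped * ?u \<le> nrm p d" "C_clipped * ?v \<le> nrm p d" using r' rd by linarith+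
  qed
  have shift: "column_diff p n (signal_plus_noise p n \<theta> E) i = (\<lambda>a\<in>{1..p}. d a + column_diff p n E i a)"
    if "i \<in> {1..m0}" for E i
  proof (rule column_diff_signal_plus_noise)
    show "i \<in> {1..n}" using that m0 by auto
    have "i \<in> {1..t0}" "n + 1 - i \<in> {t0 + 1..n}" using that m0 by auto
    then show "\<theta> i a - \<theta> (n + 1 - i) a = d a" for a using \<mu> by (simp add: d_def)
  qed
  let ?x = "\<lambda>E. column_diff p n (signal_plus_noise p n \<theta> E)"
  have accept_le: "prob {E \<in> space P. \<not> reject \<alpha> p n (?x E)} \<le> prob {E \<in> space P. \<not> norm_reject p t (?x E)}"
    using n by (intro finite_measure_mono predE pred_intros_logic measurable_compose[OF meas pred_norm_reject_column_diff])
      (auto simp: reject_def)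
  show ?thesis
  proof (cases "2 * t * sqrt (real p) \<le> nrm p d")
    case True
    interpret N1: noise_sample P "\<lambda>i E. column_diff p n E i" 1 p \<alpha>
      using n by (intro noise_sample_column_diff P \<alpha> p) simp
    have "norm_reject p t (?x E) \<longleftrightarrow> norm_reject p t (N1.shifted d E)" for E
      using m0 by (intro norm_reject_cong) (simp only: N1.shifted_def, intro shift, auto)
    then show ?thesis using accept_le N1.prob_norm_accept[OF _ _ True] t_ge \<epsilon>_pos by (simp add: t_def)
  next
    case False
    obtain j where j: "2 ^ j \<le> m0" "m0 < 2 ^ (j + 1)" using ex_power_ivl1[of 2 m0] m0 by auto
    have le: "2 * 2 ^ j \<le> n" using j m0 by linarith
    then have js: "j \<in> scales n" by (simp add: scales_def)
    interpret Nm: noise_sample P "\<lambda>i E. column_diff p n E i" "2 ^ j" p \<alpha>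
      by (rule noise_sample_column_diff[OF P \<alpha> p le])
    have "prob {E \<in> space P. \<not> reject \<alpha> p n (?x E)} \<le> prob {E \<in> space P. \<not> scale_reject \<alpha> p n (2 ^ j) (?x E)}"
      using js by (intro finite_measure_mono predE pred_intros_logic measurable_compose[OF meas pred_scale_reject_column_diff])
        (auto simp: reject_def)
    also have "\<dots> = prob {E \<in> space P. \<not> scale_reject \<alpha> p n (2 ^ j) (Nm.shifted d E)}"
    proof -
      have "scale_reject \<alpha> p n (2 ^ j) (?x E) \<longleftrightarrow> scale_reject \<alpha> p n (2 ^ j) (Nm.shifted d E)" for E
        using j by (intro scale_reject_cong) (simp only: Nm.shifted_def, intro shift, auto)
      then show ?thesis by simp
    qed
    also have "\<dots> \<le> \<epsilon> / 8"
    proof (rule prob_scale_accept[OF Nm.noise_sample_axioms n _ _ m0(1) h1 h2])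
      have "m0 < 2 * 2 ^ j" using j by (simp add: power_add mult.commute)
      then have "real m0 < real (2 * 2 ^ j)" by (simp only: of_nat_less_iff)
      then show "real m0 < 2 * real (2 ^ j)" by simp
    qed (use False in auto)
    finally show ?thesis .
  qed
qed

end

theorem theorem13:
  fixes \<alpha> \<epsilon> :: real
  assumes "1 \<le> \<alpha>" and "\<alpha> \<le> 2" and "0 < \<epsilon>" and "\<epsilon> < 1"
  shows "\<exists>C::real. C > 0 \<and>
    (\<forall>(n::nat) (p::nat) (\<rho>::nat \<Rightarrow> real). n \<ge> 3 \<longrightarrow> p \<ge> 1 \<longrightarrow>
      (\<forall>t0\<in>{1..n-1}. \<rho> t0 \<ge> C *
         (sqrt (real p / real (min t0 (n - t0))) +
          (real p / real (min t0 (n - t0))) powr ((\<alpha> - 1) / \<alpha>) +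
          (ln (ln (real n)) / real (min t0 (n - t0))) powr ((\<alpha> - 1) / \<alpha>))) \<longrightarrow>
      (\<exists>\<phi>. is_test p n \<phi> \<and> testing_error \<alpha> p n \<rho> \<phi> \<le> ennreal \<epsilon>))"
proof -
  interpret error_level \<epsilon> using assms by unfold_locales
  show ?thesis
  \<comment> \<open>The sum lets one hypothesis supply the separation for both branches; both
    summands depend on \<epsilon> alone.\<close>
  proof (intro exI[of _ "C_clamped + C_clipped"] conjI allI impI)
    show "0 < C_clamped + C_clipped" using C_nonneg by simp
    fix n p :: nat and \<rho> :: "nat \<Rightarrow> real"
    assume n: "3 \<le> n" and p: "1 \<le> p"
      and \<rho>: "\<forall>t0\<in>{1..n-1}. \<rho> t0 \<ge> (C_clamped + C_clipped) *
         (sqrt (real p / real (min t0 (n - t0))) +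
          (real p / real (min t0 (n - t0))) powr ((\<alpha> - 1) / \<alpha>) +
          (ln (ln (real n)) / real (min t0 (n - t0))) powr ((\<alpha> - 1) / \<alpha>))"
    have pred: "Measurable.pred (mat_borel p n) (\<lambda>X. reject \<alpha> p n (column_diff p n X))"
      using n by (intro pred_reject) auto
    have "(SUP P\<in>indep_noise_class \<alpha> p n. SUP \<theta>\<in>null_space p n.
        \<integral>\<^sup>+X. ennreal (change_test \<alpha> p n X) \<partial>data_law p n \<theta> P) \<le> ennreal (\<epsilon> / 2)"
    proof (intro SUP_least)
      fix P \<theta> assume P: "P \<in> indep_noise_class \<alpha> p n" and \<theta>: "\<theta> \<in> null_space p n"
      interpret prob_space P using P by (simp add: indep_noise_class_def)
      have sets_P: "sets P = sets (mat_borel p n)" using P by (simp add: indep_noise_class_def)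
      show "(\<integral>\<^sup>+X. ennreal (change_test \<alpha> p n X) \<partial>data_law p n \<theta> P) \<le> ennreal (\<epsilon> / 2)"
        unfolding change_test_def nn_integral_data_law[OF sets_P pred] emeasure_eq_measure
        by (intro ennreal_leI prob_reject_null_le P assms p n \<theta>)
    qed
    moreover have "(SUP P\<in>indep_noise_class \<alpha> p n. SUP \<theta>\<in>alternative p n \<rho>.
        \<integral>\<^sup>+X. ennreal (1 - change_test \<alpha> p n X) \<partial>data_law p n \<theta> P) \<le> ennreal (\<epsilon> / 2)"
    proof (intro SUP_least)
      fix P \<theta> assume P: "P \<in> indep_noise_class \<alpha> p n" and "\<theta> \<in> alternative p n \<rho>"
      then obtain t0 where t0: "t0 \<in> {1..n - 1}" and \<theta>: "\<theta> \<in> change_at p n t0 (\<rho> t0)"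
        by (auto simp: alternative_def)
      interpret prob_space P using P by (simp add: indep_noise_class_def)
      have sets_P: "sets P = sets (mat_borel p n)" using P by (simp add: indep_noise_class_def)
      have eq: "1 - change_test \<alpha> p n X = (if \<not> reject \<alpha> p n (column_diff p n X) then 1 else 0)" for X
        by (simp add: change_test_def)
      have "prob {E \<in> space P. \<not> reject \<alpha> p n (column_diff p n (signal_plus_noise p n \<theta> E))} \<le> \<epsilon> / 8"
        using \<rho> t0 by (intro prob_accept_alternative_le[OF P _ _ p n t0 \<theta>] assms) auto
      also have "\<dots> \<le> \<epsilon> / 2" using assms by simp
      finally show "(\<integral>\<^sup>+X. ennreal (1 - change_test \<alpha> p n X) \<partial>data_law p n \<theta> P) \<le> ennreal (\<epsilon> / 2)"
        unfolding eq nn_integral_data_law[OF sets_P pred_intros_logic(2)[OF pred]] emeasure_eq_measure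
        by (rule ennreal_leI)
    qed
    ultimately have "testing_error \<alpha> p n \<rho> (change_test \<alpha> p n) \<le> ennreal (\<epsilon> / 2) + ennreal (\<epsilon> / 2)"
      unfolding testing_error_def by (rule add_mono)
    also have "\<dots> = ennreal \<epsilon>" using assms by (simp flip: ennreal_plus)
    finally show "\<exists>\<phi>. is_test p n \<phi> \<and> testing_error \<alpha> p n \<rho> \<phi> \<le> ennreal \<epsilon>"
      using is_test_change_test[of n p \<alpha>] n by auto
  qed
qed

end
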